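(* For every integer $n\ge 2$: (1) No nonempty open subset of $L_n$ is a trapped family of rays. (2) There exists a trap in $\mathbb{R}^n$ that traps a family of rays of dimension $2n-3$ in $L_n$. Thus the largest possible dimension of a trapped family of rays in $\mathbb{R}^n$ is $2n-3$.
   Context: $L_n=\{(u,p): u\in S^{n-1},\ p\in u^\perp\}$ is the space of oriented lines in $\mathbb{R}^n$; $(u,p)$ represents the line $p+\mathbb{R}u$ traversed in direction $u$. It is a smooth manifold of dimension $2n-2$. A trap is a finite collection of compact embedded $C^\infty$ hypersurfaces (the mirrors, each possibly with boundary) in $\mathbb{R}^n$. Rays move along straight lines at unit speed and are reflected specularly (angle of incidence equals angle of reflection) at interior points of the mirrors. A trajectory is nonsingular if it has no tangential collisions with the mirrors, no collisions with the boundaries of the mirrors, no multiple collisions (simultaneous collisions with more than one mirror), and no accumulation of collisions in finite time. Let $F\subset L_n$ be a smooth embedded submanifold. $F$ is a trapped family of rays (trapped by a given trap) if there is a ball $B_R$ containing the trap in its interior such that, for every $\ell\in F$, the billiard trajectory coming from infinity along $\ell$ enters $B_R$, remains within $B_R$ for all subsequent time, and is nonsingular. An open subset of $L_n$ is regarded as an embedded submanifold of dimension $2n-2$. *)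

theory Defs
  imports "HOL-Analysis.Analysis"
begin

subsection \<open>Smooth maps and embedded submanifolds of Euclidean space\<close>

text \<open>Only used for open \<open>S\<close>.  In finite dimensions \<open>Ck_on k S f\<close> is the usual
  \<open>C\<^sup>k\<close> condition: all directional derivatives are again \<open>C\<^sup>k\<^sup>-\<^sup>1\<close>.\<close>

primrec Ck_on ::
  "nat \<Rightarrow> 'a::real_normed_vector set \<Rightarrow> ('a \<Rightarrow> 'b::real_normed_vector) \<Rightarrow> bool" where
  "Ck_on 0 S f \<longleftrightarrow> continuous_on S f"
| "Ck_on (Suc k) S f \<longleftrightarrow> (\<forall>x\<in>S. f differentiable (at x)) \<and>
     (\<forall>v. Ck_on k S (\<lambda>x. frechet_derivative f (at x) v))"

definition smooth_on ::
  "'a::real_normed_vector set \<Rightarrow> ('a \<Rightarrow> 'b::real_normed_vector) \<Rightarrow> bool" where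
  "smooth_on S f \<longleftrightarrow> (\<forall>k. Ck_on k S f)"

definition diffeomorphism ::
  "'a::real_normed_vector set \<Rightarrow> 'a set \<Rightarrow> ('a \<Rightarrow> 'a) \<Rightarrow> ('a \<Rightarrow> 'a) \<Rightarrow> bool" where
  "diffeomorphism U V \<phi> \<psi> \<longleftrightarrow>
     open U \<and> open V \<and> homeomorphism U V \<phi> \<psi> \<and> smooth_on U \<phi> \<and> smooth_on V \<psi>"

text \<open>Slice charts: near an interior point \<open>M\<close> is a \<open>d\<close>-dimensional linear slice, near a
  boundary point it is a half-slice with the point on its edge.\<close>

definition manifold_interior :: "nat \<Rightarrow> 'a::euclidean_space set \<Rightarrow> 'a set" where
  "manifold_interior d M = {x \<in> M. \<exists>U V \<phi> \<psi> S.
     diffeomorphism U V \<phi> \<psi> \<and> x \<in> U \<and> subspace S \<and> dim S = d \<and>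
     \<phi> ` (U \<inter> M) = V \<inter> S}"

definition manifold_boundary :: "nat \<Rightarrow> 'a::euclidean_space set \<Rightarrow> 'a set" where
  "manifold_boundary d M = {x \<in> M. \<exists>U V \<phi> \<psi> S b.
     diffeomorphism U V \<phi> \<psi> \<and> x \<in> U \<and> subspace S \<and> dim S = d \<and>
     b \<in> S \<and> b \<noteq> 0 \<and> b \<bullet> \<phi> x = 0 \<and>
     \<phi> ` (U \<inter> M) = V \<inter> {y \<in> S. 0 \<le> b \<bullet> y}}"

definition embedded_submanifold :: "nat \<Rightarrow> 'a::euclidean_space set \<Rightarrow> bool" where
  "embedded_submanifold d M \<longleftrightarrow> M \<subseteq> manifold_interior d M"

definition embedded_submanifold_with_boundary :: "nat \<Rightarrow> 'a::euclidean_space set \<Rightarrow> bool" where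
  "embedded_submanifold_with_boundary d M \<longleftrightarrow>
     M \<subseteq> manifold_interior d M \<union> manifold_boundary d M"


subsection \<open>Traps\<close>

definition mirror :: "'a::euclidean_space set \<Rightarrow> bool" where
  "mirror M \<longleftrightarrow> compact M \<and> embedded_submanifold_with_boundary (DIM('a) - 1) M"

definition mirror_interior :: "'a::euclidean_space set \<Rightarrow> 'a set" where
  "mirror_interior M = manifold_interior (DIM('a) - 1) M"

definition mirror_boundary :: "'a::euclidean_space set \<Rightarrow> 'a set" where
  "mirror_boundary M = manifold_boundary (DIM('a) - 1) M"

definition trap :: "'a::euclidean_space set set \<Rightarrow> bool" where
  "trap T \<longleftrightarrow> finite T \<and> (\<forall>M\<in>T. mirror M)"


subsection \<open>Billiard trajectories\<close>

text \<open>Velocities of smooth curves in \<open>M\<close>; only used at interior points of a mirror, where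
  this is the usual tangent hyperplane.\<close>

definition tangent_space :: "'a::euclidean_space set \<Rightarrow> 'a \<Rightarrow> 'a set" where
  "tangent_space M x = {v. \<exists>c \<epsilon>. (0::real) < \<epsilon> \<and> smooth_on {-\<epsilon><..<\<epsilon>} c \<and>
     c ` {-\<epsilon><..<\<epsilon>} \<subseteq> M \<and> c 0 = x \<and> (c has_vector_derivative v) (at 0)}"

definition unit_normal :: "'a::euclidean_space set \<Rightarrow> 'a \<Rightarrow> 'a \<Rightarrow> bool" where
  "unit_normal M x \<nu> \<longleftrightarrow> norm \<nu> = 1 \<and> (\<forall>v\<in>tangent_space M x. \<nu> \<bullet> v = 0)"

text \<open>A path is defined for all times, is parametrised by arc length, and near each time is
  either straight or a straight segment followed by its specular reflection.\<close>

definition moves_freely :: "(real \<Rightarrow> 'a::euclidean_space) \<Rightarrow> real \<Rightarrow> bool" where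
  "moves_freely \<gamma> t \<longleftrightarrow>
     (\<exists>v. norm v = 1 \<and> (\<forall>\<^sub>F s in nhds t. \<gamma> s = \<gamma> t + (s - t) *\<^sub>R v))"

text \<open>The condition \<open>v \<bullet> \<nu> \<noteq> 0\<close> says that the collision is not tangential.\<close>

definition reflects_transversally ::
  "'a::euclidean_space set \<Rightarrow> (real \<Rightarrow> 'a) \<Rightarrow> real \<Rightarrow> bool" where
  "reflects_transversally M \<gamma> t \<longleftrightarrow>
     (\<exists>v \<nu>. norm v = 1 \<and> unit_normal M (\<gamma> t) \<nu> \<and> v \<bullet> \<nu> \<noteq> 0 \<and>
        (\<forall>\<^sub>F s in at_left t. \<gamma> s = \<gamma> t + (s - t) *\<^sub>R v) \<and>
        (\<forall>\<^sub>F s in at_right t. \<gamma> s = \<gamma> t + (s - t) *\<^sub>R (v - (2 * (v \<bullet> \<nu>)) *\<^sub>R \<nu>)))"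

definition nonsingular_trajectory ::
  "'a::euclidean_space set set \<Rightarrow> (real \<Rightarrow> 'a) \<Rightarrow> bool" where
  "nonsingular_trajectory T \<gamma> \<longleftrightarrow>
     (\<forall>t. \<gamma> t \<notin> \<Union>T \<longrightarrow> moves_freely \<gamma> t) \<and>
     (\<forall>t. \<forall>M\<in>T. \<gamma> t \<in> M \<longrightarrow>
        \<gamma> t \<in> mirror_interior M \<and> \<gamma> t \<notin> mirror_boundary M \<and>
        (\<forall>M'\<in>T. \<gamma> t \<in> M' \<longrightarrow> M' = M) \<and>
        reflects_transversally M \<gamma> t) \<and>
     (\<forall>a b. finite {t \<in> {a..b}. \<gamma> t \<in> \<Union>T})"


subsection \<open>Oriented lines and trapped families of rays\<close>

text \<open>\<open>(u, p)\<close> is the line \<open>p + \<real>u\<close> traversed in direction \<open>u\<close>; the topology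
  and smooth structure are inherited from the ambient Euclidean space \<open>'a \<times> 'a\<close>.\<close>

definition oriented_lines :: "('a::euclidean_space \<times> 'a) set" where
  "oriented_lines = {(u, p). norm u = 1 \<and> p \<bullet> u = 0}"

definition comes_from_infinity_along :: "'a::euclidean_space \<times> 'a \<Rightarrow> (real \<Rightarrow> 'a) \<Rightarrow> bool" where
  "comes_from_infinity_along l \<gamma> \<longleftrightarrow>
     (\<forall>\<^sub>F t in at_bot. \<gamma> t = snd l + t *\<^sub>R fst l)"

text \<open>The time \<open>t\<^sub>0\<close> is when the trajectory enters the closed ball \<open>B\<close>.\<close>

definition enters_and_remains_in :: "'a set \<Rightarrow> (real \<Rightarrow> 'a) \<Rightarrow> bool" where
  "enters_and_remains_in B \<gamma> \<longleftrightarrow>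
     (\<exists>t\<^sub>0. (\<forall>t<t\<^sub>0. \<gamma> t \<notin> B) \<and> (\<forall>t\<ge>t\<^sub>0. \<gamma> t \<in> B))"

text \<open>Submanifolds of \<open>oriented_lines\<close>, itself embedded in \<open>'a \<times> 'a\<close>, are
  the submanifolds of \<open>'a \<times> 'a\<close> contained in it.\<close>

definition submanifold_of_lines :: "nat \<Rightarrow> ('a::euclidean_space \<times> 'a) set \<Rightarrow> bool" where
  "submanifold_of_lines d F \<longleftrightarrow> F \<subseteq> oriented_lines \<and> embedded_submanifold d F"

text \<open>The smoothness and dimension of \<open>F\<close> are expressed separately by
  \<open>submanifold_of_lines\<close>; they are automatic for relatively open \<open>F\<close>.  A single ball
  serves all rays of \<open>F\<close>.\<close>

definition trapped_family ::
  "'a::euclidean_space set set \<Rightarrow> ('a \<times> 'a) set \<Rightarrow> bool" where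
  "trapped_family T F \<longleftrightarrow> F \<subseteq> oriented_lines \<and>
     (\<exists>c R. 0 < R \<and> \<Union>T \<subseteq> interior (cball c R) \<and>
        (\<forall>l\<in>F. \<exists>\<gamma>. nonsingular_trajectory T \<gamma> \<and> comes_from_infinity_along l \<gamma> \<and>
           enters_and_remains_in (cball c R) \<gamma>))"

end

(*
  Upper bound.  The billiard flow preserves Lebesgue measure of phase space: near a transversal
  collision it is, up to free flights (which are shears), the collision map back-propagated along
  the new direction, and at the mirror the derivative of that map is block triangular with
  the reflection in both diagonal blocks.  If an open set of rays were trapped, an open set of incoming
  phase points would, after times k D with D large, have disjoint images of equal positive measure
  inside a bounded set.  By invariance of domain a submanifold of top dimension contains an open
  set of rays.

  Construction.  In the oblate ellipsoid |x|^2 / 2 + z^2 = 1 every chord meeting the focal sphere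
  |x| = 1, z = 0 is reflected to a chord meeting the focal sphere; if d and d' are the distances
  from the mirror point at height z to the two focal points, then d d' = 1 + z^2.  Hence a ray crossing
  the focal sphere outwards keeps doing so with ever smaller slope, and never comes back
  to the height z = 1/2 above which the ellipsoid has been removed.  Rays through the focal sphere
  form a hypersurface in the space of lines, and the nearly vertical ones enter through the hole.
*)
theory Submission
  imports Defs
begin

text \<open>The speed is left free: an open set of rays, thickened by the starting point on the ray
  and by speeds between 1 and 2, becomes an open set of pairs (position, velocity), to which
  Lebesgue measure applies directly. The obstacle is that the flow at a fixed time is not
  continuous, since the velocity jumps at a collision. The starting set is therefore cut, for each
  time, by the number of earlier collisions. Near a point of a piece, the flow agrees on that piece
  with a map that is differentiable at the point with derivative of determinant 1 or -1, and change
  of variables asks only for derivatives within the piece. Injectivity and disjointness come from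
  running paths backwards, which is deterministic through collisions because a reflection is
  invertible. In the construction the motion becomes an iteration on pairs (focal point, direction).
  The thresholds 1/2 and 99/100 are chosen with room to spare, so that after one bounce the ray
  leaves the focal sphere outwards with slope at most 1/2; this condition reproduces itself and
  keeps every later collision strictly below the rim.\<close>

section \<open>Calculus of smooth maps\<close>

lemma Ck_on_SucD: "Ck_on (Suc k) S f \<Longrightarrow> Ck_on k S f"
proof (induction k arbitrary: f)
  case 0
  then show ?case
    by (metis Ck_on.simps continuous_at_imp_continuous_on differentiable_imp_continuous_within)
next
  case (Suc k)
  then show ?case by simp
qed

lemma Ck_on_cong:
  assumes "open S" "\<And>x. x \<in> S \<Longrightarrow> f x = g x" "Ck_on k S f"
  shows "Ck_on k S g"
  using assms
proof (induction k arbitrary: f g)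
  case 0
  then show ?case using continuous_on_cong by force
next
  case (Suc k)
  have *: "(g has_derivative frechet_derivative f (at x)) (at x)" if "x \<in> S" for x
  proof (rule has_derivative_transform_within_open[of f _ x UNIV S])
    show "(f has_derivative frechet_derivative f (at x)) (at x)"
      using Suc.prems that frechet_derivative_works by auto
  qed (use Suc.prems that in auto)
  then have eq: "frechet_derivative f (at x) = frechet_derivative g (at x)" if "x \<in> S" for x
    using frechet_derivative_at that by blast
  have "Ck_on k S (\<lambda>x. frechet_derivative g (at x) v)" for v
  proof (rule Suc.IH)
    show "Ck_on k S (\<lambda>x. frechet_derivative f (at x) v)"
      using Suc.prems(3) by simp
    show "frechet_derivative f (at x) v = frechet_derivative g (at x) v" if "x \<in> S" for x
      by (simp only: eq[OF that])
  qed fact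
  moreover have "g differentiable (at x)" if "x \<in> S" for x
    using * that differentiable_def by blast
  ultimately show ?case by simp
qed

text \<open>Lets an explicit derivative formula stand in for \<open>frechet_derivative\<close>;
  every closure property below is an induction on \<open>k\<close> through this rule.\<close>

lemma Ck_on_SucI:
  assumes "open S" "\<And>x. x \<in> S \<Longrightarrow> (f has_derivative f' x) (at x)"
    and "\<And>v. Ck_on k S (\<lambda>x. f' x v)"
  shows "Ck_on (Suc k) S f"
proof -
  have eq: "f' x = frechet_derivative f (at x)" if "x \<in> S" for x
    using frechet_derivative_at[OF assms(2)[OF that]] .
  have "Ck_on k S (\<lambda>x. frechet_derivative f (at x) v)" for v
  proof (rule Ck_on_cong[OF assms(1) _ assms(3)])
    show "f' x v = frechet_derivative f (at x) v" if "x \<in> S" for x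
      by (simp only: eq[OF that])
  qed
  moreover have "f differentiable (at x)" if "x \<in> S" for x
    using assms that differentiable_def by blast
  ultimately show ?thesis by simp
qed

lemma Ck_on_derivative:
  "Ck_on (Suc k) S f \<Longrightarrow> x \<in> S \<Longrightarrow> (f has_derivative frechet_derivative f (at x)) (at x)"
  using frechet_derivative_works by auto

lemma Ck_on_subset: "Ck_on k S f \<Longrightarrow> T \<subseteq> S \<Longrightarrow> Ck_on k T f"
  by (induction k arbitrary: f) (auto intro: continuous_on_subset)

lemma Ck_on_const: "open S \<Longrightarrow> Ck_on k S (\<lambda>x. c)"
proof (induction k arbitrary: c)
  case (Suc k)
  then show ?case by (intro Ck_on_SucI[where f'="\<lambda>x v. 0"]) auto
qed auto

lemma Ck_on_bounded_linear:
  assumes "open S" "bounded_linear L" "Ck_on k S f"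
  shows "Ck_on k S (\<lambda>x. L (f x))"
  using assms(3)
proof (induction k arbitrary: f)
  case 0
  then show ?case using assms(2) by (simp add: bounded_linear.continuous_on)
next
  case (Suc k)
  then show ?case
    by (intro Ck_on_SucI[where f'="\<lambda>x v. L (frechet_derivative f (at x) v)"])
      (auto intro!: assms bounded_linear.has_derivative[OF assms(2)] Ck_on_derivative)
qed

lemma Ck_on_ident: "open S \<Longrightarrow> Ck_on k S (\<lambda>x. x)"
  by (cases k) (auto intro!: continuous_on_id Ck_on_SucI[where f'="\<lambda>x v. v"] Ck_on_const simp del: Ck_on.simps(2))

lemma Ck_on_add:
  assumes "open S" "Ck_on k S f" "Ck_on k S g"
  shows "Ck_on k S (\<lambda>x. f x + g x)"
  using assms(2,3)
proof (induction k arbitrary: f g)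
  case (Suc k)
  then show ?case
    by (intro Ck_on_SucI[where f'="\<lambda>x v. frechet_derivative f (at x) v + frechet_derivative g (at x) v"])
      (auto intro!: assms has_derivative_add Ck_on_derivative)
qed (auto intro: continuous_on_add)

lemma Ck_on_bilinear:
  assumes "open S" "bounded_bilinear B" "Ck_on k S f" "Ck_on k S g"
  shows "Ck_on k S (\<lambda>x. B (f x) (g x))"
  using assms(3,4)
proof (induction k arbitrary: f g)
  case 0
  then show ?case using assms(2) by (simp add: bounded_bilinear.continuous_on)
next
  case (Suc k)
  note D = Ck_on_SucD[OF Suc.prems(1)] Ck_on_SucD[OF Suc.prems(2)]
  show ?case
  proof (rule Ck_on_SucI[where f'="\<lambda>x v. B (f x) (frechet_derivative g (at x) v) + B (frechet_derivative f (at x) v) (g x)"])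
    show "((\<lambda>x. B (f x) (g x)) has_derivative
        (\<lambda>v. B (f x) (frechet_derivative g (at x) v) + B (frechet_derivative f (at x) v) (g x))) (at x)"
      if "x \<in> S" for x
      using Suc.prems that
      by (intro bounded_bilinear.FDERIV[OF assms(2)] Ck_on_derivative)
  qed (use assms Suc D in \<open>auto intro!: Ck_on_add\<close>)
qed

text \<open>The derivative of 1/f is a product of f' and copies of 1/f itself, so the induction on
  \<open>k\<close> closes.\<close>

lemma Ck_on_inverse:
  fixes f :: "'a::real_normed_vector \<Rightarrow> real"
  assumes "open S" "Ck_on k S f" "\<And>x. x \<in> S \<Longrightarrow> f x \<noteq> 0"
  shows "Ck_on k S (\<lambda>x. inverse (f x))"
  using assms(2)
proof (induction k)
  case 0
  then show ?case using assms by (auto intro: continuous_on_inverse)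
next
  case (Suc k)
  note I = Suc.IH[OF Ck_on_SucD[OF Suc.prems]]
  show ?case
  proof (rule Ck_on_SucI[where f'="\<lambda>x v. - (inverse (f x) * frechet_derivative f (at x) v * inverse (f x))"])
    show "((\<lambda>x. inverse (f x)) has_derivative
        (\<lambda>v. - (inverse (f x) * frechet_derivative f (at x) v * inverse (f x)))) (at x)"
      if "x \<in> S" for x
      using Suc.prems that assms by (intro Deriv.has_derivative_inverse Ck_on_derivative) auto
    show "Ck_on k S (\<lambda>x. - (inverse (f x) * frechet_derivative f (at x) v * inverse (f x)))" for v
      using Suc.prems I assms(1)
      by (intro Ck_on_bounded_linear[of S uminus] Ck_on_bilinear[OF _ bounded_bilinear_mult]
          bounded_linear_minus bounded_linear_ident) auto
  qed fact
qed

text \<open>As for the inverse: the derivative is f' times the inverse of the square root, which is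
  of class \<open>k\<close> by the induction hypothesis.\<close>

lemma Ck_on_sqrt:
  fixes f :: "'a::real_normed_vector \<Rightarrow> real"
  assumes "open S" "Ck_on k S f" "\<And>x. x \<in> S \<Longrightarrow> f x > 0"
  shows "Ck_on k S (\<lambda>x. sqrt (f x))"
  using assms(2)
proof (induction k)
  case 0
  then show ?case by (auto intro: continuous_on_real_sqrt)
next
  case (Suc k)
  note I = Suc.IH[OF Ck_on_SucD[OF Suc.prems]]
  show ?case
  proof (rule Ck_on_SucI[where f'="\<lambda>x v. frechet_derivative f (at x) v * (inverse (sqrt (f x)) * (1/2))"])
    show "((\<lambda>x. sqrt (f x)) has_derivative
        (\<lambda>v. frechet_derivative f (at x) v * (inverse (sqrt (f x)) * (1/2)))) (at x)"
      if "x \<in> S" for x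
    proof -
      have "(f has_derivative frechet_derivative f (at x)) (at x)"
        using Suc.prems that Ck_on_derivative by blast
      then show ?thesis
        using assms(3)[OF that] by (auto intro!: derivative_eq_intros simp: field_simps)
    qed
    have "f x \<noteq> 0" "sqrt (f x) \<noteq> 0" if "x \<in> S" for x
      using assms(3)[OF that] by auto
    then show "Ck_on k S (\<lambda>x. frechet_derivative f (at x) v * (inverse (sqrt (f x)) * (1/2)))" for v
      using Suc.prems I assms(1)
      by (intro Ck_on_bilinear[OF _ bounded_bilinear_mult] Ck_on_inverse Ck_on_const) auto
  qed fact
qed

text \<open>Makes the straight lines of a chart into smooth curves on a mirror, as the definition of
  \<open>tangent_space\<close> demands.\<close>

lemma Ck_on_affine_curve:
  fixes f :: "'a::real_normed_vector \<Rightarrow> 'b::real_normed_vector"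
  assumes "open S" "Ck_on k S f"
  shows "Ck_on k {t::real. a + t *\<^sub>R s \<in> S} (\<lambda>t. f (a + t *\<^sub>R s))"
  using assms(2)
proof (induction k arbitrary: f)
  case 0
  show ?case unfolding Ck_on.simps
    by (rule continuous_on_compose2[OF 0[unfolded Ck_on.simps]]) (auto intro!: continuous_intros)
next
  case (Suc k)
  have op: "open {t::real. a + t *\<^sub>R s \<in> S}"
    using open_vimage[OF assms(1), of "\<lambda>t. a + t *\<^sub>R s"]
    by (simp add: vimage_def continuous_on_add continuous_on_scaleR)
  show ?case
  proof (rule Ck_on_SucI[OF op, where f'="\<lambda>t v. v *\<^sub>R frechet_derivative f (at (a + t *\<^sub>R s)) s"])
    fix t assume "t \<in> {t::real. a + t *\<^sub>R s \<in> S}"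
    then have f: "(f has_derivative frechet_derivative f (at (a + t *\<^sub>R s))) (at (a + t *\<^sub>R s))"
      using Suc.prems Ck_on_derivative by blast
    have "((\<lambda>t. a + t *\<^sub>R s) has_derivative (\<lambda>v. v *\<^sub>R s)) (at t)"
      by (auto intro!: derivative_eq_intros)
    from has_derivative_compose[OF this f]
    show "((\<lambda>t. f (a + t *\<^sub>R s)) has_derivative
        (\<lambda>v. v *\<^sub>R frechet_derivative f (at (a + t *\<^sub>R s)) s)) (at t)"
      by (simp add: linear_cmul[OF has_derivative_linear[OF f]])
  next
    show "Ck_on k {t. a + t *\<^sub>R s \<in> S} (\<lambda>t. v *\<^sub>R frechet_derivative f (at (a + t *\<^sub>R s)) s)" for v
      by (rule Ck_on_bounded_linear[OF op bounded_linear_scaleR_right]) (use Suc in auto)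
  qed
qed

lemma Ck_on_Pair:
  assumes "open S" "Ck_on k S f" "Ck_on k S g"
  shows "Ck_on k S (\<lambda>x. (f x, g x))"
proof -
  have "Ck_on k S (\<lambda>x. (f x, 0) + (0, g x))"
    by (rule Ck_on_add[OF assms(1) Ck_on_bounded_linear[OF assms(1) _ assms(2)] Ck_on_bounded_linear[OF assms(1) _ assms(3)]])
      (intro bounded_linear_Pair bounded_linear_ident bounded_linear_zero)+
  then show ?thesis by simp
qed

context
  fixes S :: "'a::real_normed_vector set"
  assumes S: "open S"
begin

lemma smooth_on_const: "smooth_on S (\<lambda>x. c)"
  by (simp add: smooth_on_def Ck_on_const S)

lemma smooth_on_ident: "smooth_on S (\<lambda>x. x)"
  by (simp add: smooth_on_def Ck_on_ident S)

lemma smooth_on_bounded_linear: "bounded_linear L \<Longrightarrow> smooth_on S f \<Longrightarrow> smooth_on S (\<lambda>x. L (f x))"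
  by (simp add: smooth_on_def Ck_on_bounded_linear S)

lemma smooth_on_add: "smooth_on S f \<Longrightarrow> smooth_on S g \<Longrightarrow> smooth_on S (\<lambda>x. f x + g x)"
  by (simp add: smooth_on_def Ck_on_add S)

lemma smooth_on_uminus: "smooth_on S f \<Longrightarrow> smooth_on S (\<lambda>x. - f x)"
  by (rule smooth_on_bounded_linear) (intro bounded_linear_minus bounded_linear_ident)

lemma smooth_on_diff: "smooth_on S f \<Longrightarrow> smooth_on S g \<Longrightarrow> smooth_on S (\<lambda>x. f x - g x)"
  using smooth_on_add[of f "\<lambda>x. - g x"] by (simp add: smooth_on_uminus)

lemma smooth_on_inner:
  fixes f g :: "'a \<Rightarrow> 'b::real_inner"
  shows "smooth_on S f \<Longrightarrow> smooth_on S g \<Longrightarrow> smooth_on S (\<lambda>x. f x \<bullet> g x)"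
  by (simp add: smooth_on_def Ck_on_bilinear bounded_bilinear_inner S)

lemma smooth_on_scaleR: "smooth_on S f \<Longrightarrow> smooth_on S g \<Longrightarrow> smooth_on S (\<lambda>x. f x *\<^sub>R g x)"
  by (simp add: smooth_on_def Ck_on_bilinear bounded_bilinear_scaleR S)

lemma smooth_on_divide:
  fixes f g :: "'a \<Rightarrow> real"
  assumes "smooth_on S f" "smooth_on S g" "\<And>x. x \<in> S \<Longrightarrow> g x \<noteq> 0"
  shows "smooth_on S (\<lambda>x. f x / g x)"
proof -
  have "Ck_on k S (\<lambda>x. f x * inverse (g x))" for k
    using assms unfolding smooth_on_def
    by (intro Ck_on_bilinear[OF S bounded_bilinear_mult] Ck_on_inverse[OF S]) auto
  then show ?thesis by (simp add: smooth_on_def divide_inverse)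
qed

lemma smooth_on_sqrt:
  fixes f :: "'a \<Rightarrow> real"
  shows "smooth_on S f \<Longrightarrow> (\<And>x. x \<in> S \<Longrightarrow> f x > 0) \<Longrightarrow> smooth_on S (\<lambda>x. sqrt (f x))"
  by (simp add: smooth_on_def Ck_on_sqrt S)

lemma smooth_on_Pair: "smooth_on S f \<Longrightarrow> smooth_on S g \<Longrightarrow> smooth_on S (\<lambda>x. (f x, g x))"
  by (simp add: smooth_on_def Ck_on_Pair S)

end

lemma smooth_on_imp_continuous_on: "smooth_on S f \<Longrightarrow> continuous_on S f"
  unfolding smooth_on_def by (metis Ck_on.simps(1))

lemma smooth_on_has_derivative:
  "smooth_on S f \<Longrightarrow> x \<in> S \<Longrightarrow> (f has_derivative frechet_derivative f (at x)) (at x)"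
  by (auto simp: smooth_on_def intro: Ck_on_derivative)

lemma smooth_on_frechet_derivative:
  "smooth_on S f \<Longrightarrow> smooth_on S (\<lambda>x. frechet_derivative f (at x) v)"
  unfolding smooth_on_def by (metis Ck_on.simps(2))

section \<open>Unimodular maps of phase space\<close>

text \<open>The change of variables theorem of the library is stated for \<open>real^'m\<close> with a well-ordered index
  type \<open>'m\<close>, which \<open>'n bit0\<close> (of twice the size of \<open>'n\<close>) is for every finite \<open>'n\<close>.\<close>

definition phase_coords ::
  "((real^'n) \<times> (real^'n) \<Rightarrow> real^('n::finite bit0)) \<times> (real^('n bit0) \<Rightarrow> (real^'n) \<times> (real^'n))" where
  "phase_coords = (SOME (f, g). linear f \<and> linear g \<and> (\<forall>x. norm (f x) = norm x) \<and>
     (\<forall>y. norm (g y) = norm y) \<and> (\<forall>x. g (f x) = x) \<and> (\<forall>y. f (g y) = y))"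

abbreviation flat :: "(real^'n) \<times> (real^'n) \<Rightarrow> real^('n::finite bit0)" where
  "flat \<equiv> fst phase_coords"

abbreviation unflat :: "real^('n::finite bit0) \<Rightarrow> (real^'n) \<times> (real^'n)" where
  "unflat \<equiv> snd phase_coords"

lemma flat:
  shows linear_flat: "linear (flat :: (real^'n) \<times> (real^'n) \<Rightarrow> real^('n::finite bit0))"
    and linear_unflat: "linear (unflat :: real^('n bit0) \<Rightarrow> (real^'n) \<times> (real^'n))"
    and norm_flat [simp]: "\<And>x :: (real^'n) \<times> (real^'n). norm (flat x) = norm x"
    and norm_unflat [simp]: "\<And>y :: real^('n bit0). norm (unflat y) = norm y"
    and unflat_flat [simp]: "\<And>x :: (real^'n) \<times> (real^'n). unflat (flat x) = x"
    and flat_unflat [simp]: "\<And>y :: real^('n bit0). flat (unflat y) = y"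
proof -
  have d: "dim (UNIV :: ((real^'n) \<times> (real^'n)) set) = dim (UNIV :: (real^('n bit0)) set)"
    by simp
  obtain f :: "(real^'n) \<times> (real^'n) \<Rightarrow> real^('n bit0)" and g
    where "linear f" "linear g" "\<And>x. norm (f x) = norm x" "\<And>x. norm (g x) = norm x"
      "\<And>x. g (f x) = x" "\<And>x. f (g x) = x"
    using isometries_subspaces[OF subspace_UNIV subspace_UNIV d] by (metis UNIV_I)
  then have "\<exists>p :: ((real^'n) \<times> (real^'n) \<Rightarrow> real^('n bit0)) \<times> _. case p of (f, g) \<Rightarrow>
      linear f \<and> linear g \<and> (\<forall>x. norm (f x) = norm x) \<and>
     (\<forall>y. norm (g y) = norm y) \<and> (\<forall>x. g (f x) = x) \<and> (\<forall>y. f (g y) = y)"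
    by (intro exI[of _ "(f, g)"]) auto
  from someI_ex[OF this, folded phase_coords_def]
  have *: "linear (flat :: (real^'n) \<times> (real^'n) \<Rightarrow> real^('n::finite bit0)) \<and>
    linear (unflat :: real^('n bit0) \<Rightarrow> (real^'n) \<times> (real^'n)) \<and>
    (\<forall>x :: (real^'n) \<times> (real^'n). norm (flat x) = norm x) \<and>
    (\<forall>y :: real^('n bit0). norm (unflat y) = norm y) \<and>
    (\<forall>x :: (real^'n) \<times> (real^'n). unflat (flat x) = x) \<and>
    (\<forall>y :: real^('n bit0). flat (unflat y) = y)"
    by (simp add: case_prod_unfold)
  show "linear (flat :: (real^'n) \<times> (real^'n) \<Rightarrow> real^('n::finite bit0))"
    "linear (unflat :: real^('n bit0) \<Rightarrow> (real^'n) \<times> (real^'n))"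
    "\<And>x :: (real^'n) \<times> (real^'n). norm (flat x) = norm x"
    "\<And>y :: real^('n bit0). norm (unflat y) = norm y"
    "\<And>x :: (real^'n) \<times> (real^'n). unflat (flat x) = x"
    "\<And>y :: real^('n bit0). flat (unflat y) = y"
    using * by blast+
qed

text \<open>Absolute value, because change of variables sees only that and isometries of either
  orientation occur.\<close>

definition unimodular :: "((real^'n) \<times> (real^'n) \<Rightarrow> (real^'n::finite) \<times> (real^'n)) \<Rightarrow> bool" where
  "unimodular L \<longleftrightarrow> linear L \<and> \<bar>det (matrix (flat \<circ> L \<circ> unflat))\<bar> = 1"

lemma matrix_flat_compose:
  fixes L L' :: "(real^'n) \<times> (real^'n) \<Rightarrow> (real^'n::finite) \<times> (real^'n)"
  assumes "linear L" "linear L'"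
  shows "matrix (flat \<circ> (L \<circ> L') \<circ> unflat) =
    matrix (flat \<circ> L \<circ> unflat) ** matrix (flat \<circ> L' \<circ> unflat)"
proof -
  have "flat \<circ> (L \<circ> L') \<circ> unflat = (flat \<circ> L \<circ> unflat) \<circ> (flat \<circ> L' \<circ> unflat)"
    by (auto simp: fun_eq_iff)
  then show ?thesis
    using assms by (simp only:) (intro matrix_compose linear_compose linear_flat linear_unflat)
qed

lemma unimodular_compose:
  assumes "unimodular L" "unimodular L'"
  shows "unimodular (L \<circ> L')"
  using assms by (simp add: unimodular_def matrix_flat_compose det_mul abs_mult linear_compose)

lemma unimodular_isometry:
  assumes "linear L" "\<And>x. norm (L x) = norm x"
  shows "unimodular L"
proof -
  have "orthogonal_transformation (flat \<circ> L \<circ> unflat)"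
    unfolding orthogonal_transformation
    using assms by (auto intro!: linear_compose linear_flat linear_unflat)
  then show ?thesis using assms by (simp add: unimodular_def)
qed

text \<open>Taking determinants gives (det D)^2 (det L)^2 = 1. This settles shears without computing
  in coordinates: flipping the sign of one component turns a shear into its inverse.\<close>

lemma unimodular_if_conjugate_inverse:
  assumes L: "linear L" and D: "unimodular D" and inv: "D \<circ> (L \<circ> (D \<circ> L)) = id"
  shows "unimodular L"
proof -
  have lD: "linear D" using D unimodular_def by blast
  let ?d = "\<lambda>L. det (matrix (flat \<circ> L \<circ> unflat))"
  have "?d (D \<circ> (L \<circ> (D \<circ> L))) = ?d D * (?d L * (?d D * ?d L))"
    using L lD by (simp add: matrix_flat_compose det_mul linear_compose)
  moreover have "\<bar>?d (D \<circ> (L \<circ> (D \<circ> L)))\<bar> = 1"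
    using unimodular_isometry[of id] inv by (simp add: unimodular_def linear_id)
  ultimately have "\<bar>?d L\<bar> * \<bar>?d L\<bar> = 1"
    using D by (simp add: unimodular_def abs_mult)
  then have "\<bar>?d L\<bar> = 1" by (auto simp: abs_mult_self_eq square_eq_1_iff)
  then show ?thesis using L by (simp add: unimodular_def)
qed

lemma unimodular_flip: "unimodular (\<lambda>(a, b). (a, - b))"
  by (rule unimodular_isometry) (auto intro!: linearI simp: norm_Pair)

definition free_flight :: "real \<Rightarrow> 'a \<times> 'a \<Rightarrow> 'a \<times> 'a::real_vector" where
  "free_flight t x = (fst x + t *\<^sub>R snd x, snd x)"

lemma unimodular_free_flight: "unimodular (free_flight t)"
  by (rule unimodular_if_conjugate_inverse[OF _ unimodular_flip])
    (auto intro!: linearI simp: free_flight_def fun_eq_iff algebra_simps)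

lemma unimodular_shear:
  assumes "linear K"
  shows "unimodular (\<lambda>(a, b). (a, b + K a))"
  by (rule unimodular_if_conjugate_inverse[OF _ unimodular_flip])
    (auto intro!: linearI simp: fun_eq_iff algebra_simps linear_add[OF assms] linear_cmul[OF assms])

lemma measure_unimodular_image:
  fixes f :: "(real^'n) \<times> (real^'n) \<Rightarrow> (real^'n::finite) \<times> (real^'n)"
  assumes P: "flat ` P \<in> lmeasurable"
    and f: "\<And>x. x \<in> P \<Longrightarrow> \<exists>L. unimodular L \<and> (f has_derivative L) (at x within P)"
    and inj: "inj_on f P"
  shows "flat ` f ` P \<in> lmeasurable" "measure lebesgue (flat ` f ` P) = measure lebesgue (flat ` P)"
proof -
  obtain L where L: "\<And>x. x \<in> P \<Longrightarrow> unimodular (L x)" "\<And>x. x \<in> P \<Longrightarrow> (f has_derivative L x) (at x within P)"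
    using f by metis
  let ?f = "flat \<circ> f \<circ> unflat"
  let ?f' = "\<lambda>y. flat \<circ> L (unflat y) \<circ> unflat"
  have img: "?f ` flat ` P = flat ` f ` P" by (simp add: image_comp)
  have "?f ` flat ` P \<in> lmeasurable \<and> measure lebesgue (?f ` flat ` P) = measure lebesgue (flat ` P)
    \<longleftrightarrow> ((\<lambda>y. \<bar>det (matrix (?f' y))\<bar>) has_integral measure lebesgue (flat ` P)) (flat ` P)"
  proof (rule has_measure_differentiable_image)
    show "flat ` P \<in> sets lebesgue" using P by blast
    show "inj_on ?f (flat ` P)"
    proof (rule inj_onI, clarsimp)
      fix a b a' b' :: "real^'n"
      assume "(a, b) \<in> P" "(a', b') \<in> P" "flat (f (a, b)) = flat (f (a', b'))"
      then have "f (a, b) = f (a', b')" by (metis unflat_flat)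
      then show "flat (a, b) = flat (a', b')"
        using inj_onD[OF inj _ \<open>(a, b) \<in> P\<close> \<open>(a', b') \<in> P\<close>] by simp
    qed
    fix y assume "y \<in> flat ` P"
    then obtain x where x: "x \<in> P" "y = flat x" by auto
    have l: "(flat has_derivative flat) F" "(unflat has_derivative unflat) G" for F G
      using linear_flat linear_unflat
      by (auto intro!: bounded_linear_imp_has_derivative simp: linear_conv_bounded_linear)
    have "(f has_derivative L x) (at (unflat y) within unflat ` flat ` P)"
      using L(2)[OF x(1)] x by (simp add: image_comp)
    from diff_chain_within[OF l(2) this] 
    have "(f \<circ> unflat has_derivative L x \<circ> unflat) (at y within flat ` P)" .
    from diff_chain_within[OF this l(1)]
    show "(?f has_derivative ?f' y) (at y within flat ` P)"
      using x by (simp add: comp_assoc)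
  qed
  moreover have "((\<lambda>y. \<bar>det (matrix (?f' y))\<bar>) has_integral measure lebesgue (flat ` P)) (flat ` P)"
  proof (rule has_integral_eq)
    show "((\<lambda>y. 1) has_integral measure lebesgue (flat ` P)) (flat ` P)"
      using P has_integral_iff lmeasurable_iff_integrable_on lmeasure_integral by metis
  qed (use L(1) in \<open>auto simp: unimodular_def\<close>)
  ultimately show "flat ` f ` P \<in> lmeasurable" "measure lebesgue (flat ` f ` P) = measure lebesgue (flat ` P)"
    unfolding img by blast+
qed

lemma flat_image_eq_vimage: "flat ` A = unflat -` A"
  by (auto simp: image_iff) (metis flat_unflat)

lemma borel_flat_image: "A \<in> sets borel \<Longrightarrow> flat ` A \<in> sets borel"
proof -
  assume "A \<in> sets borel"
  moreover have "unflat \<in> borel_measurable borel"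
    using linear_unflat linear_continuous_on linear_conv_bounded_linear
    by (blast intro: borel_measurable_continuous_onI)
  ultimately show ?thesis
    using measurable_sets[of unflat borel borel A] by (simp add: flat_image_eq_vimage)
qed

lemma open_flat_image: "open A \<Longrightarrow> open (flat ` A)"
  unfolding flat_image_eq_vimage
  using linear_unflat linear_continuous_on linear_conv_bounded_linear by (blast intro: open_vimage)

lemma bounded_flat_image: "bounded A \<Longrightarrow> bounded (flat ` A)"
  by (auto simp: bounded_iff)

text \<open>A pigeonhole principle by volume: infinitely many disjoint sets of one positive measure
  do not fit into a bounded set. The partition may depend on \<open>k\<close>, since the
  discontinuities of the flow vary with time.\<close>

theorem no_disjoint_unimodular_images:
  fixes f :: "nat \<Rightarrow> (real^'n) \<times> (real^'n) \<Rightarrow> (real^'n::finite) \<times> (real^'n)"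
  assumes W: "open W" "W \<noteq> {}" "bounded W"
    and P: "\<And>k::nat. (\<Union>i::nat. P k i) = W" "\<And>k. disjoint_family (P k)" "\<And>k i. P k i \<in> sets borel"
    and der: "\<And>k i x. x \<in> P k i \<Longrightarrow> \<exists>L. unimodular L \<and> (f k has_derivative L) (at x within P k i)"
    and inj: "\<And>k. inj_on (f k) W"
    and disj: "\<And>j k. j \<noteq> k \<Longrightarrow> f j ` W \<inter> f k ` W = {}"
    and C: "bounded C" "\<And>k. f k ` W \<subseteq> C"
  shows False
proof -
  define m where "m = measure lebesgue (flat ` W)"
  have inj_flat: "inj flat" by (metis injI unflat_flat)
  have W': "flat ` W \<in> lmeasurable"
    by (rule lmeasurable_open[OF bounded_flat_image[OF W(3)] open_flat_image[OF W(1)]])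
  have "m > 0"
    unfolding m_def
    using W W' open_not_negligible[of "flat ` W"] open_flat_image[of W]
    by (metis image_is_empty negligible_iff_measure zero_less_measure_iff)
  have img: "flat ` f k ` W \<in> lmeasurable \<and> measure lebesgue (flat ` f k ` W) = m" for k
  proof -
    have sub: "P k i \<subseteq> W" for i using P(1) by blast
    have Pm: "flat ` P k i \<in> lmeasurable" for i
    proof (rule bounded_set_imp_lmeasurable)
      show "bounded (flat ` P k i)" using bounded_flat_image bounded_subset[OF W(3) sub] .
      show "flat ` P k i \<in> sets lebesgue"
        using borel_flat_image[OF P(3)[of k i]] by simp
    qed
    have fP: "flat ` f k ` P k i \<in> lmeasurable"
       "measure lebesgue (flat ` f k ` P k i) = measure lebesgue (flat ` P k i)" for i
      using measure_unimodular_image[OF Pm der inj_on_subset[OF inj sub]] by blast+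
    have U: "flat ` f k ` W = (\<Union>i. flat ` f k ` P k i)" "flat ` W = (\<Union>i. flat ` P k i)"
      unfolding P(1)[of k, symmetric] by blast+
    have d1: "disjoint_family (\<lambda>i. flat ` P k i)"
      unfolding disjoint_family_on_def
    proof (intro ballI impI)
      fix i j :: nat assume "i \<noteq> j"
      then have "P k i \<inter> P k j = {}" using P(2)[of k] by (auto simp: disjoint_family_on_def)
      then show "flat ` P k i \<inter> flat ` P k j = {}" by (simp flip: image_Int[OF inj_flat])
    qed
    have d2: "disjoint_family (\<lambda>i. flat ` f k ` P k i)"
      unfolding disjoint_family_on_def
    proof (intro ballI impI)
      fix i j :: nat assume "i \<noteq> j"
      then have "P k i \<inter> P k j = {}" using P(2)[of k] by (auto simp: disjoint_family_on_def)
      then show "flat ` f k ` P k i \<inter> flat ` f k ` P k j = {}"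
        by (simp flip: image_Int[OF inj_flat] inj_on_image_Int[OF inj sub sub])
    qed
    have bd: "bounded (flat ` f k ` W)"
      using C bounded_subset bounded_flat_image by meson
    \<comment> \<open>Measure is preserved piece by piece; countable additivity, with disjoint
      images thanks to injectivity on all of \<open>W\<close>, reassembles the pieces.\<close>
    have e: "emeasure lebesgue (flat ` f k ` W) = emeasure lebesgue (flat ` W)"
      unfolding U using fP Pm d1 d2
      by (subst (1 2) suminf_emeasure[symmetric])
        (auto intro!: suminf_cong simp: emeasure_eq_measure2 image_subset_iff fmeasurableD)
    have "flat ` f k ` W \<in> sets lebesgue"
      unfolding U(1) using fP by (intro sets.countable_UN) auto
    then show ?thesis using bd e m_def
      by (simp add: bounded_set_imp_lmeasurable measure_def)
  qed
  obtain R where R: "\<And>x. x \<in> C \<Longrightarrow> norm x \<le> R" using C(1) bounded_iff by blast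
  have le: "real N * m \<le> measure lebesgue (cball (0::real^('n bit0)) R)" for N
  proof -
    have "real N * m = (\<Sum>k<N. measure lebesgue (flat ` f k ` W))"
      by (simp add: img)
    also have "\<dots> = measure lebesgue (\<Union>k<N. flat ` f k ` W)"
    proof (rule measure_finite_Union[symmetric])
      show "disjoint_family_on (\<lambda>k. flat ` f k ` W) {..<N}"
        unfolding disjoint_family_on_def by (simp add: disj flip: image_Int[OF inj_flat])
      show "emeasure lebesgue (flat ` f k ` W) \<noteq> \<infinity>" for k
        using img[of k] emeasure_eq_measure2 by fastforce
    qed (use img in auto)
    also have "\<dots> \<le> measure lebesgue (cball (0::real^('n bit0)) R)"
    proof (rule measure_mono_fmeasurable)
      have "norm (flat (f k x)) \<le> R" if "x \<in> W" for k x
        using C(2)[of k] R[of "f k x"] that by auto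
      then show "(\<Union>k<N. flat ` f k ` W) \<subseteq> cball 0 R" by auto
      show "(\<Union>k<N. flat ` f k ` W) \<in> sets lebesgue"
        using img by (intro sets.finite_UN fmeasurableD) auto
    qed simp
    finally show ?thesis .
  qed
  obtain N where "real N * m > measure lebesgue (cball (0::real^('n bit0)) R)"
    using reals_Archimedean3[OF \<open>m > 0\<close>] by blast
  with le[of N] show False by simp
qed

section \<open>Local equations of mirrors\<close>

text \<open>Accepts normals of any length, so that the gradient of a local equation can be inserted
  directly. For the zero vector the division by zero gives the identity, which keeps the laws below
  free of side conditions.\<close>

definition reflect :: "'a::real_inner \<Rightarrow> 'a \<Rightarrow> 'a" where
  "reflect n v = v - (2 * (v \<bullet> n) / (n \<bullet> n)) *\<^sub>R n"

lemma linear_reflect: "linear (reflect n)"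
  by (rule linearI) (auto simp: reflect_def inner_add_left algebra_simps add_divide_distrib)

lemma reflect_inner_normal: "reflect n v \<bullet> n = - (v \<bullet> n)"
  by (cases "n = 0") (auto simp: reflect_def inner_diff_left)

lemma reflect_reflect [simp]: "reflect n (reflect n v) = v"
proof -
  have "reflect n (reflect n v) = reflect n v + (2 * (v \<bullet> n) / (n \<bullet> n)) *\<^sub>R n"
    by (subst reflect_def) (simp add: reflect_inner_normal)
  then show ?thesis by (simp add: reflect_def)
qed

lemma norm_reflect [simp]: "norm (reflect n v) = norm v"
proof -
  have "reflect n v \<bullet> reflect n v = v \<bullet> v"
    by (cases "n = 0")
      (auto simp: reflect_def inner_diff_left inner_diff_right inner_commute field_simps power2_eq_square)
  then show ?thesis by (simp add: norm_eq)
qed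

lemma reflect_scaleR: "c \<noteq> 0 \<Longrightarrow> reflect (c *\<^sub>R n) v = reflect n v"
  by (cases "n = 0") (auto simp: reflect_def)

lemma reflect_unit: "norm n = 1 \<Longrightarrow> reflect n v = v - (2 * (v \<bullet> n)) *\<^sub>R n"
  by (simp add: reflect_def norm_eq_1)

section \<open>From charts to defining functions and normals\<close>

lemma hyperplane_normal_exists:
  fixes S :: "'a::euclidean_space set"
  assumes "subspace S" "dim S = DIM('a) - 1"
  obtains b where "b \<noteq> 0" "S = {y. b \<bullet> y = 0}"
proof -
  have "dim S < DIM('a)" using assms(2) DIM_positive[where 'a='a] by linarith
  then obtain b where b: "b \<noteq> 0" "span S \<subseteq> {x. b \<bullet> x = 0}"
    using lowdim_subset_hyperplane by metis
  have "S \<subseteq> {x. b \<bullet> x = 0}" using b(2) span_superset by blast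
  moreover have "dim {x. b \<bullet> x = 0} \<le> dim S"
    using assms(2) dim_hyperplane[OF b(1)] by simp
  ultimately have "S = {x. b \<bullet> x = 0}"
    using subspace_dim_equal[OF assms(1) subspace_hyperplane] by blast
  with b show thesis using that by blast
qed

lemma frechet_derivative_diffeomorphism:
  assumes "diffeomorphism U V \<phi> \<psi>" "x \<in> U"
  shows "frechet_derivative \<phi> (at x) (frechet_derivative \<psi> (at (\<phi> x)) w) = w"
    and "frechet_derivative \<psi> (at (\<phi> x)) (frechet_derivative \<phi> (at x) w) = w"
proof -
  have d: "open U" "open V" "\<phi> x \<in> V" "\<psi> (\<phi> x) = x"
    "\<And>y. y \<in> V \<Longrightarrow> \<phi> (\<psi> y) = y" "\<And>y. y \<in> U \<Longrightarrow> \<psi> (\<phi> y) = y"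
    using assms by (auto simp: diffeomorphism_def homeomorphism_def)
  have D: "(\<phi> has_derivative frechet_derivative \<phi> (at x)) (at x)"
    "(\<psi> has_derivative frechet_derivative \<psi> (at (\<phi> x))) (at (\<phi> x))"
    using assms d smooth_on_has_derivative by (auto simp: diffeomorphism_def)
  have "((\<lambda>y. \<phi> (\<psi> y)) has_derivative
      (\<lambda>w. frechet_derivative \<phi> (at x) (frechet_derivative \<psi> (at (\<phi> x)) w))) (at (\<phi> x))"
    using has_derivative_compose[OF D(2)] D(1) d(4) by simp
  moreover have "((\<lambda>y. \<phi> (\<psi> y)) has_derivative (\<lambda>w. w)) (at (\<phi> x))"
    by (rule has_derivative_transform_within_open[OF has_derivative_ident d(2,3)]) (simp add: d)
  ultimately show "frechet_derivative \<phi> (at x) (frechet_derivative \<psi> (at (\<phi> x)) w) = w"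
    using has_derivative_unique by metis
  have "((\<lambda>y. \<psi> (\<phi> y)) has_derivative
      (\<lambda>w. frechet_derivative \<psi> (at (\<phi> x)) (frechet_derivative \<phi> (at x) w))) (at x)"
    by (rule has_derivative_compose[OF D(1,2)])
  moreover have "((\<lambda>y. \<psi> (\<phi> y)) has_derivative (\<lambda>w. w)) (at x)"
    by (rule has_derivative_transform_within_open[OF has_derivative_ident d(1) assms(2)]) (simp add: d)
  ultimately show "frechet_derivative \<psi> (at (\<phi> x)) (frechet_derivative \<phi> (at x) w) = w"
    using has_derivative_unique by metis
qed

text \<open>The line through \<open>\<phi> x\<close> in direction \<open>s\<close> stays in the
  subspace \<open>S\<close> and, for short times, in the open set \<open>V\<close>; its preimage is
  a curve in \<open>M\<close> with the required velocity.\<close>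

lemma chart_tangent_vector:
  assumes "diffeomorphism U V \<phi> \<psi>" "x \<in> U" "x \<in> M" "\<phi> ` (U \<inter> M) = V \<inter> S" "subspace S" "s \<in> S"
  shows "frechet_derivative \<psi> (at (\<phi> x)) s \<in> tangent_space M x"
proof -
  have d: "open V" "\<phi> x \<in> V \<inter> S" "\<psi> (\<phi> x) = x" "smooth_on V \<psi>" "\<And>y. y \<in> U \<Longrightarrow> \<psi> (\<phi> y) = y"
    using assms by (auto simp: diffeomorphism_def homeomorphism_def)
  let ?c = "\<lambda>t. \<psi> (\<phi> x + t *\<^sub>R s)"
  let ?T = "{t::real. \<phi> x + t *\<^sub>R s \<in> V}"
  have "open ((\<lambda>t::real. \<phi> x + t *\<^sub>R s) -` V)"
    by (rule open_vimage[OF d(1)]) (intro continuous_intros)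
  moreover have "0 \<in> (\<lambda>t::real. \<phi> x + t *\<^sub>R s) -` V" using d by simp
  ultimately obtain \<epsilon> where \<epsilon>: "\<epsilon> > 0" "ball 0 \<epsilon> \<subseteq> (\<lambda>t::real. \<phi> x + t *\<^sub>R s) -` V"
    using openE by blast
  then have sub: "{-\<epsilon><..<\<epsilon>} \<subseteq> ?T"
    by (auto simp: subset_iff dist_real_def abs_less_iff)
  have "smooth_on {-\<epsilon><..<\<epsilon>} ?c"
    using Ck_on_affine_curve[OF d(1)] d(4) Ck_on_subset[OF _ sub] unfolding smooth_on_def by blast
  moreover have "?c ` {-\<epsilon><..<\<epsilon>} \<subseteq> M"
  proof clarify
    fix t assume "t \<in> {-\<epsilon><..<\<epsilon>}"
    then have "\<phi> x + t *\<^sub>R s \<in> V \<inter> S"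
      using sub d(2) assms(5,6) subspace_add subspace_scale by blast
    then obtain y where "y \<in> U \<inter> M" "\<phi> y = \<phi> x + t *\<^sub>R s" using assms(4) by (metis imageE)
    then show "?c t \<in> M" using d(5)[of y] by auto
  qed
  moreover have "(?c has_vector_derivative frechet_derivative \<psi> (at (\<phi> x)) s) (at 0)"
  proof -
    have 1: "(\<psi> has_derivative frechet_derivative \<psi> (at (\<phi> x))) (at (\<phi> x + 0 *\<^sub>R s))"
      using smooth_on_has_derivative[OF d(4)] d(2) by simp
    have 2: "((\<lambda>t::real. \<phi> x + t *\<^sub>R s) has_derivative (\<lambda>t. t *\<^sub>R s)) (at 0)"
      by (auto intro!: derivative_eq_intros)
    show ?thesis
      using has_derivative_compose[OF 2 1]
      by (simp add: has_vector_derivative_def linear_cmul[OF has_derivative_linear[OF 1]])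
  qed
  ultimately show ?thesis
    unfolding tangent_space_def using \<epsilon>(1) d(3)
    by (intro CollectI exI[of _ ?c] exI[of _ \<epsilon>]) auto
qed

text \<open>The chart flattens the mirror to a hyperplane with normal \<open>b\<close>, so the
  function \<open>b \<bullet> \<phi> z\<close> is a local equation and \<open>n\<close> is its
  gradient. Since \<open>unit_normal\<close> only speaks of curves, the last claim is what ties it
  to this gradient.\<close>

lemma mirror_local_equation:
  fixes M :: "'a::euclidean_space set"
  assumes "m \<in> mirror_interior M"
  obtains U h n where "open U" "m \<in> U" "U \<inter> M = {z \<in> U. h z = 0}"
    "\<And>z. z \<in> U \<Longrightarrow> (h has_derivative (\<lambda>w. n z \<bullet> w)) (at z)"
    "\<And>z. z \<in> U \<Longrightarrow> n differentiable (at z)"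
    "\<And>z \<nu>. z \<in> U \<inter> M \<Longrightarrow> unit_normal M z \<nu> \<Longrightarrow> \<exists>c. c \<noteq> 0 \<and> \<nu> = c *\<^sub>R n z"
proof -
  obtain U V \<phi> \<psi> S where ch: "diffeomorphism U V \<phi> \<psi>" "m \<in> U" "subspace S" "dim S = DIM('a) - 1"
     "\<phi> ` (U \<inter> M) = V \<inter> S"
    using assms by (auto simp: mirror_interior_def manifold_interior_def)
  have U: "open U" "smooth_on U \<phi>" "\<phi> ` U = V" "\<And>y. y \<in> U \<Longrightarrow> \<psi> (\<phi> y) = y"
    using ch(1) by (auto simp: diffeomorphism_def homeomorphism_def)
  obtain b where b: "b \<noteq> 0" "S = {y. b \<bullet> y = 0}"
    using hyperplane_normal_exists[OF ch(3,4)] .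
  define h where "h z = b \<bullet> \<phi> z" for z
  let ?D = "\<lambda>z. frechet_derivative \<phi> (at z)"
  \<comment> \<open>The transpose of the derivative of \<open>\<phi>\<close> applied to
    \<open>b\<close>, written in coordinates so that its smoothness in \<open>z\<close> can be read
    off.\<close>
  define n where "n z = (\<Sum>i\<in>Basis. (b \<bullet> ?D z i) *\<^sub>R i)" for z
  have D: "(\<phi> has_derivative ?D z) (at z)" if "z \<in> U" for z
    using smooth_on_has_derivative U that by blast
  have n: "n z \<bullet> w = b \<bullet> ?D z w" if "z \<in> U" for z w
  proof -
    have "linear (?D z)" using D[OF that] has_derivative_linear by blast
    then have "?D z (\<Sum>i\<in>Basis. (w \<bullet> i) *\<^sub>R i) = (\<Sum>i\<in>Basis. (w \<bullet> i) *\<^sub>R ?D z i)"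
      by (simp only: linear_sum linear_cmul)
    then have "b \<bullet> ?D z w = (\<Sum>i\<in>Basis. (w \<bullet> i) * (b \<bullet> ?D z i))"
      by (simp only: euclidean_representation inner_sum_right inner_scaleR_right)
    then show ?thesis
      by (simp add: n_def inner_sum_left inner_commute[of w] mult.commute)
  qed
  have smooth_n: "smooth_on U n"
  proof -
    have 1: "smooth_on U (\<lambda>z. (b \<bullet> ?D z i) *\<^sub>R i)" for i
      using U by (intro smooth_on_scaleR smooth_on_inner smooth_on_const smooth_on_frechet_derivative)
    have "smooth_on U (\<lambda>z. \<Sum>i\<in>A. (b \<bullet> ?D z i) *\<^sub>R i)" if "finite A" for A
      using that by (induction A rule: finite_induct) (auto intro: smooth_on_const smooth_on_add U(1) 1)
    then show ?thesis unfolding n_def by simp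
  qed
  show thesis
  proof
    show "open U" "m \<in> U" using U ch by auto
    have "z \<in> M \<longleftrightarrow> h z = 0" if "z \<in> U" for z
    proof
      assume "z \<in> M" then show "h z = 0" using ch(5) that b by (auto simp: h_def)
    next
      assume "h z = 0"
      then have "\<phi> z \<in> \<phi> ` (U \<inter> M)" using that b U(3) ch(5) by (auto simp: h_def)
      then show "z \<in> M" using U(4) that by (metis IntE imageE)
    qed
    then show "U \<inter> M = {z \<in> U. h z = 0}" by blast
    show "(h has_derivative (\<lambda>w. n z \<bullet> w)) (at z)" if "z \<in> U" for z
      unfolding h_def using n[OF that] D[OF that] has_derivative_inner_right by fastforce
    show "n differentiable (at z)" if "z \<in> U" for z
      using smooth_n smooth_on_has_derivative differentiable_def that by blast
    fix z \<nu> assume z: "z \<in> U \<inter> M" and \<nu>: "unit_normal M z \<nu>"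
    let ?E = "frechet_derivative \<psi> (at (\<phi> z))"
    have lE: "linear ?E"
      using smooth_on_has_derivative[of V \<psi> "\<phi> z"] ch(1) z
      by (auto simp: diffeomorphism_def homeomorphism_def intro: has_derivative_linear)
    define c where "c = (\<nu> \<bullet> ?E b) / (b \<bullet> b)"
    have "\<nu> \<bullet> w = (c *\<^sub>R n z) \<bullet> w" for w
    proof -
      \<comment> \<open>The component of the transported vector inside the hyperplane: it comes from
        a tangent vector, so \<open>\<nu>\<close> sees only the remaining multiple of
        \<open>b\<close>.\<close>
      define s where "s = ?D z w - ((n z \<bullet> w) / (b \<bullet> b)) *\<^sub>R b"
      have "s \<in> S" using b n z by (simp add: s_def inner_diff_right)
      then have "\<nu> \<bullet> ?E s = 0"
        using chart_tangent_vector[OF ch(1) _ _ ch(5,3)] z \<nu> by (auto simp: unit_normal_def)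
      moreover have "w = ?E s + ((n z \<bullet> w) / (b \<bullet> b)) *\<^sub>R ?E b"
        using frechet_derivative_diffeomorphism(2)[OF ch(1), of z w] z
        by (simp add: s_def linear_diff[OF lE] linear_cmul[OF lE])
      ultimately have "\<nu> \<bullet> w = ((n z \<bullet> w) / (b \<bullet> b)) * (\<nu> \<bullet> ?E b)"
        by (metis add_0 inner_add_right inner_scaleR_right)
      then show ?thesis by (simp add: c_def)
    qed
    then have "\<nu> = c *\<^sub>R n z" by (metis vector_eq_rdot)
    moreover have "c \<noteq> 0" using \<nu> calculation by (auto simp: unit_normal_def)
    ultimately show "\<exists>c. c \<noteq> 0 \<and> \<nu> = c *\<^sub>R n z" by blast
  qed
qed

section \<open>Billiard paths\<close>

text \<open>All speeds \<open>r\<close> are needed because the flow acts on an open set of velocities.\<close>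

definition billiard_path :: "'a::euclidean_space set set \<Rightarrow> real \<Rightarrow> (real \<Rightarrow> 'a) \<Rightarrow> bool" where
  "billiard_path T r \<Gamma> \<longleftrightarrow>
     (\<forall>t. \<Gamma> t \<notin> \<Union>T \<longrightarrow>
        (\<exists>v. norm v = r \<and> (\<forall>\<^sub>F s in nhds t. \<Gamma> s = \<Gamma> t + (s - t) *\<^sub>R v))) \<and>
     (\<forall>t. \<forall>M\<in>T. \<Gamma> t \<in> M \<longrightarrow> \<Gamma> t \<in> mirror_interior M \<and> (\<forall>M'\<in>T. \<Gamma> t \<in> M' \<longrightarrow> M' = M) \<and>
        (\<exists>v \<nu>. norm v = r \<and> unit_normal M (\<Gamma> t) \<nu> \<and> v \<bullet> \<nu> \<noteq> 0 \<and>
          (\<forall>\<^sub>F s in at_left t. \<Gamma> s = \<Gamma> t + (s - t) *\<^sub>R v) \<and>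
          (\<forall>\<^sub>F s in at_right t. \<Gamma> s = \<Gamma> t + (s - t) *\<^sub>R reflect \<nu> v))) \<and>
     (\<forall>a b. finite {t \<in> {a..b}. \<Gamma> t \<in> \<Union>T})"

lemma billiard_path_rescale:
  fixes T :: "'a::euclidean_space set set"
  assumes \<gamma>: "nonsingular_trajectory T \<gamma>" and r: "r > 0"
  shows "billiard_path T r (\<lambda>t. \<gamma> (c + r * t))"
proof -
  let ?g = "\<lambda>t. c + r * t"
  have lim: "filterlim ?g (nhds (?g t)) (nhds t)" for t
    by (intro tendsto_intros filterlim_ident)
  have lim_left: "filterlim ?g (at_left (?g t)) (at_left t)" for t
    using r by (auto simp: filterlim_at eventually_at_filter intro!: tendsto_intros always_eventually)
  have lim_right: "filterlim ?g (at_right (?g t)) (at_right t)" for t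
    using r by (auto simp: filterlim_at eventually_at_filter intro!: tendsto_intros always_eventually)
  have eq: "(?g s - ?g t) *\<^sub>R v = (s - t) *\<^sub>R (r *\<^sub>R v)" for s t and v :: 'a
  proof -
    have "?g s - ?g t = (s - t) * r" by (simp add: algebra_simps)
    then show ?thesis by (simp only: scaleR_scaleR)
  qed
  show ?thesis
    unfolding billiard_path_def
  proof (intro conjI allI ballI impI)
    fix t assume "\<gamma> (?g t) \<notin> \<Union>T"
    then obtain v where v: "norm v = 1" "\<forall>\<^sub>F s in nhds (?g t). \<gamma> s = \<gamma> (?g t) + (s - ?g t) *\<^sub>R v"
      using \<gamma> by (auto simp: nonsingular_trajectory_def moves_freely_def)
    have "norm (r *\<^sub>R v) = r" using v r by simp
    moreover have "\<forall>\<^sub>F s in nhds t. \<gamma> (?g s) = \<gamma> (?g t) + (s - t) *\<^sub>R (r *\<^sub>R v)"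
      using eventually_compose_filterlim[OF v(2) lim] by (simp only: eq)
    ultimately show "\<exists>v. norm v = r \<and> (\<forall>\<^sub>F s in nhds t. \<gamma> (?g s) = \<gamma> (?g t) + (s - t) *\<^sub>R v)"
      by blast
  next
    fix t M assume M: "M \<in> T" "\<gamma> (?g t) \<in> M"
    then show "\<gamma> (?g t) \<in> mirror_interior M"
      using \<gamma> by (auto simp: nonsingular_trajectory_def)
    show "M' = M" if "M' \<in> T" "\<gamma> (?g t) \<in> M'" for M'
      using \<gamma> M that by (auto simp: nonsingular_trajectory_def)
    have "reflects_transversally M \<gamma> (?g t)"
      using \<gamma> M by (auto simp: nonsingular_trajectory_def)
    then obtain v \<nu> where v: "norm v = 1" "unit_normal M (\<gamma> (?g t)) \<nu>" "v \<bullet> \<nu> \<noteq> 0"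
      "\<forall>\<^sub>F s in at_left (?g t). \<gamma> s = \<gamma> (?g t) + (s - ?g t) *\<^sub>R v"
      "\<forall>\<^sub>F s in at_right (?g t). \<gamma> s = \<gamma> (?g t) + (s - ?g t) *\<^sub>R (v - (2 * (v \<bullet> \<nu>)) *\<^sub>R \<nu>)"
      unfolding reflects_transversally_def by blast
    have "r *\<^sub>R (v - (2 * (v \<bullet> \<nu>)) *\<^sub>R \<nu>) = reflect \<nu> (r *\<^sub>R v)"
      using v(2) by (simp add: unit_normal_def reflect_unit algebra_simps)
    then have "\<forall>\<^sub>F s in at_right t. \<gamma> (?g s) = \<gamma> (?g t) + (s - t) *\<^sub>R reflect \<nu> (r *\<^sub>R v)"
      using eventually_compose_filterlim[OF v(5) lim_right] by (simp only: eq)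
    moreover have "\<forall>\<^sub>F s in at_left t. \<gamma> (?g s) = \<gamma> (?g t) + (s - t) *\<^sub>R (r *\<^sub>R v)"
      using eventually_compose_filterlim[OF v(4) lim_left] by (simp only: eq)
    moreover have "norm (r *\<^sub>R v) = r" "(r *\<^sub>R v) \<bullet> \<nu> \<noteq> 0" using v r by auto
    ultimately show "\<exists>v \<nu>. norm v = r \<and> unit_normal M (\<gamma> (?g t)) \<nu> \<and> v \<bullet> \<nu> \<noteq> 0 \<and>
          (\<forall>\<^sub>F s in at_left t. \<gamma> (?g s) = \<gamma> (?g t) + (s - t) *\<^sub>R v) \<and>
          (\<forall>\<^sub>F s in at_right t. \<gamma> (?g s) = \<gamma> (?g t) + (s - t) *\<^sub>R reflect \<nu> v)"
      using v(2) by blast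
  next
    fix a b
    have "finite {t \<in> {?g a..?g b}. \<gamma> t \<in> \<Union>T}"
      using \<gamma> by (simp add: nonsingular_trajectory_def)
    moreover have "inj ?g" using r by (auto intro: injI)
    ultimately have "finite (?g -` {t \<in> {?g a..?g b}. \<gamma> t \<in> \<Union>T})"
      by (intro finite_vimageI)
    moreover have "{t \<in> {a..b}. \<gamma> (?g t) \<in> \<Union>T} \<subseteq> ?g -` {t \<in> {?g a..?g b}. \<gamma> t \<in> \<Union>T}"
      using r by auto
    ultimately show "finite {t \<in> {a..b}. \<gamma> (?g t) \<in> \<Union>T}" using finite_subset by blast
  qed
qed

text \<open>Taken from the left, the velocity is also meaningful at a collision, where it is the
  incoming direction; position and left velocity then form a phase point at every time.\<close>

definition left_velocity :: "(real \<Rightarrow> 'a::real_normed_vector) \<Rightarrow> real \<Rightarrow> 'a" where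
  "left_velocity \<Gamma> t = (THE v. \<forall>\<^sub>F s in at_left t. \<Gamma> s = \<Gamma> t + (s - t) *\<^sub>R v)"

lemma left_velocity_eqI:
  assumes "\<forall>\<^sub>F s in at_left t. \<Gamma> s = \<Gamma> t + (s - t) *\<^sub>R v"
  shows "left_velocity \<Gamma> t = v"
  unfolding left_velocity_def
proof (rule the_equality)
  fix w assume "\<forall>\<^sub>F s in at_left t. \<Gamma> s = \<Gamma> t + (s - t) *\<^sub>R w"
  then have "\<forall>\<^sub>F s in at_left t. s < t \<and> (s - t) *\<^sub>R w = (s - t) *\<^sub>R v"
    using assms by (auto simp: eventually_at_filter elim: eventually_elim2)
  then obtain s where "s < t" "(s - t) *\<^sub>R w = (s - t) *\<^sub>R v"
    using eventually_happens[of _ "at_left t"] by (auto simp: trivial_limit_at_left_real)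
  then show "w = v" by auto
qed fact

lemma right_velocity_unique:
  fixes \<Gamma> :: "real \<Rightarrow> 'a::real_normed_vector"
  assumes "\<forall>\<^sub>F s in at_right t. \<Gamma> s = x + (s - t) *\<^sub>R v"
    and "\<forall>\<^sub>F s in at_right t. \<Gamma> s = x + (s - t) *\<^sub>R w"
  shows "v = w"
proof -
  have "\<forall>\<^sub>F s in at_right t. s > t \<and> (s - t) *\<^sub>R w = (s - t) *\<^sub>R v"
    using assms by (auto simp: eventually_at_filter elim: eventually_elim2)
  then obtain s where "s > t" "(s - t) *\<^sub>R w = (s - t) *\<^sub>R v"
    using eventually_happens[of _ "at_right t"] by (auto simp: trivial_limit_at_right_real)
  then show "v = w" by auto
qed

lemma eventually_nhds_sides:
  "(\<forall>\<^sub>F s in nhds (t::real). P s) \<Longrightarrow> (\<forall>\<^sub>F s in at_left t. P s) \<and> (\<forall>\<^sub>F s in at_right t. P s)"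
  by (auto simp: eventually_at_filter elim: eventually_mono)

section \<open>Elementary facts about a single billiard path\<close>

context
  fixes T :: "'a::euclidean_space set set" and r :: real and \<Gamma> :: "real \<Rightarrow> 'a"
  assumes path: "billiard_path T r \<Gamma>"
begin

lemma path_free:
  "\<Gamma> t \<notin> \<Union>T \<Longrightarrow> \<exists>v. norm v = r \<and> (\<forall>\<^sub>F s in nhds t. \<Gamma> s = \<Gamma> t + (s - t) *\<^sub>R v)"
  using path by (simp add: billiard_path_def)

lemma path_collision:
  assumes "M \<in> T" "\<Gamma> t \<in> M"
  shows "\<Gamma> t \<in> mirror_interior M" "\<And>M'. M' \<in> T \<Longrightarrow> \<Gamma> t \<in> M' \<Longrightarrow> M' = M"
    "\<exists>v \<nu>. norm v = r \<and> unit_normal M (\<Gamma> t) \<nu> \<and> v \<bullet> \<nu> \<noteq> 0 \<and>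
       (\<forall>\<^sub>F s in at_left t. \<Gamma> s = \<Gamma> t + (s - t) *\<^sub>R v) \<and>
       (\<forall>\<^sub>F s in at_right t. \<Gamma> s = \<Gamma> t + (s - t) *\<^sub>R reflect \<nu> v)"
  using path assms unfolding billiard_path_def by blast+

lemma path_finite: "finite {t \<in> {a..b}. \<Gamma> t \<in> \<Union>T}"
  using path[unfolded billiard_path_def, THEN conjunct2, THEN conjunct2] by simp

lemma path_sides:
  obtains v w where "norm v = r" "\<forall>\<^sub>F s in at_left t. \<Gamma> s = \<Gamma> t + (s - t) *\<^sub>R v"
    "\<forall>\<^sub>F s in at_right t. \<Gamma> s = \<Gamma> t + (s - t) *\<^sub>R w"
proof (cases "\<Gamma> t \<in> \<Union>T")
  case True
  then obtain M where "M \<in> T" "\<Gamma> t \<in> M" by blast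
  from path_collision(3)[OF this] show thesis using that by blast
next
  case False
  then obtain v where "norm v = r" "\<forall>\<^sub>F s in nhds t. \<Gamma> s = \<Gamma> t + (s - t) *\<^sub>R v"
    using path_free by blast
  with eventually_nhds_sides[OF this(2)] show thesis using that by blast
qed

lemma path_left: "\<forall>\<^sub>F s in at_left t. \<Gamma> s = \<Gamma> t + (s - t) *\<^sub>R left_velocity \<Gamma> t"
  by (rule path_sides[of t]) (simp add: left_velocity_eqI)

lemma norm_left_velocity: "norm (left_velocity \<Gamma> t) = r"
  by (rule path_sides[of t]) (simp add: left_velocity_eqI)

lemma path_isCont: "isCont \<Gamma> t"
proof -
  obtain v w where v: "\<forall>\<^sub>F s in at_left t. \<Gamma> s = \<Gamma> t + (s - t) *\<^sub>R v"
    "\<forall>\<^sub>F s in at_right t. \<Gamma> s = \<Gamma> t + (s - t) *\<^sub>R w"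
    by (rule path_sides)
  have *: "((\<lambda>s. \<Gamma> t + (s - t) *\<^sub>R u) \<longlongrightarrow> \<Gamma> t) (at t within A)" for u A
    by (auto intro!: tendsto_eq_intros)
  have "(\<Gamma> \<longlongrightarrow> \<Gamma> t) (at_left t)" "(\<Gamma> \<longlongrightarrow> \<Gamma> t) (at_right t)"
    using tendsto_cong[OF v(1)] tendsto_cong[OF v(2)] * by blast+
  then show ?thesis by (simp add: isCont_def filterlim_at_split)
qed

lemma path_continuous_on: "continuous_on A \<Gamma>"
  using path_isCont continuous_at_imp_continuous_on by blast

text \<open>The pair \<open>V s\<close> of intercept and velocity is locally constant on the open
  collision-free interval, hence constant by connectedness; continuity of the path extends the line
  to both end points.\<close>

lemma path_straight:
  assumes "a < b" "\<And>t. a < t \<Longrightarrow> t < b \<Longrightarrow> \<Gamma> t \<notin> \<Union>T" "s \<in> {a..b}"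
  shows "\<Gamma> s = \<Gamma> b + (s - b) *\<^sub>R left_velocity \<Gamma> b"
proof -
  define V where "V s = (\<Gamma> s - s *\<^sub>R left_velocity \<Gamma> s, left_velocity \<Gamma> s)" for s
  have loc: "\<forall>\<^sub>F s' in nhds s. V s = V s'" if s: "s \<in> {a<..<b}" for s
  proof -
    obtain v where v: "\<forall>\<^sub>F s' in nhds s. \<Gamma> s' = \<Gamma> s + (s' - s) *\<^sub>R v"
      using path_free[of s] assms(2) s by auto
    then have "\<forall>\<^sub>F s' in nhds s. \<forall>\<^sub>F u in nhds s'. \<Gamma> u = \<Gamma> s + (u - s) *\<^sub>R v"
      by (simp add: eventually_eventually)
    then have "\<forall>\<^sub>F s' in nhds s. left_velocity \<Gamma> s' = v \<and> \<Gamma> s' = \<Gamma> s + (s' - s) *\<^sub>R v"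
    proof eventually_elim
      case (elim s')
      have eq: "\<Gamma> s' = \<Gamma> s + (s' - s) *\<^sub>R v" using eventually_nhds_x_imp_x[OF elim] .
      have "\<forall>\<^sub>F u in nhds s'. \<Gamma> u = \<Gamma> s' + (u - s') *\<^sub>R v"
        using elim by eventually_elim (simp add: eq algebra_simps)
      then show ?case using left_velocity_eqI eventually_nhds_sides eq by blast
    qed
    moreover from eventually_nhds_x_imp_x[OF this] have "left_velocity \<Gamma> s = v" by blast
    ultimately show ?thesis
      by (auto simp: V_def algebra_simps elim!: eventually_mono)
  qed
  define c where "c = (a + b) / 2"
  have c: "c \<in> {a<..<b}" using assms by (auto simp: c_def field_simps)
  have V: "V s = V c" if "s \<in> {a<..<b}" for s
  proof (rule connected_local_const[OF _ that c])
    show "\<forall>x\<in>{a<..<b}. \<forall>\<^sub>F y in at x within {a<..<b}. V x = V y"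
      by (auto simp: eventually_at_filter intro!: eventually_mono[OF loc])
  qed simp
  let ?v = "left_velocity \<Gamma> c"
  have "\<Gamma> s = \<Gamma> c - c *\<^sub>R ?v + s *\<^sub>R ?v" if "s \<in> {a<..<b}" for s
    using V[OF that] by (auto simp: V_def algebra_simps)
  then have "{a<..<b} \<subseteq> {s. \<Gamma> s = \<Gamma> c - c *\<^sub>R ?v + s *\<^sub>R ?v}" by blast
  moreover have "closed {s. \<Gamma> s = \<Gamma> c - c *\<^sub>R ?v + s *\<^sub>R ?v}"
    by (intro closed_Collect_eq path_continuous_on continuous_intros)
  ultimately have cl: "\<Gamma> s = \<Gamma> c - c *\<^sub>R ?v + s *\<^sub>R ?v" if "s \<in> {a..b}" for s
    using closure_minimal[of "{a<..<b}" "{s. \<Gamma> s = \<Gamma> c - c *\<^sub>R ?v + s *\<^sub>R ?v}"]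
      closure_greaterThanLessThan[OF assms(1)] that by (simp add: subset_iff)
  have "b \<in> {a..b}" using assms(1) by simp
  note clb = cl[OF this]
  have "\<forall>\<^sub>F s in at_left b. s \<in> {a..b}"
    using eventually_at_left_real[OF assms(1)] by eventually_elim auto
  then have "\<forall>\<^sub>F s in at_left b. \<Gamma> s = \<Gamma> b + (s - b) *\<^sub>R ?v"
  proof eventually_elim
    case (elim s)
    show ?case unfolding cl[OF elim] clb by (simp add: algebra_simps)
  qed
  then have "left_velocity \<Gamma> b = ?v" by (rule left_velocity_eqI)
  then show ?thesis
    unfolding cl[OF assms(3)] clb by (simp add: algebra_simps)
qed

text \<open>Two points of the known initial stretch determine the line of the whole free interval.
  The end point \<open>b\<close> may be a collision time: then \<open>v\<close> is the velocity of
  incidence.\<close>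

lemma path_continue:
  assumes "a < a'" "a' \<le> b" "\<And>t. a < t \<Longrightarrow> t < b \<Longrightarrow> \<Gamma> t \<notin> \<Union>T"
    and "\<And>s. a < s \<Longrightarrow> s < a' \<Longrightarrow> \<Gamma> s = p + s *\<^sub>R v"
  shows "\<And>s. s \<in> {a..b} \<Longrightarrow> \<Gamma> s = p + s *\<^sub>R v" "left_velocity \<Gamma> b = v"
proof -
  let ?w = "left_velocity \<Gamma> b"
  have st: "\<Gamma> s = \<Gamma> b + (s - b) *\<^sub>R ?w" if "s \<in> {a..b}" for s
    using path_straight[OF less_le_trans[OF assms(1,2)] assms(3) that] .
  define s1 where "s1 = a + (a' - a) / 3"
  define s2 where "s2 = a + (a' - a) / 2"
  have s12: "a < s1" "s1 < s2" "s2 < a'" using assms(1) by (auto simp: s1_def s2_def field_simps)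
  have e: "\<Gamma> b + (s1 - b) *\<^sub>R ?w = p + s1 *\<^sub>R v" "\<Gamma> b + (s2 - b) *\<^sub>R ?w = p + s2 *\<^sub>R v"
    using st[of s1] st[of s2] assms(2) assms(4)[of s1] assms(4)[of s2] s12 by auto
  have "(s2 - s1) *\<^sub>R ?w = (\<Gamma> b + (s2 - b) *\<^sub>R ?w) - (\<Gamma> b + (s1 - b) *\<^sub>R ?w)"
    by (simp add: algebra_simps)
  also have "\<dots> = (s2 - s1) *\<^sub>R v" unfolding e by (simp add: algebra_simps)
  finally show w: "?w = v" using s12 by simp
  have "\<Gamma> b - b *\<^sub>R v = p" using e(1) unfolding w by (simp add: algebra_simps)
  then show "\<Gamma> s = p + s *\<^sub>R v" if "s \<in> {a..b}" for s
    using st[OF that] unfolding w by (auto simp: algebra_simps)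
qed

lemma path_first_collision:
  assumes "s \<in> {a..b}" "\<Gamma> s \<in> \<Union>T"
  obtains t where "t \<in> {a..b}" "\<Gamma> t \<in> \<Union>T" "\<And>u. a \<le> u \<Longrightarrow> u < t \<Longrightarrow> \<Gamma> u \<notin> \<Union>T"
proof -
  let ?C = "{t \<in> {a..b}. \<Gamma> t \<in> \<Union>T}"
  have C: "finite ?C" "?C \<noteq> {}" using path_finite assms by auto
  define m where "m = Min ?C"
  have m: "m \<in> ?C" unfolding m_def by (rule Min_in[OF C])
  show thesis
  proof (rule that[of m])
    fix u assume u: "a \<le> u" "u < m"
    show "\<Gamma> u \<notin> \<Union>T"
    proof
      assume "\<Gamma> u \<in> \<Union>T"
      then have "u \<in> ?C" using u m by simp
      then have "m \<le> u" unfolding m_def by (rule Min_le[OF C(1)])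
      with u show False by simp
    qed
  qed (use m in simp_all)
qed

end

text \<open>The billiard is deterministic backwards in time. The proof looks at the infimum
  \<open>i\<close> of the backward times at which the two paths differ and carries the agreement up
  to \<open>i\<close> and then beyond it.\<close>

lemma backward_unique:
  assumes p: "billiard_path T r \<Gamma>" "billiard_path T r' \<Gamma>'"
    and eq: "\<Gamma> t = \<Gamma>' t'" "left_velocity \<Gamma> t = left_velocity \<Gamma>' t'" and "s \<ge> 0"
  shows "\<Gamma> (t - s) = \<Gamma>' (t' - s) \<and> left_velocity \<Gamma> (t - s) = left_velocity \<Gamma>' (t' - s)"
proof (rule ccontr)
  assume contra: "\<not> ?thesis"
  define P where "P s \<longleftrightarrow> \<Gamma> (t - s) = \<Gamma>' (t' - s) \<and> left_velocity \<Gamma> (t - s) = left_velocity \<Gamma>' (t' - s)" for s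
  define B where "B = {s. s \<ge> 0 \<and> \<not> P s}"
  have B: "B \<noteq> {}" "bdd_below B" using contra \<open>s \<ge> 0\<close> by (auto simp: B_def P_def intro: bdd_belowI[of _ 0])
  define i where "i = Inf B"
  have i0: "i \<ge> 0" unfolding i_def using B by (intro cInf_greatest) (auto simp: B_def)
  have before: "P u" if "0 \<le> u" "u < i" for u
    using cInf_lower[OF _ B(2), of u] that by (force simp: B_def i_def)
  \<comment> \<open>To the left of any time both paths are straight with the velocities already
    known to agree, so agreement extends a little further back.\<close>
  have step: "\<exists>\<delta>>0. \<forall>u\<in>{w..<w+\<delta>}. P u" if "P w" for w
  proof -
    obtain l where l: "l < t - w" "\<And>y. y \<in> {l<..<t-w} \<Longrightarrow> \<Gamma> y = \<Gamma> (t - w) + (y - (t - w)) *\<^sub>R left_velocity \<Gamma> (t - w)"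
      using path_left[OF p(1), of "t - w"] by (auto simp: eventually_at_left[of "t - w - 1"])
    obtain l' where l': "l' < t' - w" "\<And>y. y \<in> {l'<..<t'-w} \<Longrightarrow> \<Gamma>' y = \<Gamma>' (t' - w) + (y - (t' - w)) *\<^sub>R left_velocity \<Gamma>' (t' - w)"
      using path_left[OF p(2), of "t' - w"] by (auto simp: eventually_at_left[of "t' - w - 1"])
    define \<delta> where "\<delta> = min (t - w - l) (t' - w - l')"
    have "P u" if u: "u \<in> {w..<w+\<delta>}" for u
    proof (cases "u = w")
      case False
      have e1: "\<forall>\<^sub>F y in at_left (t - u). \<Gamma> y = \<Gamma> (t - u) + (y - (t - u)) *\<^sub>R left_velocity \<Gamma> (t - w)"
      proof -
        have "l < t - u" "t - u < t - w" using u False by (auto simp: \<delta>_def)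
        then show ?thesis
          using eventually_at_left_real[of l "t - u"]
          by (auto simp: l(2) algebra_simps elim!: eventually_mono)
      qed
      have e2: "\<forall>\<^sub>F y in at_left (t' - u). \<Gamma>' y = \<Gamma>' (t' - u) + (y - (t' - u)) *\<^sub>R left_velocity \<Gamma>' (t' - w)"
      proof -
        have "l' < t' - u" "t' - u < t' - w" using u False by (auto simp: \<delta>_def)
        then show ?thesis
          using eventually_at_left_real[of l' "t' - u"]
          by (auto simp: l'(2) algebra_simps elim!: eventually_mono)
      qed
      show ?thesis
        using left_velocity_eqI[OF e1] left_velocity_eqI[OF e2] l(2)[of "t - u"] l'(2)[of "t' - u"] u False \<open>P w\<close>
        by (auto simp: P_def \<delta>_def)
    qed (use \<open>P w\<close> in simp)
    moreover have "\<delta> > 0" using l l' by (simp add: \<delta>_def)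
    ultimately show ?thesis by blast
  qed
  \<comment> \<open>Positions agree at the infimum by continuity; the velocities have to be compared
    through the outgoing sides, where agreement is already known.\<close>
  have "P i"
  proof (cases "i = 0")
    case True
    then show ?thesis using eq by (simp add: P_def)
  next
    case False
    then have "i > 0" using i0 by simp
    have agree: "\<forall>\<^sub>F y in at_right (t - i). \<Gamma> y = \<Gamma>' (y + (t' - t))"
    proof -
      have "\<Gamma> y = \<Gamma>' (y + (t' - t))" if "y \<in> {t - i<..<t}" for y
        using before[of "t - y"] that by (simp add: P_def algebra_simps)
      then show ?thesis using eventually_at_right_real[of "t - i" t] \<open>i > 0\<close>
        by (auto elim: eventually_mono)
    qed
    have shift: "filterlim (\<lambda>y. y + (t' - t)) (at_right (t' - i)) (at_right (t - i))"
      by (auto simp: filterlim_at eventually_at_filter intro!: tendsto_eq_intros always_eventually)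
    have "(\<Gamma> \<longlongrightarrow> \<Gamma> (t - i)) (at_right (t - i))" 
      using path_isCont[OF p(1)] by (auto simp: isCont_def filterlim_at_split)
    moreover have "((\<lambda>y. \<Gamma>' (y + (t' - t))) \<longlongrightarrow> \<Gamma>' (t' - i)) (at_right (t - i))"
      using path_isCont[OF p(2), of "t' - i"] filterlim_compose[OF _ shift] by (auto simp: isCont_def filterlim_at_split)
    ultimately have pos: "\<Gamma> (t - i) = \<Gamma>' (t' - i)"
      using tendsto_cong[OF agree] tendsto_unique[of "at_right (t - i)"] by (simp add: trivial_limit_at_right_real)
    have transfer: "w = w'" 
      if "\<forall>\<^sub>F s in at_right (t - i). \<Gamma> s = \<Gamma> (t - i) + (s - (t - i)) *\<^sub>R w"
        "\<forall>\<^sub>F s in at_right (t' - i). \<Gamma>' s = \<Gamma>' (t' - i) + (s - (t' - i)) *\<^sub>R w'" for w w'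
    proof (rule right_velocity_unique[OF that(1)])
      show "\<forall>\<^sub>F s in at_right (t - i). \<Gamma> s = \<Gamma> (t - i) + (s - (t - i)) *\<^sub>R w'"
        using eventually_compose_filterlim[OF that(2) shift] agree
        by eventually_elim (simp add: pos algebra_simps)
    qed
    have "left_velocity \<Gamma> (t - i) = left_velocity \<Gamma>' (t' - i)"
    proof (cases "\<Gamma> (t - i) \<in> \<Union>T")
      case False
      from path_free[OF p(1) this] obtain v where v: "\<forall>\<^sub>F s in nhds (t - i). \<Gamma> s = \<Gamma> (t - i) + (s - (t - i)) *\<^sub>R v" by blast
      from path_free[OF p(2)] False pos obtain v' where
        v': "\<forall>\<^sub>F s in nhds (t' - i). \<Gamma>' s = \<Gamma>' (t' - i) + (s - (t' - i)) *\<^sub>R v'" by metis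
      note sides = eventually_nhds_sides[OF v] eventually_nhds_sides[OF v']
      have "v = v'"
        by (rule transfer[OF sides(1)[THEN conjunct2] sides(2)[THEN conjunct2]])
      then show ?thesis
        using left_velocity_eqI[OF sides(1)[THEN conjunct1]] left_velocity_eqI[OF sides(2)[THEN conjunct1]]
        by simp
    next
      case True
      then obtain M where M: "M \<in> T" "\<Gamma> (t - i) \<in> M" by blast
      obtain v \<nu> where v: "unit_normal M (\<Gamma> (t - i)) \<nu>"
          "\<forall>\<^sub>F s in at_left (t - i). \<Gamma> s = \<Gamma> (t - i) + (s - (t - i)) *\<^sub>R v"
          "\<forall>\<^sub>F s in at_right (t - i). \<Gamma> s = \<Gamma> (t - i) + (s - (t - i)) *\<^sub>R reflect \<nu> v"
        using path_collision(3)[OF p(1) M] by blast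
      obtain v' \<nu>' where v': "unit_normal M (\<Gamma>' (t' - i)) \<nu>'"
          "\<forall>\<^sub>F s in at_left (t' - i). \<Gamma>' s = \<Gamma>' (t' - i) + (s - (t' - i)) *\<^sub>R v'"
          "\<forall>\<^sub>F s in at_right (t' - i). \<Gamma>' s = \<Gamma>' (t' - i) + (s - (t' - i)) *\<^sub>R reflect \<nu>' v'"
        using path_collision(3)[OF p(2) M(1)] M(2)[unfolded pos] by blast
      \<comment> \<open>The two paths may use different unit normals at the common point, but both
        are multiples of one gradient and define the same reflection. It is an involution and can be
        cancelled from the equal outgoing velocities.\<close>
      obtain n where n: "\<And>\<nu>. unit_normal M (\<Gamma> (t - i)) \<nu> \<Longrightarrow> \<exists>c. c \<noteq> 0 \<and> \<nu> = c *\<^sub>R n"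
        by (rule mirror_local_equation[OF path_collision(1)[OF p(1) M]]) (use M(2) in blast)
      have "unit_normal M (\<Gamma> (t - i)) \<nu>'" using v'(1) pos by simp
      then obtain c c' where "\<nu> = c *\<^sub>R n" "\<nu>' = c' *\<^sub>R n" "c \<noteq> 0" "c' \<noteq> 0"
        using n v(1) by blast
      moreover have "reflect \<nu> v = reflect \<nu>' v'" using transfer v(3) v'(3) .
      ultimately have "reflect n v = reflect n v'" by (simp add: reflect_scaleR)
      then have "v = v'" using reflect_reflect by metis
      then show ?thesis using left_velocity_eqI[OF v(2)] left_velocity_eqI[OF v'(2)] by simp
    qed
    with pos show ?thesis by (simp add: P_def)
  qed
  then obtain \<delta> where \<delta>: "\<delta> > 0" "\<And>u. u \<in> {i..<i+\<delta>} \<Longrightarrow> P u" using step by blast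
  obtain b where "b \<in> B" "b < i + \<delta>"
    using cInf_lessD[OF B(1), of "i + \<delta>"] \<delta>(1) by (auto simp: i_def)
  then show False using \<delta>(2)[of b] cInf_lower[OF _ B(2), of b] by (auto simp: B_def i_def)
qed

section \<open>Perturbation of trajectories\<close>

text \<open>Implicit differentiation of \<open>h (q + \<sigma> *\<^sub>R v) = 0\<close> with
  \<open>\<sigma>\<close> known only to tend to 0. The expansion of \<open>h\<close> gives
  \<open>\<nu> \<bullet> fst \<delta> + \<sigma> * c = o(norm \<delta> +
  \<bar>\<sigma>\<bar>)\<close>, where \<open>c = \<nu> \<bullet> v0\<close>; transversality bounds
  the hitting time by a multiple of \<open>norm \<delta>\<close>.\<close>

lemma hitting_time_derivative:
  fixes h :: "'a::euclidean_space \<Rightarrow> real" and \<sigma> :: "'a \<times> 'a \<Rightarrow> real"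
  assumes h: "(h has_derivative (\<lambda>w. \<nu> \<bullet> w)) (at m)" and c: "\<nu> \<bullet> v0 \<noteq> 0"
    and lim: "(\<sigma> \<longlongrightarrow> 0) (nhds (m, v0))" and \<sigma>0: "\<sigma> (m, v0) = 0"
    and zero: "\<forall>\<^sub>F x in nhds (m, v0). h (fst x + \<sigma> x *\<^sub>R snd x) = 0"
  shows "(\<sigma> has_derivative (\<lambda>\<delta>. - (\<nu> \<bullet> fst \<delta>) / (\<nu> \<bullet> v0))) (at (m, v0))"
proof -
  let ?x0 = "(m, v0)" and ?c = "\<nu> \<bullet> v0" and ?A = "\<lambda>\<delta>::'a \<times> 'a. - (\<nu> \<bullet> fst \<delta>) / (\<nu> \<bullet> v0)"
  have hm: "h m = 0" using eventually_nhds_x_imp_x[OF zero] \<sigma>0 by simp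
  define H where "H p = h (fst (fst p) + snd p *\<^sub>R snd (fst p))" for p :: "('a \<times> 'a) \<times> real"
  have dG: "((\<lambda>p :: ('a \<times> 'a) \<times> real. fst (fst p) + snd p *\<^sub>R snd (fst p)) has_derivative
      (\<lambda>p. fst (fst p) + snd p *\<^sub>R v0)) (at (?x0, 0))"
    by (auto intro!: derivative_eq_intros)
  have dH: "(H has_derivative (\<lambda>p. \<nu> \<bullet> fst (fst p) + snd p * ?c)) (at (?x0, 0))"
    using has_derivative_compose[OF dG, of h "\<lambda>w. \<nu> \<bullet> w"] h by (simp add: H_def[abs_def] inner_add_right)
  show ?thesis
    unfolding has_derivative_at_alt
  proof (intro conjI allI impI)
    show "bounded_linear ?A"
      unfolding linear_conv_bounded_linear[symmetric]
      by (rule linearI) (auto simp: inner_add_right add_divide_distrib diff_divide_distrib)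
    fix e :: real assume e: "e > 0"
    \<comment> \<open>Will bound \<open>norm \<delta> + \<bar>\<sigma> x\<bar>\<close> by
      \<open>K * norm \<delta>\<close>.\<close>
    define K where "K = 2 + 2 * norm \<nu> / \<bar>?c\<bar>"
    have K: "K > 0" "K \<ge> 2" by (auto simp: K_def add_pos_nonneg)
    \<comment> \<open>The first bound lets the term with \<open>\<sigma> x\<close> be absorbed on
      the left; the second leaves the error \<open>e\<close> after multiplication by
      \<open>K\<close> and division by \<open>\<bar>?c\<bar>\<close>.\<close>
    define e' where "e' = min (\<bar>?c\<bar> / 2) (e * \<bar>?c\<bar> / K)"
    have e': "e' > 0" "e' \<le> \<bar>?c\<bar> / 2" "e' * K \<le> e * \<bar>?c\<bar>"
      using e c K by (auto simp: e'_def min_def field_simps)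
    obtain d where d: "d > 0" "\<And>y. norm (y - (?x0, 0)) < d \<Longrightarrow>
        norm (H y - H (?x0, 0) - (\<nu> \<bullet> fst (fst (y - (?x0, 0))) + snd (y - (?x0, 0)) * ?c)) \<le> e' * norm (y - (?x0, 0))"
      using dH[unfolded has_derivative_at_alt] e'(1) by meson
    have "\<forall>\<^sub>F x in nhds ?x0. \<bar>\<sigma> x\<bar> < d / 2"
      using tendstoD[OF lim, of "d / 2"] d by (simp add: dist_real_def)
    moreover have "\<forall>\<^sub>F x in nhds ?x0. dist x ?x0 < d / 2"
      using eventually_nhds_metric[of _ ?x0] d by (metis half_gt_zero)
    ultimately have "\<forall>\<^sub>F x in nhds ?x0. norm (\<sigma> x - \<sigma> ?x0 - ?A (x - ?x0)) \<le> e * norm (x - ?x0)"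
      using zero
    proof eventually_elim
      case (elim x)
      define \<delta> where "\<delta> = x - ?x0"
      have nle: "norm (\<delta>, \<sigma> x) \<le> norm \<delta> + \<bar>\<sigma> x\<bar>" using norm_Pair_le[of \<delta> "\<sigma> x"] by simp
      have "norm (\<delta>, \<sigma> x) < d" using nle elim by (simp add: \<delta>_def dist_norm)
      then have "\<bar>\<nu> \<bullet> fst \<delta> + \<sigma> x * ?c\<bar> \<le> e' * norm (\<delta>, \<sigma> x)"
        using d(2)[of "(x, \<sigma> x)"] elim hm by (simp add: H_def \<delta>_def abs_minus_commute)
      also have "\<dots> \<le> e' * (norm \<delta> + \<bar>\<sigma> x\<bar>)" using nle e' by (intro mult_left_mono) auto
      finally have 1: "\<bar>\<nu> \<bullet> fst \<delta> + \<sigma> x * ?c\<bar> \<le> e' * (norm \<delta> + \<bar>\<sigma> x\<bar>)" .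
      have 2: "\<bar>\<nu> \<bullet> fst \<delta>\<bar> \<le> norm \<nu> * norm \<delta>"
        using Cauchy_Schwarz_ineq2[of \<nu> "fst \<delta>"] norm_fst_le[of "fst \<delta>" "snd \<delta>"]
        by (simp) (meson mult_left_mono norm_ge_zero order_trans)
      have "\<bar>\<sigma> x\<bar> * \<bar>?c\<bar> \<le> \<bar>\<nu> \<bullet> fst \<delta> + \<sigma> x * ?c\<bar> + \<bar>\<nu> \<bullet> fst \<delta>\<bar>"
        by (simp flip: abs_mult)
      also have "\<dots> \<le> e' * norm \<delta> + e' * \<bar>\<sigma> x\<bar> + norm \<nu> * norm \<delta>"
        using 1 2 by (simp add: algebra_simps)
      also have "\<dots> \<le> \<bar>?c\<bar> / 2 * norm \<delta> + \<bar>?c\<bar> / 2 * \<bar>\<sigma> x\<bar> + norm \<nu> * norm \<delta>"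
        using e'(2) by (intro add_mono mult_right_mono) auto
      finally have 3: "\<bar>\<sigma> x\<bar> * \<bar>?c\<bar> \<le> (\<bar>?c\<bar> + 2 * norm \<nu>) * norm \<delta>" by (simp add: algebra_simps)
      have "\<bar>\<sigma> x\<bar> \<le> (1 + 2 * norm \<nu> / \<bar>?c\<bar>) * norm \<delta>"
        using 3 c by (simp add: field_simps)
      then have "norm \<delta> + \<bar>\<sigma> x\<bar> \<le> K * norm \<delta>" by (simp add: K_def algebra_simps)
      then have "\<bar>\<nu> \<bullet> fst \<delta> + \<sigma> x * ?c\<bar> \<le> e' * (K * norm \<delta>)"
        using 1 e'(1) by (meson mult_left_mono order_trans less_imp_le)
      also have "\<dots> \<le> e * \<bar>?c\<bar> * norm \<delta>"
        using e'(3) by (metis mult.assoc mult_right_mono norm_ge_zero)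
      finally have "\<bar>\<nu> \<bullet> fst \<delta> + \<sigma> x * ?c\<bar> / \<bar>?c\<bar> \<le> e * norm \<delta>"
        using c by (simp add: field_simps)
      moreover have "\<sigma> x - \<sigma> ?x0 - ?A \<delta> = (\<nu> \<bullet> fst \<delta> + \<sigma> x * ?c) / ?c"
        using c \<sigma>0 by (simp add: field_simps)
      ultimately show ?case by (simp only: \<delta>_def real_norm_def abs_divide)
    qed
    then show "\<exists>d>0. \<forall>y. norm (y - ?x0) < d \<longrightarrow> norm (\<sigma> y - \<sigma> ?x0 - ?A (y - ?x0)) \<le> e * norm (y - ?x0)"
      unfolding eventually_nhds_metric dist_norm by blast
  qed
qed

text \<open>A collision acts instantaneously when the ray is continued backwards along its new
  direction; this back-propagated collision map has a block triangular derivative.\<close>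

lemma collision_map_derivative:
  fixes h :: "real^'n::finite \<Rightarrow> real" and \<sigma> :: "(real^'n) \<times> (real^'n) \<Rightarrow> real"
  assumes h: "(h has_derivative (\<lambda>w. n m \<bullet> w)) (at m)" and n: "n differentiable (at m)"
    and c: "n m \<bullet> v0 \<noteq> 0"
    and lim: "(\<sigma> \<longlongrightarrow> 0) (nhds (m, v0))" "\<sigma> (m, v0) = 0"
    and zero: "\<forall>\<^sub>F x in nhds (m, v0). h (fst x + \<sigma> x *\<^sub>R snd x) = 0"
  defines "w \<equiv> \<lambda>x. reflect (n (fst x + \<sigma> x *\<^sub>R snd x)) (snd x)"
  shows "\<exists>L. unimodular L \<and> ((\<lambda>x. (fst x + \<sigma> x *\<^sub>R (snd x - w x), w x)) has_derivative L) (at (m, v0))"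
proof -
  define \<nu> where "\<nu> = n m"
  have \<nu>: "\<nu> \<bullet> v0 \<noteq> 0" "\<nu> \<bullet> \<nu> \<noteq> 0" using c by (auto simp: \<nu>_def)
  define A where "A \<delta> = - (\<nu> \<bullet> fst \<delta>) / (\<nu> \<bullet> v0)" for \<delta> :: "(real^'n) \<times> (real^'n)"
  have d\<sigma>: "(\<sigma> has_derivative A) (at (m, v0))"
    using hitting_time_derivative[OF h c lim zero] by (simp add: A_def[abs_def] \<nu>_def)
  obtain N where N: "(n has_derivative N) (at m)" using n differentiable_def by blast
  have lN: "linear N" using N has_derivative_linear by blast
  \<comment> \<open>Derivative of the hit point: projection along \<open>v0\<close> onto the tangent
    hyperplane. The velocity increment drops out because \<open>\<sigma>\<close> vanishes at the
    base point, and this makes the derivative triangular.\<close>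
  define Z where "Z q = q - ((\<nu> \<bullet> q) / (\<nu> \<bullet> v0)) *\<^sub>R v0" for q
  have dz: "((\<lambda>x. fst x + \<sigma> x *\<^sub>R snd x) has_derivative (\<lambda>\<delta>. Z (fst \<delta>))) (at (m, v0))"
    by (rule derivative_eq_intros d\<sigma> refl)+ (auto simp: lim Z_def A_def)
  have dn: "((\<lambda>x. n (fst x + \<sigma> x *\<^sub>R snd x)) has_derivative (\<lambda>\<delta>. N (Z (fst \<delta>)))) (at (m, v0))"
    using has_derivative_compose[OF dz, of n N] N by (simp add: lim)
  define k where "k x = 2 * (snd x \<bullet> n (fst x + \<sigma> x *\<^sub>R snd x)) /
      (n (fst x + \<sigma> x *\<^sub>R snd x) \<bullet> n (fst x + \<sigma> x *\<^sub>R snd x))" for x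
  have w: "w x = snd x - k x *\<^sub>R n (fst x + \<sigma> x *\<^sub>R snd x)" for x
    by (simp add: w_def reflect_def k_def)
  have k0: "k (m, v0) = 2 * (v0 \<bullet> \<nu>) / (\<nu> \<bullet> \<nu>)" by (simp add: k_def lim \<nu>_def)
  define B where "B q = 2 * (v0 \<bullet> N (Z q)) / (\<nu> \<bullet> \<nu>)
      - 4 * (v0 \<bullet> \<nu>) * (\<nu> \<bullet> N (Z q)) / (\<nu> \<bullet> \<nu>)\<^sup>2" for q
  have dk: "(k has_derivative (\<lambda>\<delta>. 2 * (snd \<delta> \<bullet> \<nu>) / (\<nu> \<bullet> \<nu>) + B (fst \<delta>))) (at (m, v0))"
    unfolding k_def
    by (rule derivative_eq_intros dn refl)+
      (use \<nu> in \<open>auto simp: lim B_def \<nu>_def[symmetric] field_simps power2_eq_square inner_commute\<close>)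
  define K where "K q = - (B q *\<^sub>R \<nu> + k (m, v0) *\<^sub>R N (Z q))" for q
  have dw: "(w has_derivative (\<lambda>\<delta>. reflect \<nu> (snd \<delta>) + K (fst \<delta>))) (at (m, v0))"
    unfolding w
    by (rule derivative_eq_intros dn dk refl)+
      (auto simp: lim K_def reflect_def \<nu>_def[symmetric] algebra_simps)
  \<comment> \<open>Again \<open>\<sigma>\<close> is 0 at the base point, so \<open>dw\<close>
    contributes nothing; the term \<open>A \<delta>\<close> times the velocity jump along
    \<open>\<nu>\<close> completes \<open>fst \<delta>\<close> to its reflection.\<close>
  have dq: "((\<lambda>x. fst x + \<sigma> x *\<^sub>R (snd x - w x)) has_derivative (\<lambda>\<delta>. reflect \<nu> (fst \<delta>))) (at (m, v0))"
    by (rule derivative_eq_intros dw d\<sigma> refl)+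
      (use \<nu> in \<open>auto simp: lim w k0 A_def \<nu>_def[symmetric] reflect_def inner_commute\<close>)
  have lZ: "linear Z" by (rule linearI) (auto simp: Z_def inner_add_right algebra_simps add_divide_distrib)
  have lB: "linear B" 
    by (rule linearI) (auto simp: B_def linear_add[OF lZ] linear_add[OF lN] linear_cmul[OF lZ] linear_cmul[OF lN]
       inner_add_right algebra_simps add_divide_distrib)
  have lK: "linear K" 
    by (rule linearI) (auto simp: K_def linear_add[OF lZ] linear_add[OF lN] linear_cmul[OF lZ] linear_cmul[OF lN]
      linear_add[OF lB] linear_cmul[OF lB] algebra_simps)
  have "unimodular (\<lambda>(a, b). (reflect \<nu> a, reflect \<nu> b))"
    by (rule unimodular_isometry)
      (auto intro!: linearI simp: norm_Pair linear_add[OF linear_reflect] linear_cmul[OF linear_reflect])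
  \<comment> \<open>The derivative factors into the reflection of both blocks followed by a shear.
    The shear uses \<open>K\<close> after \<open>reflect \<nu>\<close>, so that the involution
    cancels and \<open>K (fst \<delta>)\<close> remains.\<close>
  from unimodular_compose[OF unimodular_shear[OF linear_compose[OF linear_reflect[of \<nu>] lK]] this]
  have "unimodular (\<lambda>\<delta>. (reflect \<nu> (fst \<delta>), reflect \<nu> (snd \<delta>) + K (fst \<delta>)))"
    by (simp add: o_def case_prod_unfold)
  with has_derivative_Pair[OF dq dw] show ?thesis by blast
qed

text \<open>The sign of the equation is free. It is chosen so that \<open>h\<close> increases along
  the incoming ray; after reflection \<open>h\<close> decreases.\<close>

lemma mirror_local_equation_oriented:
  fixes M :: "'a::euclidean_space set"
  assumes "m \<in> mirror_interior M" "unit_normal M m \<nu>" "v \<bullet> \<nu> \<noteq> 0"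
  obtains U h n where "open U" "m \<in> U" "\<And>z. z \<in> U \<Longrightarrow> z \<in> M \<longleftrightarrow> h z = 0"
    "\<And>z. z \<in> U \<Longrightarrow> (h has_derivative (\<lambda>w. n z \<bullet> w)) (at z)"
    "\<And>z. z \<in> U \<Longrightarrow> n differentiable (at z)" "n m \<bullet> v > 0"
    "\<And>z \<nu>. z \<in> U \<Longrightarrow> z \<in> M \<Longrightarrow> unit_normal M z \<nu> \<Longrightarrow> \<exists>c. c \<noteq> 0 \<and> \<nu> = c *\<^sub>R n z"
proof -
  obtain U h n where U: "open U" "m \<in> U" "U \<inter> M = {z \<in> U. h z = 0}"
    "\<And>z. z \<in> U \<Longrightarrow> (h has_derivative (\<lambda>w. n z \<bullet> w)) (at z)"
    "\<And>z. z \<in> U \<Longrightarrow> n differentiable (at z)"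
    "\<And>z \<nu>. z \<in> U \<inter> M \<Longrightarrow> unit_normal M z \<nu> \<Longrightarrow> \<exists>c. c \<noteq> 0 \<and> \<nu> = c *\<^sub>R n z"
    by (rule mirror_local_equation[OF assms(1)]) blast
  have "m \<in> M" using assms(1) by (simp add: mirror_interior_def manifold_interior_def)
  then obtain c where "c \<noteq> 0" "\<nu> = c *\<^sub>R n m" using U(6)[OF IntI[OF U(2)] assms(2)] by blast
  then have "n m \<bullet> v \<noteq> 0" using assms(3) by (simp add: inner_commute)
  then consider "n m \<bullet> v > 0" | "n m \<bullet> v < 0" by linarith
  then show thesis
  proof cases
    case 1
    show thesis
      by (rule that[of U h n]) (use U 1 in \<open>blast+\<close>)
  next
    case 2
    have der: "((\<lambda>z. - h z) has_derivative (\<lambda>w. - n z \<bullet> w)) (at z)" if "z \<in> U" for z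
      using has_derivative_minus[OF U(4)[OF that]] by simp
    have nor: "\<exists>c. c \<noteq> 0 \<and> \<nu> = c *\<^sub>R (- n z)" if z: "z \<in> U" "z \<in> M" "unit_normal M z \<nu>" for z \<nu>
    proof -
      obtain c where "c \<noteq> 0" "\<nu> = c *\<^sub>R n z" using U(6)[OF IntI[OF z(1,2)] z(3)] by blast
      then show ?thesis by (intro exI[of _ "- c"]) simp
    qed
    show thesis
      by (rule that[of U "\<lambda>z. - h z" "\<lambda>z. - n z"])
        (use U(1,2,3) 2 der nor differentiable_minus[OF U(5)] in auto)
  qed
qed

lemma free_flight_bounded_linear: "bounded_linear (free_flight t :: 'a \<times> 'a \<Rightarrow> 'a \<times> 'a::euclidean_space)"
  unfolding linear_conv_bounded_linear[symmetric]
  by (rule linearI) (auto simp: free_flight_def algebra_simps)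

lemma isCont_nhds: "isCont f x \<Longrightarrow> (f \<longlongrightarrow> f x) (nhds x)"
  by (simp add: isCont_def tendsto_at_iff_tendsto_nhds)

lemma isCont_box:
  fixes f :: "'a::real_normed_vector \<times> 'b::real_normed_vector \<Rightarrow> 'c::topological_space"
  assumes "isCont f (a, b)" "open S" "f (a, b) \<in> S"
  obtains d where "d > 0" "\<And>x y. norm (x - a) < d \<Longrightarrow> norm (y - b) < d \<Longrightarrow> f (x, y) \<in> S"
proof -
  have "\<forall>\<^sub>F p in nhds (a, b). f p \<in> S"
    using assms unfolding continuous_at_open eventually_nhds by blast
  then obtain d where d: "d > 0" "\<And>p. dist p (a, b) < d \<Longrightarrow> f p \<in> S"
    unfolding eventually_nhds_metric by blast
  show thesis
  proof (rule that[of "d/2"])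
    fix x y assume "norm (x - a) < d/2" "norm (y - b) < d/2"
    then have "dist (x, y) (a, b) < d"
      using norm_Pair_le[of "x - a" "y - b"] by (simp add: dist_norm)
    then show "f (x, y) \<in> S" by (rule d(2))
  qed (use d in simp)
qed

text \<open>\<open>g y\<close> is the position at time \<open>0\<close> and the velocity of the line which the path \<open>\<Gamma> y\<close>
  follows before the collision; \<open>g' y\<close> is the same for the line followed afterwards.\<close>

lemma collision_perturbation:
  fixes \<Gamma> :: "(real^'n) \<times> (real^'n) \<Rightarrow> real \<Rightarrow> real^'n::finite"
  assumes T: "finite T" "\<And>M. M \<in> T \<Longrightarrow> closed M"
    and path: "\<forall>\<^sub>F y in nhds x. billiard_path T (r y) (\<Gamma> y)"
    and coll: "\<Gamma> x t0 \<in> \<Union>T" and "\<alpha> < t0"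
    and g: "(g has_derivative L) (at x)" "unimodular L"
    and follow: "\<And>a b. \<alpha> < a \<Longrightarrow> a \<le> b \<Longrightarrow> b < t0 \<Longrightarrow>
      \<forall>\<^sub>F y in nhds x. \<forall>s\<in>{a..b}. \<Gamma> y s = fst (g y) + s *\<^sub>R snd (g y) \<and> \<Gamma> y s \<notin> \<Union>T"
  obtains g' L' \<beta> where "t0 < \<beta>" "unimodular L'" "(g' has_derivative L') (at x)"
    "\<forall>\<epsilon>. 0 < \<epsilon> \<longrightarrow> t0 + \<epsilon> < \<beta> \<longrightarrow> (\<forall>\<^sub>F y in nhds x.
       (\<exists>t1. {s \<in> {t0-\<epsilon>..t0+\<epsilon>}. \<Gamma> y s \<in> \<Union>T} = {t1}) \<and>
       (\<forall>s\<in>{t0+\<epsilon>..\<beta>}. \<Gamma> y s = fst (g' y) + s *\<^sub>R snd (g' y) \<and> \<Gamma> y s \<notin> \<Union>T))"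
proof -
  obtain M where M: "M \<in> T" "\<Gamma> x t0 \<in> M" using coll by blast
  have px: "billiard_path T (r x) (\<Gamma> x)" using eventually_nhds_x_imp_x[OF path] .
  define v0 where "v0 = snd (g x)"
  define m where "m = fst (g x) + t0 *\<^sub>R v0"
  have line: "\<Gamma> x s = fst (g x) + s *\<^sub>R v0 \<and> \<Gamma> x s \<notin> \<Union>T" if "\<alpha> < s" "s < t0" for s
    using eventually_nhds_x_imp_x[OF follow[OF that(1) order_refl that(2)]]
    unfolding v0_def by (rule bspec) simp
  note cont = path_continue[OF px \<open>\<alpha> < t0\<close> order_refl conjunct2[OF line] conjunct1[OF line]]
  have m: "\<Gamma> x t0 = m" "left_velocity (\<Gamma> x) t0 = v0"
    using cont(1)[of t0] cont(2) \<open>\<alpha> < t0\<close> by (auto simp: m_def)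
  obtain v \<nu> where v: "unit_normal M m \<nu>" "v \<bullet> \<nu> \<noteq> 0" "\<forall>\<^sub>F s in at_left t0. \<Gamma> x s = m + (s - t0) *\<^sub>R v"
    using path_collision(3)[OF px M] unfolding m(1) by blast
  have "v = v0" using left_velocity_eqI[of "\<Gamma> x" t0 v] v(3) m by simp
  have mi: "m \<in> mirror_interior M" using path_collision(1)[OF px M] m(1) by simp
  obtain U h n where U: "open U" "m \<in> U" "\<And>z. z \<in> U \<Longrightarrow> z \<in> M \<longleftrightarrow> h z = 0"
    "\<And>z. z \<in> U \<Longrightarrow> (h has_derivative (\<lambda>w. n z \<bullet> w)) (at z)"
    "\<And>z. z \<in> U \<Longrightarrow> n differentiable (at z)" "n m \<bullet> v0 > 0"
    "\<And>z \<nu>. z \<in> U \<Longrightarrow> z \<in> M \<Longrightarrow> unit_normal M z \<nu> \<Longrightarrow> \<exists>c. c \<noteq> 0 \<and> \<nu> = c *\<^sub>R n z"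
    by (rule mirror_local_equation_oriented[OF mi v(1,2)[unfolded \<open>v = v0\<close>]]) blast
  define v0' where "v0' = reflect (n m) v0"
  have n0: "n m \<noteq> 0" using U(6) by auto
  have v0': "n m \<bullet> v0' < 0"
    using U(6) by (simp add: v0'_def inner_commute[of "n m"] reflect_inner_normal)
  have "closed (\<Union>(T - {M}))" using T by (intro closed_Union) auto
  moreover have "m \<notin> \<Union>(T - {M})"
    using path_collision(2)[OF px M] m(1) by auto
  ultimately have "open (U - \<Union>(T - {M}))" "m \<in> U - \<Union>(T - {M})" using U by (auto intro: open_Diff)
  then obtain r1 where r1: "r1 > 0" "ball m r1 \<subseteq> U - \<Union>(T - {M})" using openE by blast
  have cn: "isCont n m" using U(2,5) differentiable_imp_continuous_within by blast
  have cn1: "isCont (\<lambda>p. n (fst p)) (m, w)" for w :: "real^'n"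
    by (rule isCont_o2[where g=n]) (use cn in \<open>auto intro: isCont_fst\<close>)
  \<comment> \<open>Near the base collision, incoming velocities increase \<open>h\<close>
    (\<open>d1\<close>), velocities close to \<open>v0'\<close> decrease it (\<open>d2\<close>), and
    reflection sends the incoming ones into the latter set (\<open>d3\<close>).\<close>
  obtain d1 where d1: "d1 > 0" "\<And>z w. norm (z - m) < d1 \<Longrightarrow> norm (w - v0) < d1 \<Longrightarrow> n z \<bullet> w > 0"
    by (rule isCont_box[where f="\<lambda>p. n (fst p) \<bullet> snd p" and a=m and b=v0 and S="{0<..}"]) (use U(6) cn1 in auto)
  obtain d2 where d2: "d2 > 0" "\<And>z w. norm (z - m) < d2 \<Longrightarrow> norm (w - v0') < d2 \<Longrightarrow> n z \<bullet> w < 0"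
    by (rule isCont_box[where f="\<lambda>p. n (fst p) \<bullet> snd p" and a=m and b=v0' and S="{..<0}"]) (use v0' cn1 in auto)
  have "isCont (\<lambda>p. reflect (n (fst p)) (snd p)) (m, v0)"
    unfolding reflect_def using cn1 n0 by (intro continuous_intros) auto
  then obtain d3 where d3: "d3 > 0" "\<And>z w. norm (z - m) < d3 \<Longrightarrow> norm (w - v0) < d3 \<Longrightarrow> norm (reflect (n z) w - v0') < d2"
    by (rule isCont_box[where a=m and b=v0 and S="ball v0' d2"]) (use d2(1) in \<open>auto simp: v0'_def dist_norm norm_minus_commute\<close>)
  define d where "d = min r1 (min d1 (min d2 d3))"
  have d: "d > 0" using r1 d1 d2 d3 by (simp add: d_def)
  have near: "z \<in> U" "z \<in> \<Union>T \<longleftrightarrow> h z = 0" "z \<in> \<Union>T \<Longrightarrow> z \<in> M" if "norm (z - m) < d" for z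
  proof -
    have "z \<in> ball m r1" using that by (simp add: d_def dist_norm norm_minus_commute)
    then have "z \<in> U" "z \<notin> \<Union>(T - {M})" using r1(2) by auto
    then show "z \<in> U" "z \<in> \<Union>T \<longleftrightarrow> h z = 0" "z \<in> \<Union>T \<Longrightarrow> z \<in> M" using U(3)[of z] M(1) by auto
  qed
  define B where "B = norm v0 + d"
  have B: "B > 0" using d by (simp add: B_def add_nonneg_pos)
  \<comment> \<open>At speed at most \<open>B\<close> a time \<open>\<epsilon>0\<close> moves a
    point by at most d/8. Thus the incoming line stays within d/4 + d/8 < d/2 of \<open>m\<close>,
    and an outgoing one of duration \<open>2 * \<epsilon>0\<close> within d/2 + d/4 < d.\<close>
  define \<epsilon>0 where "\<epsilon>0 = min ((t0 - \<alpha>) / 2) (d / (8 * B))"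
  have \<epsilon>0: "\<epsilon>0 > 0" "\<alpha> < t0 - \<epsilon>0" "\<epsilon>0 * B \<le> d / 8"
    using \<open>\<alpha> < t0\<close> d B by (auto simp: \<epsilon>0_def min_def field_simps)
  define good where "good X \<longleftrightarrow> norm (fst X - m) < d / 4 \<and> norm (snd X - v0) < d" for X
  have goodv: "norm (snd X) \<le> B" if "good X" for X
    using that norm_triangle_sub[of "snd X" v0] by (simp add: good_def B_def)
  have inball: "norm (fst X + s *\<^sub>R snd X - m) < d / 2" if "good X" "\<bar>s\<bar> \<le> \<epsilon>0" for X s
  proof -
    have "norm (s *\<^sub>R snd X) \<le> \<epsilon>0 * B" using goodv[OF that(1)] that(2) B \<epsilon>0 by (simp add: mult_mono)
    moreover have "norm (fst X + s *\<^sub>R snd X - m) \<le> norm (fst X - m) + norm (s *\<^sub>R snd X)"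
      by (metis add_diff_eq add.commute norm_triangle_ineq diff_add_eq)
    ultimately show ?thesis using that(1) \<epsilon>0 d by (simp add: good_def)
  qed
  have incr: "h (fst X + s *\<^sub>R snd X) < h (fst X + s' *\<^sub>R snd X)"
    if X: "good X" and s: "- \<epsilon>0 \<le> s" "s < s'" "s' \<le> \<epsilon>0" for X s s'
  proof (rule DERIV_pos_imp_increasing[OF s(2)])
    fix u assume "s \<le> u" "u \<le> s'"
    then have u: "norm (fst X + u *\<^sub>R snd X - m) < d / 2" using inball[OF X, of u] s by auto
    then have "(h has_derivative (\<lambda>w. n (fst X + u *\<^sub>R snd X) \<bullet> w)) (at (fst X + u *\<^sub>R snd X))"
      using near U(4) d by auto
    moreover have "((\<lambda>s. fst X + s *\<^sub>R snd X) has_derivative (\<lambda>w. w *\<^sub>R snd X)) (at u)"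
      by (auto intro!: derivative_eq_intros)
    ultimately have "((\<lambda>s. h (fst X + s *\<^sub>R snd X)) has_derivative (\<lambda>w. n (fst X + u *\<^sub>R snd X) \<bullet> (w *\<^sub>R snd X))) (at u)"
      using has_derivative_compose by blast
    then have "((\<lambda>s. h (fst X + s *\<^sub>R snd X)) has_real_derivative n (fst X + u *\<^sub>R snd X) \<bullet> snd X) (at u)"
      unfolding has_field_derivative_def by (rule has_derivative_eq_rhs) (simp add: fun_eq_iff mult.commute)
    moreover have "n (fst X + u *\<^sub>R snd X) \<bullet> snd X > 0"
      using X u d by (intro d1) (auto simp: good_def d_def)
    ultimately show "\<exists>y. ((\<lambda>s. h (fst X + s *\<^sub>R snd X)) has_real_derivative y) (at u) \<and> 0 < y" by blast
  qed
  have uniq: "s = s'" if "good X" "\<bar>s\<bar> \<le> \<epsilon>0" "\<bar>s'\<bar> \<le> \<epsilon>0" "h (fst X + s *\<^sub>R snd X) = 0" "h (fst X + s' *\<^sub>R snd X) = 0" for X s s'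
    using incr[OF that(1), of s s'] incr[OF that(1), of s' s] that by force
  \<comment> \<open>The hitting time relative to \<open>t0\<close>, of either sign; strict
    monotonicity of \<open>h\<close> along the ray makes it unique.\<close>
  define \<sigma> where "\<sigma> X = (SOME s. \<bar>s\<bar> \<le> \<epsilon>0 \<and> h (fst X + s *\<^sub>R snd X) = 0)" for X
  have \<sigma>: "\<sigma> X = s" if "good X" "\<bar>s\<bar> \<le> \<epsilon>0" "h (fst X + s *\<^sub>R snd X) = 0" for X s
    unfolding \<sigma>_def by (rule some_equality) (use that uniq in auto)
  have good_ev: "\<forall>\<^sub>F X in nhds (m, v0). good X"
  proof -
    have "open {X. good X}" unfolding good_def
      by (intro open_Collect_conj open_Collect_less continuous_intros)
    moreover have "good (m, v0)" using d by (simp add: good_def)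
    ultimately show ?thesis unfolding eventually_nhds by blast
  qed
  have hm: "h m = 0" using near(2)[of m] d coll m(1) by simp
  have \<sigma>0: "\<sigma> (m, v0) = 0"
    using \<sigma>[of "(m, v0)" 0] eventually_nhds_x_imp_x[OF good_ev] hm \<epsilon>0 by simp
  have hit: "\<forall>\<^sub>F X in nhds (m, v0). good X \<and> \<bar>\<sigma> X\<bar> < \<epsilon> \<and> h (fst X + \<sigma> X *\<^sub>R snd X) = 0"
    if \<epsilon>: "0 < \<epsilon>" "\<epsilon> < \<epsilon>0" for \<epsilon>
  proof -
    have ch: "isCont h z" if "norm (z - m) < d" for z
      using U(4) near that has_derivative_continuous by blast
    have g0: "good (m, v0)" using eventually_nhds_x_imp_x[OF good_ev] .
    have lim: "((\<lambda>X. h (fst X + s *\<^sub>R snd X)) \<longlongrightarrow> h (m + s *\<^sub>R v0)) (nhds (m, v0))" if "\<bar>s\<bar> \<le> \<epsilon>0" for s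
    proof -
      have "isCont h (m + s *\<^sub>R v0)" using inball[OF g0 that] d by (intro ch) simp
      moreover have "((\<lambda>X. fst X + s *\<^sub>R snd X) \<longlongrightarrow> m + s *\<^sub>R v0) (nhds (m, v0))"
        using tendsto_fst[OF filterlim_ident[of "nhds (m, v0)"]] tendsto_snd[OF filterlim_ident[of "nhds (m, v0)"]]
        by (intro tendsto_intros) auto
      ultimately show ?thesis using isCont_tendsto_compose by blast
    qed
    \<comment> \<open>\<open>h\<close> changes sign between the times \<open>-\<epsilon>\<close> and
      \<open>\<epsilon>\<close> on the base ray, hence on nearby rays too, and the intermediate
      value theorem supplies the zero.\<close>
    have neg: "h (m + (- \<epsilon>) *\<^sub>R v0) < 0" and pos: "h (m + \<epsilon> *\<^sub>R v0) > 0"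
      using incr[OF g0, of "-\<epsilon>" 0] incr[OF g0, of 0 \<epsilon>] hm \<epsilon> by auto
    have "\<forall>\<^sub>F X in nhds (m, v0). h (fst X + (- \<epsilon>) *\<^sub>R snd X) < 0"
      by (rule order_tendstoD(2)[OF lim neg]) (use \<epsilon> in auto)
    moreover have "\<forall>\<^sub>F X in nhds (m, v0). 0 < h (fst X + \<epsilon> *\<^sub>R snd X)"
      by (rule order_tendstoD(1)[OF lim pos]) (use \<epsilon> in auto)
    ultimately show ?thesis using good_ev
    proof eventually_elim
      case (elim X)
      have "\<exists>s\<ge>-\<epsilon>. s \<le> \<epsilon> \<and> h (fst X + s *\<^sub>R snd X) = 0"
      proof (rule IVT)
        show "\<forall>s. - \<epsilon> \<le> s \<and> s \<le> \<epsilon> \<longrightarrow> isCont (\<lambda>s. h (fst X + s *\<^sub>R snd X)) s"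
        proof (intro allI impI)
          fix s assume "- \<epsilon> \<le> s \<and> s \<le> \<epsilon>"
          then have "\<bar>s\<bar> \<le> \<epsilon>0" using \<epsilon> by linarith
          then have "isCont h (fst X + s *\<^sub>R snd X)"
            using inball[OF elim(3), of s] d by (intro ch) auto
          then show "isCont (\<lambda>s. h (fst X + s *\<^sub>R snd X)) s"
            by (rule isCont_o2[where g=h, rotated]) (intro continuous_intros)
        qed
      qed (use elim \<epsilon> in auto)
      then obtain s where s: "- \<epsilon> \<le> s" "s \<le> \<epsilon>" "h (fst X + s *\<^sub>R snd X) = 0" by blast
      then have "s \<noteq> - \<epsilon>" "s \<noteq> \<epsilon>" using elim by auto
      moreover have "\<sigma> X = s" using \<sigma>[OF elim(3), of s] s \<epsilon> by auto
      ultimately show ?case using s elim by auto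
    qed
  qed
  have lim\<sigma>: "(\<sigma> \<longlongrightarrow> 0) (nhds (m, v0))"
  proof (rule tendstoI)
    fix e :: real assume "e > 0"
    then have "0 < min e (\<epsilon>0 / 2)" "min e (\<epsilon>0 / 2) < \<epsilon>0" using \<epsilon>0 by auto
    from hit[OF this] show "\<forall>\<^sub>F X in nhds (m, v0). dist (\<sigma> X) 0 < e"
      by eventually_elim auto
  qed
  have zero: "\<forall>\<^sub>F X in nhds (m, v0). h (fst X + \<sigma> X *\<^sub>R snd X) = 0"
    using hit[of "\<epsilon>0/2"] \<epsilon>0 by (auto elim: eventually_mono)
  define w where "w X = reflect (n (fst X + \<sigma> X *\<^sub>R snd X)) (snd X)" for X
  define \<rho> where "\<rho> X = (fst X + \<sigma> X *\<^sub>R (snd X - w X), w X)" for X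
  obtain L1 where L1: "unimodular L1" "(\<rho> has_derivative L1) (at (m, v0))"
    using collision_map_derivative[OF U(4)[OF U(2)] U(5)[OF U(2)] _ lim\<sigma> \<sigma>0 zero] U(6)
    unfolding \<rho>_def w_def by auto
  have ff: "free_flight t0 (g x) = (m, v0)" by (simp add: free_flight_def m_def v0_def)
  have dff: "(free_flight t has_derivative free_flight t) F" for t and F :: "((real^'n) \<times> (real^'n)) filter"
    by (rule bounded_linear_imp_has_derivative[OF free_flight_bounded_linear])
  \<comment> \<open>Lines are recorded by their state at time 0 while \<open>\<rho>\<close> acts on
    states at time \<open>t0\<close>, hence the conjugation by free flight.\<close>
  define g' where "g' y = free_flight (- t0) (\<rho> (free_flight t0 (g y)))" for y
  have dX: "((\<lambda>y. free_flight t0 (g y)) has_derivative (\<lambda>\<delta>. free_flight t0 (L \<delta>))) (at x)"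
    by (rule has_derivative_compose[OF g(1) dff])
  have dg': "(g' has_derivative (\<lambda>\<delta>. free_flight (- t0) (L1 (free_flight t0 (L \<delta>))))) (at x)"
    unfolding g'_def using has_derivative_compose[OF dX, of \<rho> L1] L1(2) ff
    by (intro has_derivative_compose[OF _ dff]) simp
  have "unimodular (free_flight (- t0) \<circ> (L1 \<circ> (free_flight t0 \<circ> L)))"
    by (intro unimodular_compose unimodular_free_flight L1(1) g(2))
  then have ug': "unimodular (\<lambda>\<delta>. free_flight (- t0) (L1 (free_flight t0 (L \<delta>))))" by (simp add: o_def)
  have limX: "filterlim (\<lambda>y. free_flight t0 (g y)) (nhds (m, v0)) (nhds x)"
    using isCont_nhds[OF has_derivative_continuous[OF dX]] ff by simp
  show thesis
  proof (rule that[of "t0 + \<epsilon>0", OF _ ug' dg'], goal_cases)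
    case 2
    show ?case
    proof (intro allI impI)
      fix \<epsilon> assume \<epsilon>: "0 < \<epsilon>" "t0 + \<epsilon> < t0 + \<epsilon>0"
      have fol: "\<forall>\<^sub>F y in nhds x. \<forall>s\<in>{t0-\<epsilon>0..t0-\<epsilon>}. \<Gamma> y s = fst (g y) + s *\<^sub>R snd (g y) \<and> \<Gamma> y s \<notin> \<Union>T"
        by (rule follow) (use \<epsilon> \<epsilon>0 in auto)
      have "\<forall>\<^sub>F y in nhds x. good (free_flight t0 (g y)) \<and> \<bar>\<sigma> (free_flight t0 (g y))\<bar> < \<epsilon> \<and>
          h (fst (free_flight t0 (g y)) + \<sigma> (free_flight t0 (g y)) *\<^sub>R snd (free_flight t0 (g y))) = 0"
        by (rule eventually_compose_filterlim[OF hit limX]) (use \<epsilon> in auto)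
      from path fol this
      show "\<forall>\<^sub>F y in nhds x. (\<exists>t1. {s \<in> {t0-\<epsilon>..t0+\<epsilon>}. \<Gamma> y s \<in> \<Union>T} = {t1}) \<and>
         (\<forall>s\<in>{t0+\<epsilon>..t0+\<epsilon>0}. \<Gamma> y s = fst (g' y) + s *\<^sub>R snd (g' y) \<and> \<Gamma> y s \<notin> \<Union>T)"
      proof eventually_elim
        case (elim y)
        note py = elim(1)
        define q where "q = fst (g y)"
        define v where "v = snd (g y)"
        define X where "X = free_flight t0 (g y)"
        have X: "fst X = q + t0 *\<^sub>R v" "snd X = v" by (auto simp: X_def free_flight_def q_def v_def)
        have gX: "good X" "\<bar>\<sigma> X\<bar> < \<epsilon>" "h (fst X + \<sigma> X *\<^sub>R v) = 0"
          using elim(3) X by (auto simp: X_def)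
        have lineX: "q + s *\<^sub>R v = fst X + (s - t0) *\<^sub>R v" for s by (simp add: X algebra_simps)
        have pre: "\<Gamma> y s = q + s *\<^sub>R v" "\<Gamma> y s \<notin> \<Union>T" if "t0 - \<epsilon>0 \<le> s" "s \<le> t0 - \<epsilon>" for s
        proof -
          have "s \<in> {t0 - \<epsilon>0..t0 - \<epsilon>}" using that by simp
          from bspec[OF elim(2) this] show "\<Gamma> y s = q + s *\<^sub>R v" "\<Gamma> y s \<notin> \<Union>T"
            unfolding q_def v_def by blast+
        qed
        have onM: "fst X + s *\<^sub>R v \<in> \<Union>T \<longleftrightarrow> s = \<sigma> X" if "\<bar>s\<bar> \<le> \<epsilon>0" for s
          using near(2)[of "fst X + s *\<^sub>R v"] inball[OF gX(1) that] X(2) d uniq[OF gX(1) that, of "\<sigma> X"] gX \<epsilon> by auto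
        have ext: "\<Gamma> y s = q + s *\<^sub>R v" "left_velocity (\<Gamma> y) b = v" 
          if b: "t0 - \<epsilon> < b" and nob: "\<And>t. t0 - \<epsilon> \<le> t \<Longrightarrow> t < b \<Longrightarrow> \<Gamma> y t \<notin> \<Union>T"
            and s: "t0 - \<epsilon>0 \<le> s" "s \<le> b" for s b
        proof -
          have free: "\<Gamma> y t \<notin> \<Union>T" if "t0 - \<epsilon>0 < t" "t < b" for t
          proof (cases "t \<le> t0 - \<epsilon>")
            case True
            then show ?thesis using pre(2) that(1) by simp
          next
            case False
            then show ?thesis using nob[of t] that(2) by simp
          qed
          have "t0 - \<epsilon>0 < t0 - \<epsilon>" "t0 - \<epsilon> \<le> b" using b \<epsilon> by auto
          note pc = path_continue[OF py this free, of q v]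
          show "\<Gamma> y s = q + s *\<^sub>R v" by (rule pc(1)) (use pre(1) s in auto)
          show "left_velocity (\<Gamma> y) b = v" by (rule pc(2)) (use pre(1) in auto)
        qed
        \<comment> \<open>A path without collision in the window would follow its old line, which is
          on the mirror at time \<open>t0 + \<sigma> X\<close>.\<close>
        have "\<exists>s\<in>{t0-\<epsilon>..t0+\<epsilon>}. \<Gamma> y s \<in> \<Union>T"
        proof (rule ccontr)
          assume "\<not> ?thesis"
          then have no: "\<And>s. t0 - \<epsilon> \<le> s \<Longrightarrow> s \<le> t0 + \<epsilon> \<Longrightarrow> \<Gamma> y s \<notin> \<Union>T" by auto
          have "\<Gamma> y (t0 + \<sigma> X) = q + (t0 + \<sigma> X) *\<^sub>R v"
            by (rule ext(1)[of "t0 + \<epsilon>"]) (use no gX(2) \<epsilon> in auto)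
          also have "\<dots> \<in> \<Union>T" using onM[of "\<sigma> X"] gX(2) \<epsilon> by (simp add: lineX)
          finally have "\<Gamma> y (t0 + \<sigma> X) \<in> \<Union>T" .
          moreover have "t0 - \<epsilon> \<le> t0 + \<sigma> X" "t0 + \<sigma> X \<le> t0 + \<epsilon>" using gX(2) by linarith+
          ultimately show False using no by blast
        qed
        then obtain t1 where t1: "t1 \<in> {t0-\<epsilon>..t0+\<epsilon>}" "\<Gamma> y t1 \<in> \<Union>T"
          "\<And>u. t0 - \<epsilon> \<le> u \<Longrightarrow> u < t1 \<Longrightarrow> \<Gamma> y u \<notin> \<Union>T"
          using path_first_collision[OF py] by metis
        have "t1 \<noteq> t0 - \<epsilon>" using pre(2)[of "t0 - \<epsilon>"] t1(2) \<epsilon> by auto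
        then have t1': "t0 - \<epsilon> < t1" using t1(1) by simp
        have z1: "\<Gamma> y t1 = fst X + (t1 - t0) *\<^sub>R v" and lv: "left_velocity (\<Gamma> y) t1 = v"
          using ext[OF t1' t1(3), of t1] t1(1) \<epsilon> lineX[of t1] by auto
        have t1\<sigma>: "t1 - t0 = \<sigma> X" using onM[of "t1 - t0"] t1 z1 \<epsilon> by auto
        define z where "z = fst X + \<sigma> X *\<^sub>R v"
        have z: "\<Gamma> y t1 = z" using z1 t1\<sigma> by (simp add: z_def)
        have zd: "norm (z - m) < d / 2" using inball[OF gX(1), of "\<sigma> X"] gX(2) \<epsilon> X(2) by (simp add: z_def)
        have zM: "z \<in> M" using near(3)[of z] zd d t1(2) z by simp
        have wX: "w X = reflect (n z) v" by (simp add: w_def z_def X)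
        obtain v' \<nu> where v': "unit_normal M z \<nu>" "\<forall>\<^sub>F s in at_left t1. \<Gamma> y s = z + (s - t1) *\<^sub>R v'"
            "\<forall>\<^sub>F s in at_right t1. \<Gamma> y s = z + (s - t1) *\<^sub>R reflect \<nu> v'"
          using path_collision(3)[OF py M(1), of t1] z zM by auto
        have "v' = v" using left_velocity_eqI[of "\<Gamma> y" t1 v'] v'(2) z lv by simp
        moreover obtain c where "c \<noteq> 0" "\<nu> = c *\<^sub>R n z"
          using U(7)[OF _ zM v'(1)] near(1)[of z] zd d by auto
        ultimately have out: "\<forall>\<^sub>F s in at_right t1. \<Gamma> y s = z + (s - t1) *\<^sub>R w X"
          using v'(3) by (simp add: reflect_scaleR wX)
        have wd: "norm (w X - v0') < d2" "norm (w X) \<le> B"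
          using d3(2)[of z v] zd gX(1) X d goodv[OF gX(1)] by (auto simp: wX good_def d_def)
        have near_out: "norm (z + s *\<^sub>R w X - m) < d" if "0 \<le> s" "s \<le> 2 * \<epsilon>0" for s
        proof -
          have "norm (s *\<^sub>R w X) \<le> (2 * \<epsilon>0) * B" using wd(2) that B \<epsilon>0 by (simp add: mult_mono)
          moreover have "norm (z + s *\<^sub>R w X - m) \<le> norm (z - m) + norm (s *\<^sub>R w X)"
            by (metis add_diff_eq add.commute norm_triangle_ineq diff_add_eq)
          ultimately show ?thesis using zd \<epsilon>0(3) d by simp
        qed
        \<comment> \<open>\<open>h\<close> is 0 at \<open>z\<close> and decreases along the
          reflected direction. The range \<open>2 * \<epsilon>0\<close> reaches from
          \<open>t1\<close> past the end of the window.\<close>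
        have no_out: "z + s *\<^sub>R w X \<notin> \<Union>T" if "0 < s" "s \<le> 2 * \<epsilon>0" for s
        proof -
          have "h (z + s *\<^sub>R w X) < h (z + 0 *\<^sub>R w X)"
          proof (rule DERIV_neg_imp_decreasing[OF that(1)])
            fix u assume "0 \<le> u" "u \<le> s"
            then have u: "norm (z + u *\<^sub>R w X - m) < d" using near_out that by simp
            then have "(h has_derivative (\<lambda>a. n (z + u *\<^sub>R w X) \<bullet> a)) (at (z + u *\<^sub>R w X))"
              using near U(4) by auto
            moreover have "((\<lambda>s. z + s *\<^sub>R w X) has_derivative (\<lambda>a. a *\<^sub>R w X)) (at u)"
              by (auto intro!: derivative_eq_intros)
            ultimately have "((\<lambda>s. h (z + s *\<^sub>R w X)) has_derivative (\<lambda>a. n (z + u *\<^sub>R w X) \<bullet> (a *\<^sub>R w X))) (at u)"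
              using has_derivative_compose by blast
            then have "((\<lambda>s. h (z + s *\<^sub>R w X)) has_real_derivative n (z + u *\<^sub>R w X) \<bullet> w X) (at u)"
              unfolding has_field_derivative_def by (rule has_derivative_eq_rhs) (simp add: fun_eq_iff mult.commute)
            moreover have "n (z + u *\<^sub>R w X) \<bullet> w X < 0"
              using wd u by (intro d2) (auto simp: d_def)
            ultimately show "\<exists>y. ((\<lambda>s. h (z + s *\<^sub>R w X)) has_real_derivative y) (at u) \<and> y < 0" by blast
          qed
          moreover have "h (z + 0 *\<^sub>R w X) = 0" using gX(3) by (simp add: z_def)
          ultimately show ?thesis using near(2)[OF near_out, of s] that by simp
        qed
        obtain b1 where b1: "t1 < b1" "\<And>s. t1 < s \<Longrightarrow> s < b1 \<Longrightarrow> \<Gamma> y s = z + (s - t1) *\<^sub>R w X"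
          using out by (auto simp: eventually_at_right[of t1 "t1 + 1"])
        have t1\<epsilon>: "t1 < t0 + \<epsilon>0" "t0 + \<epsilon>0 \<le> t1 + 2 * \<epsilon>0" using t1(1) \<epsilon> by auto
        \<comment> \<open>The outgoing line is known only before \<open>b1\<close>. Stopping at
          \<open>b\<close> gives a nondegenerate free stretch, from which a supposed next collision
          can be reached along the line.\<close>
        define b where "b = min ((t1 + b1) / 2) (t0 + \<epsilon>0)"
        have b: "t1 < b" "b < b1" "b \<le> t0 + \<epsilon>0"
          using b1 t1\<epsilon> by (auto simp: b_def min_def field_simps)
        have out_line: "\<Gamma> y s = (z - t1 *\<^sub>R w X) + s *\<^sub>R w X" if "t1 < s" "s < b1" for s
          using b1(2)[OF that] by (simp add: algebra_simps)
        have no_until_b: "\<Gamma> y s \<notin> \<Union>T" if "t1 < s" "s \<le> b" for s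
          using b1(2)[of s] no_out[of "s - t1"] that b t1\<epsilon> by auto
        have after: "\<Gamma> y s \<notin> \<Union>T" if "t1 < s" "s \<le> t0 + \<epsilon>0" for s
        proof
          assume hitT: "\<Gamma> y s \<in> \<Union>T"
          then have "s \<in> {b..t0 + \<epsilon>0}" using no_until_b[of s] that by force
          then obtain t2 where t2: "t2 \<in> {b..t0 + \<epsilon>0}" "\<Gamma> y t2 \<in> \<Union>T" "\<And>u. b \<le> u \<Longrightarrow> u < t2 \<Longrightarrow> \<Gamma> y u \<notin> \<Union>T"
            using path_first_collision[OF py _ hitT] by metis
          have "\<Gamma> y t2 = (z - t1 *\<^sub>R w X) + t2 *\<^sub>R w X"
          proof (rule path_continue(1)[OF py b(1), of t2])
            show "\<Gamma> y t \<notin> \<Union>T" if "t1 < t" "t < t2" for t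
              using no_until_b[of t] t2(3)[of t] that by force
          qed (use t2 b out_line in auto)
          also have "\<dots> = z + (t2 - t1) *\<^sub>R w X" by (simp add: algebra_simps)
          finally show False using t2(1,2) no_out[of "t2 - t1"] b t1\<epsilon> by auto
        qed
        have post: "\<Gamma> y s = (z - t1 *\<^sub>R w X) + s *\<^sub>R w X" if "t1 \<le> s" "s \<le> t0 + \<epsilon>0" for s
          by (rule path_continue(1)[OF py b(1,3)]) (use after b out_line that in auto)
        have g'y: "fst (g' y) = z - t1 *\<^sub>R w X" "snd (g' y) = w X"
        proof -
          have "g' y = free_flight (- t0) (\<rho> X)" by (simp add: g'_def X_def)
          moreover have "t1 = t0 + \<sigma> X" using t1\<sigma> by simp
          ultimately show "fst (g' y) = z - t1 *\<^sub>R w X" "snd (g' y) = w X"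
            by (auto simp: \<rho>_def free_flight_def z_def X algebra_simps)
        qed
        have "{s \<in> {t0-\<epsilon>..t0+\<epsilon>}. \<Gamma> y s \<in> \<Union>T} = {t1}"
        proof (intro equalityI subsetI)
          fix s assume s: "s \<in> {s \<in> {t0-\<epsilon>..t0+\<epsilon>}. \<Gamma> y s \<in> \<Union>T}"
          then have "\<not> s < t1" "\<not> t1 < s" using t1(3)[of s] after[of s] \<epsilon> by auto
          then show "s \<in> {t1}" by simp
        qed (use t1 in auto)
        moreover have "\<Gamma> y s = fst (g' y) + s *\<^sub>R snd (g' y) \<and> \<Gamma> y s \<notin> \<Union>T" if "s \<in> {t0+\<epsilon>..t0+\<epsilon>0}" for s
          unfolding g'y using post[of s] after[of s] that t1(1) gX(2) t1\<sigma> by auto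
        ultimately show ?case by blast
      qed
    qed
  qed (use \<epsilon>0 in auto)
qed

text \<open>A compact collision-free segment has positive distance from the closed union of mirrors,
  so nearby segments avoid it as well. A nearby path cannot leave its line, because its first
  collision would lie on that line.\<close>

lemma free_perturbation:
  fixes \<Gamma> :: "'b::real_normed_vector \<Rightarrow> real \<Rightarrow> 'a::euclidean_space"
  assumes T: "closed (\<Union>T)"
    and path: "\<forall>\<^sub>F y in nhds x. billiard_path T (r y) (\<Gamma> y)"
    and g: "isCont g x"
    and follow: "\<forall>\<^sub>F y in nhds x. \<forall>s\<in>{a..b}. \<Gamma> y s = fst (g y) + s *\<^sub>R snd (g y) \<and> \<Gamma> y s \<notin> \<Union>T"
    and "a < b" "b \<le> c" and no: "\<And>s. a \<le> s \<Longrightarrow> s \<le> c \<Longrightarrow> \<Gamma> x s \<notin> \<Union>T"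
  shows "\<forall>\<^sub>F y in nhds x. \<forall>s\<in>{a..c}. \<Gamma> y s = fst (g y) + s *\<^sub>R snd (g y) \<and> \<Gamma> y s \<notin> \<Union>T"
proof -
  let ?l = "\<lambda>y s. fst (g y) + s *\<^sub>R snd (g y)"
  have fx: "\<forall>s\<in>{a..b}. \<Gamma> x s = ?l x s \<and> \<Gamma> x s \<notin> \<Union>T" using eventually_nhds_x_imp_x[OF follow] .
  have lx: "\<Gamma> x s = ?l x s" if "s \<in> {a..c}" for s
    by (rule path_continue(1)[OF eventually_nhds_x_imp_x[OF path] \<open>a < b\<close> \<open>b \<le> c\<close>])
      (use fx no that in auto)
  define S where "S = ?l x ` {a..c}"
  have "compact S" unfolding S_def by (intro compact_continuous_image continuous_intros) simp
  moreover have "S \<inter> \<Union>T = {}" using no lx by (force simp: S_def)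
  ultimately obtain d where d: "d > 0" "\<And>u z. u \<in> S \<Longrightarrow> z \<in> \<Union>T \<Longrightarrow> d \<le> dist u z"
    using separate_compact_closed[OF _ T] by metis
  \<comment> \<open>Bounds the time parameter: a velocity error of d/2/m displaces the line by at
    most d/2.\<close>
  define m where "m = 1 + \<bar>a\<bar> + \<bar>c\<bar>"
  have m: "m > 0" "\<And>s. s \<in> {a..c} \<Longrightarrow> \<bar>s\<bar> \<le> m" by (auto simp: m_def)
  have "\<forall>\<^sub>F y in nhds x. dist (fst (g y)) (fst (g x)) < d / 2"
    "\<forall>\<^sub>F y in nhds x. dist (snd (g y)) (snd (g x)) < d / 2 / m"
    by (rule tendstoD[OF tendsto_fst[OF isCont_nhds[OF g]]], use m d in simp)
      (rule tendstoD[OF tendsto_snd[OF isCont_nhds[OF g]]], use m d in simp)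
  with path follow show ?thesis
  proof eventually_elim
    case (elim y)
    have early: "\<Gamma> y s = ?l y s" "\<Gamma> y s \<notin> \<Union>T" if "a \<le> s" "s \<le> b" for s
    proof -
      have "s \<in> {a..b}" using that by simp
      from bspec[OF elim(2) this] show "\<Gamma> y s = ?l y s" "\<Gamma> y s \<notin> \<Union>T" by blast+
    qed
    have free: "?l y s \<notin> \<Union>T" if s: "s \<in> {a..c}" for s
    proof
      assume "?l y s \<in> \<Union>T"
      moreover have "?l x s \<in> S" using s unfolding S_def by blast
      ultimately have "d \<le> dist (?l x s) (?l y s)" by (intro d(2))
      also have "\<dots> = norm ((fst (g x) - fst (g y)) + s *\<^sub>R (snd (g x) - snd (g y)))"
        by (simp add: dist_norm algebra_simps)
      also have "\<dots> \<le> dist (fst (g y)) (fst (g x)) + \<bar>s\<bar> * dist (snd (g y)) (snd (g x))"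
        using norm_triangle_ineq[of "fst (g x) - fst (g y)" "s *\<^sub>R (snd (g x) - snd (g y))"]
        by (simp add: dist_norm norm_minus_commute)
      also have "\<bar>s\<bar> * dist (snd (g y)) (snd (g x)) \<le> m * (d / 2 / m)"
        using m s elim by (intro mult_mono) auto
      finally show False using elim m by simp
    qed
    have no_coll: "\<Gamma> y s \<notin> \<Union>T" if s: "s \<in> {a..c}" for s
    proof
      assume "\<Gamma> y s \<in> \<Union>T"
      then obtain t where t: "t \<in> {a..c}" "\<Gamma> y t \<in> \<Union>T" "\<And>u. a \<le> u \<Longrightarrow> u < t \<Longrightarrow> \<Gamma> y u \<notin> \<Union>T"
        using path_first_collision[OF elim(1) s] by metis
      have "\<not> (a \<le> t \<and> t \<le> b)" using early(2) t(2) by blast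
      then have "b < t" using t(1) by simp
      have "\<Gamma> y t = ?l y t"
      proof (rule path_continue(1)[OF elim(1) \<open>a < b\<close>])
        show "b \<le> t" "t \<in> {a..t}" using \<open>b < t\<close> \<open>a < b\<close> by auto
        show "\<Gamma> y u \<notin> \<Union>T" if "a < u" "u < t" for u
          by (rule t(3)) (use that in auto)
        show "\<Gamma> y s = ?l y s" if "a < s" "s < b" for s
          by (rule early(1)) (use that in auto)
      qed
      then show False using free t by metis
    qed
    have "\<Gamma> y s = ?l y s" if "s \<in> {a..c}" for s
    proof (rule path_continue(1)[OF elim(1) \<open>a < b\<close> \<open>b \<le> c\<close> _ _ that])
      show "\<Gamma> y u \<notin> \<Union>T" if "a < u" "u < c" for u
        by (rule no_coll) (use that in auto)
      show "\<Gamma> y s = ?l y s" if "a < s" "s < b" for s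
        by (rule early(1)) (use that in auto)
    qed
    with no_coll show ?case by blast
  qed
qed

section \<open>Dependence of the flow on the initial state\<close>

text \<open>The interval is open at \<open>t\<close>, in keeping with the velocity from the left: a
  collision at time \<open>t\<close> itself has not yet acted. A small perturbation may advance it
  before \<open>t\<close> but loses no earlier one, so the count can only rise nearby.\<close>

definition collisions :: "'a set set \<Rightarrow> (real \<Rightarrow> 'a) \<Rightarrow> real \<Rightarrow> real set" where
  "collisions T \<Gamma> t = {s \<in> {0..<t}. \<Gamma> s \<in> \<Union>T}"

lemma finite_collisions: "billiard_path T r \<Gamma> \<Longrightarrow> finite (collisions T \<Gamma> t)"
  by (rule finite_subset[OF _ path_finite[of T r \<Gamma> 0 t]]) (auto simp: collisions_def)

lemma card_collisions_mono:
  assumes "billiard_path T r \<Gamma>" "s \<le> t"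
  shows "card (collisions T \<Gamma> s) \<le> card (collisions T \<Gamma> t)"
  using finite_collisions[OF assms(1)] assms(2) by (intro card_mono) (auto simp: collisions_def)

text \<open>\<open>g\<close> is the composition of the back-propagated collision maps of the collisions of \<open>\<Gamma> x\<close> before
  time \<open>t\<close>.  If \<open>t\<close> is itself a collision time, nearby paths may collide just before \<open>t\<close>, whence
  the smaller time \<open>a\<close>.\<close>

lemma flow_perturbation:
  fixes \<Gamma> :: "(real^'n) \<times> (real^'n) \<Rightarrow> real \<Rightarrow> real^'n::finite"
  assumes T: "finite T" "\<And>M. M \<in> T \<Longrightarrow> closed M"
    and path: "\<forall>\<^sub>F y in nhds x. billiard_path T (r y) (\<Gamma> y)"
    and start: "\<forall>\<^sub>F y in nhds x. \<forall>s\<in>{-1..0}. \<Gamma> y s = fst y + s *\<^sub>R snd y \<and> \<Gamma> y s \<notin> \<Union>T"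
    and "t > 0"
  shows "\<exists>\<alpha> g L. \<alpha> < t \<and> unimodular L \<and> (g has_derivative L) (at x) \<and>
    (\<forall>a b. \<alpha> < a \<longrightarrow> a \<le> b \<longrightarrow> b < t \<longrightarrow> (\<forall>\<^sub>F y in nhds x.
       card (collisions T (\<Gamma> y) a) = card (collisions T (\<Gamma> x) t) \<and>
       (\<forall>s\<in>{a..b}. \<Gamma> y s = fst (g y) + s *\<^sub>R snd (g y) \<and> \<Gamma> y s \<notin> \<Union>T)))"
  using \<open>t > 0\<close>
\<comment> \<open>Induction on the number of collisions of \<open>\<Gamma> x\<close> before
  \<open>t\<close>. The last of them, \<open>t'\<close>, is not counted before \<open>t'\<close>, so
  the hypothesis applies there and supplies the line arriving at \<open>t'\<close>.\<close>
proof (induction "card (collisions T (\<Gamma> x) t)" arbitrary: t)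
  case 0
  have px: "billiard_path T (r x) (\<Gamma> x)" using eventually_nhds_x_imp_x[OF path] .
  have clT: "closed (\<Union>T)" using T by blast
  have none: "collisions T (\<Gamma> x) t = {}" using 0(1) finite_collisions[OF px] by simp
  have nox: "\<Gamma> x s \<notin> \<Union>T" if "-1 \<le> s" "s < t" for s
  proof (cases "s \<le> 0")
    case True
    then have "s \<in> {-1..0}" using that by simp
    then show ?thesis using eventually_nhds_x_imp_x[OF start] by blast
  next
    case False
    then show ?thesis using none that by (auto simp: collisions_def)
  qed
  show ?case
  proof (intro exI conjI allI impI)
    \<comment> \<open>Before any collision \<open>g\<close> is the identity, lines being recorded at
      time 0, and the line is known from -1 on by \<open>start\<close>.\<close>
    show "-1 < t" using \<open>0 < t\<close> by simp
    show "unimodular (\<lambda>x :: (real^'n) \<times> (real^'n). x)" by (rule unimodular_isometry) (auto intro: linear_id[unfolded id_def])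
    show "((\<lambda>x. x) has_derivative (\<lambda>x. x)) (at x)" by simp
    fix a b assume ab: "-1 < a" "a \<le> b" "b < t"
    have "\<forall>\<^sub>F y in nhds x. \<forall>s\<in>{-1..max b 0}. \<Gamma> y s = fst y + s *\<^sub>R snd y \<and> \<Gamma> y s \<notin> \<Union>T"
      using free_perturbation[OF clT path _ start, of "max b 0"] nox ab \<open>0 < t\<close> by simp
    then show "\<forall>\<^sub>F y in nhds x. card (collisions T (\<Gamma> y) a) = card (collisions T (\<Gamma> x) t) \<and>
       (\<forall>s\<in>{a..b}. \<Gamma> y s = fst y + s *\<^sub>R snd y \<and> \<Gamma> y s \<notin> \<Union>T)"
    proof eventually_elim
      case (elim y)
      then have "\<Gamma> y s \<notin> \<Union>T" if "0 \<le> s" "s < a" for s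
        using bspec[OF elim, of s] that ab by force
      then have "collisions T (\<Gamma> y) a = {}" by (auto simp: collisions_def)
      moreover have "{a..b} \<subseteq> {-1..max b 0}" using ab by auto
      ultimately show ?case using elim none by (metis subsetD)
    qed
  qed
next
  case (Suc n)
  have px: "billiard_path T (r x) (\<Gamma> x)" using eventually_nhds_x_imp_x[OF path] .
  have clT: "closed (\<Union>T)" using T by blast
  let ?C = "collisions T (\<Gamma> x) t"
  have fin: "finite ?C" and ne: "?C \<noteq> {}"
    using finite_collisions[OF px] Suc(2) by (auto intro!: notI)
  define t' where "t' = Max ?C"
  have t'C: "t' \<in> ?C" unfolding t'_def by (rule Max_in[OF fin ne])
  then have t': "0 \<le> t'" "t' < t" "\<Gamma> x t' \<in> \<Union>T" by (auto simp: collisions_def)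
  have "(0::real) \<in> {-1..0}" by simp
  then have "\<Gamma> x 0 \<notin> \<Union>T" using eventually_nhds_x_imp_x[OF start] by blast
  then have "t' \<noteq> 0" using t'(3) by metis
  then have "t' > 0" using t'(1) by simp
  have le_t': "s \<le> t'" if "s \<in> ?C" for s unfolding t'_def using fin that by simp
  have "?C = insert t' (collisions T (\<Gamma> x) t')"
  proof (intro equalityI subsetI)
    fix s assume "s \<in> ?C"
    then show "s \<in> insert t' (collisions T (\<Gamma> x) t')"
      using le_t'[of s] by (cases "s = t'") (auto simp: collisions_def)
  qed (use t'C t'(2) in \<open>auto simp: collisions_def\<close>)
  moreover have "t' \<notin> collisions T (\<Gamma> x) t'" by (simp add: collisions_def)
  ultimately have "n = card (collisions T (\<Gamma> x) t')"
    using Suc(2) finite_collisions[OF px] by simp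
  note n = this
  from Suc(1)[OF n \<open>t' > 0\<close>] obtain \<alpha> g L where
    IH: "\<alpha> < t'" "unimodular L" "(g has_derivative L) (at x)"
    "\<And>a b. \<alpha> < a \<Longrightarrow> a \<le> b \<Longrightarrow> b < t' \<Longrightarrow> \<forall>\<^sub>F y in nhds x. card (collisions T (\<Gamma> y) a) = n \<and>
       (\<forall>s\<in>{a..b}. \<Gamma> y s = fst (g y) + s *\<^sub>R snd (g y) \<and> \<Gamma> y s \<notin> \<Union>T)"
    unfolding n[symmetric] by blast
  have fol: "\<forall>\<^sub>F y in nhds x. \<forall>s\<in>{a..b}. \<Gamma> y s = fst (g y) + s *\<^sub>R snd (g y) \<and> \<Gamma> y s \<notin> \<Union>T"
    if "\<alpha> < a" "a \<le> b" "b < t'" for a b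
    using IH(4)[OF that] by eventually_elim blast
  obtain g' L' \<beta> where new: "t' < \<beta>" "unimodular L'" "(g' has_derivative L') (at x)"
    "\<forall>\<epsilon>. 0 < \<epsilon> \<longrightarrow> t' + \<epsilon> < \<beta> \<longrightarrow> (\<forall>\<^sub>F y in nhds x.
       (\<exists>t1. {s \<in> {t'-\<epsilon>..t'+\<epsilon>}. \<Gamma> y s \<in> \<Union>T} = {t1}) \<and>
       (\<forall>s\<in>{t'+\<epsilon>..\<beta>}. \<Gamma> y s = fst (g' y) + s *\<^sub>R snd (g' y) \<and> \<Gamma> y s \<notin> \<Union>T))"
    by (rule collision_perturbation[OF T path t'(3) IH(1,3,2) fol]) (assumption | rule that)+
  show ?case
  proof (intro exI conjI allI impI)
    show "t' < t" "unimodular L'" "(g' has_derivative L') (at x)" by fact+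
    fix a b assume ab: "t' < a" "a \<le> b" "b < t"
    \<comment> \<open>The collision window around \<open>t'\<close> must lie after 0, begin where
      the old line is known, and end before \<open>a\<close> and inside the range of the new
      line.\<close>
    define d where "d = min (min (\<beta> - t') (a - t')) (min (t' - \<alpha>) t')"
    have d: "0 < d" "d \<le> \<beta> - t'" "d \<le> a - t'" "d \<le> t' - \<alpha>" "d \<le> t'"
      using new(1) ab IH(1) \<open>t' > 0\<close> by (auto simp: d_def)
    define \<epsilon> where "\<epsilon> = d / 2"
    from d have \<epsilon>: "0 < \<epsilon>" "t' + \<epsilon> < \<beta>" "t' + \<epsilon> < a" "\<alpha> < t' - \<epsilon>" "0 < t' - \<epsilon>"
      by (auto simp: \<epsilon>_def)
    have e1: "\<forall>\<^sub>F y in nhds x. card (collisions T (\<Gamma> y) (t' - \<epsilon>)) = n"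
      using IH(4)[of "t' - \<epsilon>" "t' - \<epsilon>"] \<epsilon> by (auto elim: eventually_mono)
    have sub: "{t'+\<epsilon>..min \<beta> b} \<subseteq> {t'+\<epsilon>..\<beta>}" by auto
    have f0: "\<forall>\<^sub>F y in nhds x. \<forall>s\<in>{t'+\<epsilon>..min \<beta> b}. \<Gamma> y s = fst (g' y) + s *\<^sub>R snd (g' y) \<and> \<Gamma> y s \<notin> \<Union>T"
      using new(4)[rule_format, OF \<epsilon>(1,2)] by eventually_elim (use sub in blast)
    have e2: "\<forall>\<^sub>F y in nhds x. \<forall>s\<in>{t'+\<epsilon>..b}. \<Gamma> y s = fst (g' y) + s *\<^sub>R snd (g' y) \<and> \<Gamma> y s \<notin> \<Union>T"
    proof (rule free_perturbation[OF clT path has_derivative_continuous[OF new(3)] f0])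
      show "\<Gamma> x s \<notin> \<Union>T" if "t' + \<epsilon> \<le> s" "s \<le> b" for s
        using le_t'[of s] that \<epsilon> ab t' by (auto simp: collisions_def)
    qed (use \<epsilon> ab in auto)
    from path e1 e2 new(4)[rule_format, OF \<epsilon>(1,2)]
    show "\<forall>\<^sub>F y in nhds x. card (collisions T (\<Gamma> y) a) = card ?C \<and>
       (\<forall>s\<in>{a..b}. \<Gamma> y s = fst (g' y) + s *\<^sub>R snd (g' y) \<and> \<Gamma> y s \<notin> \<Union>T)"
    proof eventually_elim
      case (elim y)
      obtain t1 where t1: "{s \<in> {t'-\<epsilon>..t'+\<epsilon>}. \<Gamma> y s \<in> \<Union>T} = {t1}" using elim(4) by blast
      have "s \<in> collisions T (\<Gamma> y) a \<longleftrightarrow> s \<in> insert t1 (collisions T (\<Gamma> y) (t' - \<epsilon>))" for s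
      proof -
        consider "s < t' - \<epsilon>" | "t' - \<epsilon> \<le> s \<and> s \<le> t' + \<epsilon>" | "t' + \<epsilon> < s" by linarith
        then show ?thesis
        proof cases
          case 1
          then show ?thesis using t1 \<epsilon> by (auto simp: collisions_def)
        next
          case 2
          then have "\<Gamma> y s \<in> \<Union>T \<longleftrightarrow> s = t1" using t1 by (metis (mono_tags, lifting) atLeastAtMost_iff mem_Collect_eq singleton_iff)
          then show ?thesis using 2 \<epsilon> by (auto simp: collisions_def)
        next
          case 3
          moreover have "t1 \<le> t' + \<epsilon>" using t1 by auto
          moreover have "\<Gamma> y s \<notin> \<Union>T" if "s < a"
          proof -
            have "s \<in> {t' + \<epsilon>..b}" using 3 that ab by simp
            then show ?thesis using elim(3) by blast
          qed
          ultimately show ?thesis using \<epsilon> by (auto simp: collisions_def)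
        qed
      qed
      then have "collisions T (\<Gamma> y) a = insert t1 (collisions T (\<Gamma> y) (t' - \<epsilon>))" by blast
      moreover have "t1 \<notin> collisions T (\<Gamma> y) (t' - \<epsilon>)" using t1 by (auto simp: collisions_def)
      ultimately have "card (collisions T (\<Gamma> y) a) = Suc n"
        using elim(2) finite_collisions[OF elim(1)] by simp
      moreover have "{a..b} \<subseteq> {t'+\<epsilon>..b}" using \<epsilon> by auto
      ultimately show ?case unfolding Suc(2)[symmetric] using elim(3) by blast
    qed
  qed
qed

section \<open>Open families are not trapped\<close>

text \<open>The phase point \<open>(q, v)\<close> lies on its line at the arc length parameter \<open>line_time (q, v)\<close>.\<close>

definition line_of :: "'a::real_inner \<times> 'a \<Rightarrow> 'a \<times> 'a" where
  "line_of y = (sgn (snd y), fst y - (fst y \<bullet> sgn (snd y)) *\<^sub>R sgn (snd y))"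

definition line_time :: "'a::real_inner \<times> 'a \<Rightarrow> real" where
  "line_time y = fst y \<bullet> sgn (snd y)"

lemma line_of_in_oriented_lines: "snd y \<noteq> 0 \<Longrightarrow> line_of y \<in> oriented_lines"
  by (auto simp: line_of_def oriented_lines_def norm_sgn inner_diff_left norm_eq_1[symmetric])

lemma continuous_on_line_of: "continuous_on {y. snd y \<noteq> 0} line_of"
  unfolding line_of_def[abs_def] by (intro continuous_intros) auto

lemma continuous_on_line_time: "continuous_on {y. snd y \<noteq> 0} line_time"
  unfolding line_time_def[abs_def] by (intro continuous_intros) auto

lemma phase_point_on_line:
  "fst y + t *\<^sub>R snd y = snd (line_of y) + (line_time y + norm (snd y) * t) *\<^sub>R fst (line_of y)"
proof -
  have "norm (snd y) *\<^sub>R sgn (snd y) = snd y"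
    by (cases "snd y = 0") (auto simp: sgn_div_norm)
  then have "t *\<^sub>R snd y = (norm (snd y) * t) *\<^sub>R sgn (snd y)"
    by (metis mult.commute scaleR_scaleR)
  then show ?thesis by (simp add: line_of_def line_time_def scaleR_add_left)
qed

text \<open>The mirrors lie inside the ball, so the path is straight until it enters. At entry it is
  both in the ball and at distance \<open>\<bar>t0\<bar>\<close> from \<open>snd l\<close>, which
  bounds the entry time.\<close>

lemma incoming_ray:
  assumes T: "\<Union>T \<subseteq> interior (cball c R)"
    and \<gamma>: "nonsingular_trajectory T \<gamma>" "comes_from_infinity_along l \<gamma>" "enters_and_remains_in (cball c R) \<gamma>"
    and l: "l \<in> oriented_lines"
  obtains t0 where "\<bar>t0\<bar> \<le> R + norm c + norm (snd l)"
    "\<And>t. t \<le> t0 \<Longrightarrow> \<gamma> t = snd l + t *\<^sub>R fst l"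
    "\<And>t. t < t0 \<Longrightarrow> \<gamma> t \<notin> cball c R" "\<And>t. t0 \<le> t \<Longrightarrow> \<gamma> t \<in> cball c R"
proof -
  obtain t0 where t0: "\<And>t. t < t0 \<Longrightarrow> \<gamma> t \<notin> cball c R" "\<And>t. t0 \<le> t \<Longrightarrow> \<gamma> t \<in> cball c R"
    using \<gamma>(3) unfolding enters_and_remains_in_def by blast
  have p: "billiard_path T 1 \<gamma>" using billiard_path_rescale[OF \<gamma>(1), of 1 0] by simp
  obtain N where N: "\<And>t. t \<le> N \<Longrightarrow> \<gamma> t = snd l + t *\<^sub>R fst l"
    using \<gamma>(2) unfolding comes_from_infinity_along_def eventually_at_bot_linorder by blast
  have free: "\<gamma> t \<notin> \<Union>T" if "t < t0" for t
    using t0(1)[OF that] T interior_subset by blast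
  have line: "\<gamma> t = snd l + t *\<^sub>R fst l" if "t \<le> t0" for t
  proof -
    define a where "a = min N t - 2"
    show ?thesis
      by (rule path_continue(1)[OF p, of a "a + 1" t0]) (use N free that in \<open>auto simp: a_def\<close>)
  qed
  have "norm (fst l) = 1" using l by (auto simp: oriented_lines_def)
  then have "\<bar>t0\<bar> = norm (t0 *\<^sub>R fst l)" by simp
  also have "t0 *\<^sub>R fst l = (\<gamma> t0 - c) + c - snd l" using line[of t0] by simp
  also have "norm \<dots> \<le> norm (\<gamma> t0 - c) + norm c + norm (snd l)"
    by (meson add_mono norm_triangle_ineq norm_triangle_ineq4 order_refl order_trans)
  also have "norm (\<gamma> t0 - c) \<le> R" using t0(2)[of t0] by (simp add: dist_norm norm_minus_commute)
  finally show thesis using that t0 line by simp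
qed

theorem open_not_trapped:
  fixes T :: "(real ^ 'n::finite) set set"
  assumes trap: "trap T" and F: "openin (top_of_set oriented_lines) F" "F \<noteq> {}"
  shows "\<not> trapped_family T F"
proof
  assume "trapped_family T F"
  then obtain c R where R: "0 < R" "\<Union>T \<subseteq> interior (cball c R)" and sub: "F \<subseteq> oriented_lines"
    and "\<And>l. l \<in> F \<Longrightarrow> \<exists>\<gamma>. nonsingular_trajectory T \<gamma> \<and> comes_from_infinity_along l \<gamma> \<and>
           enters_and_remains_in (cball c R) \<gamma>"
    unfolding trapped_family_def by blast
  then obtain \<gamma> where \<gamma>: "\<And>l. l \<in> F \<Longrightarrow> nonsingular_trajectory T (\<gamma> l) \<and> comes_from_infinity_along l (\<gamma> l) \<and>
           enters_and_remains_in (cball c R) (\<gamma> l)" by metis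
  have T: "finite T" "\<And>M. M \<in> T \<Longrightarrow> closed M"
    using trap by (auto simp: trap_def mirror_def compact_imp_closed)
  obtain l0 where l0: "l0 \<in> F" using F(2) by blast
  obtain F' where F': "open F'" "F = oriented_lines \<inter> F'" using F(1) openin_open by blast
  \<comment> \<open>A common bound for the entry times of all lines whose base point is within 1 of
    that of \<open>l0\<close>.\<close>
  define K where "K = R + norm c + norm (snd l0) + 1"
  \<comment> \<open>The open set of starting states: on a line of \<open>F\<close> near
    \<open>l0\<close>, safely before entry, with speed between 1 and 2. The lower bound on the speed
    gives a common waiting time, the upper bound gives boundedness.\<close>
  define W where "W = {y. 1 < norm (snd y) \<and> norm (snd y) < 2} \<inter>
     (\<lambda>y. (line_of y, line_time y)) -` ((F' \<inter> {l. dist (snd l) (snd l0) < 1}) \<times> {- (K + 3)<..<- (K + 2)})"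
  have Wsub: "{y. 1 < norm (snd y) \<and> norm (snd y) < 2} \<subseteq> {y :: (real^'n) \<times> (real^'n). snd y \<noteq> 0}" by auto
  have "open W"
    unfolding W_def
  proof (rule continuous_open_preimage)
    show "continuous_on {y :: (real^'n) \<times> (real^'n). 1 < norm (snd y) \<and> norm (snd y) < 2} (\<lambda>y. (line_of y, line_time y))"
      by (rule continuous_on_Pair[OF continuous_on_subset[OF continuous_on_line_of Wsub]
        continuous_on_subset[OF continuous_on_line_time Wsub]])
    show "open {y :: (real^'n) \<times> (real^'n). 1 < norm (snd y) \<and> norm (snd y) < 2}"
      by (intro open_Collect_conj open_Collect_less continuous_intros)
    have "open {l :: (real^'n) \<times> (real^'n). dist (snd l) (snd l0) < 1}"
      by (intro open_Collect_less continuous_intros)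
    then show "open ((F' \<inter> {l. dist (snd l) (snd l0) < 1}) \<times> {- (K + 3)<..<- (K + 2)})"
      using F'(1) by (intro open_Times open_Int) auto
  qed
  have WF: "line_of y \<in> F" if "y \<in> W" for y
  proof -
    have "snd y \<noteq> 0" using that by (auto simp: W_def)
    then show ?thesis using that line_of_in_oriented_lines[of y] F'(2) by (simp add: W_def)
  qed
  have W: "1 < norm (snd y)" "norm (snd y) < 2" "dist (snd (line_of y)) (snd l0) < 1"
    "- (K + 3) < line_time y" "line_time y < - (K + 2)" if "y \<in> W" for y
    using that by (auto simp: W_def)
  have "W \<noteq> {}"
  proof -
    define s where "s = - (K + 5/2)"
    define y where "y = (snd l0 + s *\<^sub>R fst l0, (3/2::real) *\<^sub>R fst l0)"
    have u: "norm (fst l0) = 1" "snd l0 \<bullet> fst l0 = 0" "fst l0 \<bullet> fst l0 = 1"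
      using l0 sub by (auto simp: oriented_lines_def norm_eq_1 dest!: subsetD)
    have sg: "sgn (snd y) = fst l0" using u by (simp add: y_def sgn_scaleR) (simp add: sgn_div_norm)
    have lt: "line_time y = s" using u by (simp add: line_time_def sg) (simp add: y_def inner_add_left)
    have "line_of y = l0"
      using lt by (simp add: line_of_def sg line_time_def) (simp add: y_def)
    then have "y \<in> W" using lt u l0 F'(2) by (simp add: W_def) (simp add: y_def s_def)
    then show ?thesis by blast
  qed
  define \<Gamma> where "\<Gamma> y t = \<gamma> (line_of y) (line_time y + norm (snd y) * t)" for y t
  have path: "billiard_path T (norm (snd y)) (\<Gamma> y)" if "y \<in> W" for y
    unfolding \<Gamma>_def[abs_def] using \<gamma>[OF WF[OF that]] W(1)[OF that] by (intro billiard_path_rescale) auto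
  \<comment> \<open>From a parameter above \<open>-(K + 3)\<close>, speed at least 1 carries every
    path beyond \<open>K\<close>, hence past its entry, within this time.\<close>
  define \<Delta> where "\<Delta> = 2 * K + 3"
  have "K > 1" using R by (simp add: K_def add_pos_nonneg)
  have in_out: "\<And>t. t \<le> 0 \<Longrightarrow> \<Gamma> y t = fst y + t *\<^sub>R snd y"
     "\<And>t. t \<le> 0 \<Longrightarrow> \<Gamma> y t \<notin> cball c R" "\<And>t. \<Delta> \<le> t \<Longrightarrow> \<Gamma> y t \<in> cball c R" if y: "y \<in> W" for y
  proof -
    obtain t0 where t0: "\<bar>t0\<bar> \<le> R + norm c + norm (snd (line_of y))"
    "\<And>t. t \<le> t0 \<Longrightarrow> \<gamma> (line_of y) t = snd (line_of y) + t *\<^sub>R fst (line_of y)"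
    "\<And>t. t < t0 \<Longrightarrow> \<gamma> (line_of y) t \<notin> cball c R" "\<And>t. t0 \<le> t \<Longrightarrow> \<gamma> (line_of y) t \<in> cball c R"
      using incoming_ray[OF R(2)] \<gamma>[OF WF[OF y]] sub WF[OF y] by blast
    have "norm (snd (line_of y)) < norm (snd l0) + 1"
      using W(3)[OF y] norm_triangle_ineq2[of "snd (line_of y)" "snd l0"] by (simp add: dist_norm)
    then have "\<bar>t0\<bar> < K" using t0(1) by (simp add: K_def)
    then have t0K: "- K < t0" "t0 < K" by auto
    have neg: "line_time y + norm (snd y) * t < t0" if "t \<le> 0" for t
    proof -
      have "norm (snd y) * t \<le> 0" using that by (simp add: mult_nonneg_nonpos)
      then show ?thesis using W(5)[OF y] t0K by simp
    qed
    show "\<Gamma> y t = fst y + t *\<^sub>R snd y" if "t \<le> 0" for t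
      using t0(2)[of "line_time y + norm (snd y) * t"] neg[OF that]
      by (simp add: \<Gamma>_def phase_point_on_line)
    show "\<Gamma> y t \<notin> cball c R" if "t \<le> 0" for t
      unfolding \<Gamma>_def by (rule t0(3)[OF neg[OF that]])
    show "\<Gamma> y t \<in> cball c R" if "\<Delta> \<le> t" for t
    proof -
      have "0 \<le> t" using that \<open>K > 1\<close> by (simp add: \<Delta>_def)
      then have "t \<le> norm (snd y) * t" using W(1)[OF y] by (simp add: mult_le_cancel_right1)
      then have "t0 \<le> line_time y + norm (snd y) * t" 
        using W(4)[OF y] t0K that unfolding \<Delta>_def by linarith
      then show ?thesis unfolding \<Gamma>_def by (rule t0(4))
    qed
  qed
  have free: "\<Gamma> y t \<notin> \<Union>T" if "y \<in> W" "t \<le> 0" for y t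
    using in_out(2)[OF that] R(2) interior_subset by blast
  have lv0: "left_velocity (\<Gamma> y) 0 = snd y" if "y \<in> W" for y
    by (rule path_continue(2)[OF path[OF that], of "-1" 0 0 "fst y"])
      (use in_out(1)[OF that] free[OF that] in auto)
  define \<Phi> where "\<Phi> t y = (\<Gamma> y t, left_velocity (\<Gamma> y) t)" for t y
  have rewind: "\<Gamma> y (t - s) = \<Gamma> y' (t' - s)" "left_velocity (\<Gamma> y) (t - s) = left_velocity (\<Gamma> y') (t' - s)"
    if "\<Phi> t y = \<Phi> t' y'" "y \<in> W" "y' \<in> W" "s \<ge> 0" for t t' s y y'
    using backward_unique[OF path[OF that(2)] path[OF that(3)] _ _ that(4), of t t'] that(1)
    by (auto simp: \<Phi>_def)
  define N where "N t y = card (collisions T (\<Gamma> y) t)" for t y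
  have near: "\<forall>\<^sub>F y in nhds x. y \<in> W" if "x \<in> W" for x
    using \<open>open W\<close> that eventually_nhds by blast
  have flow: "\<exists>\<alpha> g L. \<alpha> < t \<and> unimodular L \<and> (g has_derivative L) (at x) \<and>
    (\<forall>a b. \<alpha> < a \<longrightarrow> a \<le> b \<longrightarrow> b < t \<longrightarrow> (\<forall>\<^sub>F y in nhds x. N a y = N t x \<and>
       (\<forall>s\<in>{a..b}. \<Gamma> y s = fst (g y) + s *\<^sub>R snd (g y) \<and> \<Gamma> y s \<notin> \<Union>T)))"
    if x: "x \<in> W" and "t > 0" for x t
    unfolding N_def
  proof (rule flow_perturbation[OF T])
    show "\<forall>\<^sub>F y in nhds x. billiard_path T (norm (snd y)) (\<Gamma> y)"
      using near[OF x] by eventually_elim (rule path)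
    show "\<forall>\<^sub>F y in nhds x. \<forall>s\<in>{-1..0}. \<Gamma> y s = fst y + s *\<^sub>R snd y \<and> \<Gamma> y s \<notin> \<Union>T"
      using near[OF x]
    proof eventually_elim
      case (elim y)
      show ?case
      proof
        fix s :: real assume "s \<in> {-1..0}"
        then have "s \<le> 0" by simp
        then show "\<Gamma> y s = fst y + s *\<^sub>R snd y \<and> \<Gamma> y s \<notin> \<Union>T"
          using in_out(1)[OF elim] free[OF elim] by blast
      qed
    qed
  qed (rule \<open>t > 0\<close> | assumption)+
  have N_mono: "N s y \<le> N t y" if "y \<in> W" "s \<le> t" for y s t
    unfolding N_def using card_collisions_mono[OF path[OF that(1)] that(2)] .
  \<comment> \<open>Nearby paths have already made as many collisions at a time slightly before
    \<open>t\<close>; the count at \<open>t\<close> can only be larger.\<close>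
  have N_open: "open {y \<in> W. i \<le> N t y}" if t: "t > 0" for i t
    unfolding open_contains_ball
  proof clarify
    fix a b assume x: "(a, b) \<in> W" "i \<le> N t (a, b)"
    obtain \<alpha> g L where \<alpha>: "\<alpha> < t"
      and ev: "\<forall>c d. \<alpha> < c \<longrightarrow> c \<le> d \<longrightarrow> d < t \<longrightarrow> (\<forall>\<^sub>F y in nhds (a, b). N c y = N t (a, b) \<and>
       (\<forall>s\<in>{c..d}. \<Gamma> y s = fst (g y) + s *\<^sub>R snd (g y) \<and> \<Gamma> y s \<notin> \<Union>T))"
      using flow[OF x(1) t] by (elim exE conjE)
    have "\<alpha> < (\<alpha> + t) / 2" "(\<alpha> + t) / 2 < t" using \<alpha> by auto
    then have mid: "\<forall>\<^sub>F y in nhds (a, b). N ((\<alpha> + t) / 2) y = N t (a, b)"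
      using ev[rule_format, OF _ order_refl, of "(\<alpha> + t) / 2"] by (simp add: eventually_conj_iff)
    from mid near[OF x(1)] have "\<forall>\<^sub>F y in nhds (a, b). y \<in> W \<and> i \<le> N t y"
    proof eventually_elim
      case (elim y)
      have "N ((\<alpha> + t) / 2) y \<le> N t y" by (rule N_mono[OF elim(2)]) (use \<alpha> in auto)
      then show ?case using elim x(2) by simp
    qed
    then show "\<exists>e>0. ball (a, b) e \<subseteq> {y \<in> W. i \<le> N t y}"
      by (auto simp: eventually_nhds_metric subset_iff dist_commute)
  qed
  \<comment> \<open>The multiples start at one, so that all paths are inside the ball at every
    sampled time.\<close>
  define tk where "tk k = real (Suc k) * \<Delta>" for k
  have "\<Delta> > 0" using \<open>K > 1\<close> by (simp add: \<Delta>_def)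
  then have tk: "tk k > 0" "\<Delta> \<le> tk k" for k by (auto simp: tk_def algebra_simps add_pos_nonneg)
  \<comment> \<open>Fixing the count removes the discontinuity of the flow at time
    \<open>tk k\<close>. Each piece is a difference of two open sets.\<close>
  define P where "P k i = {y \<in> W. N (tk k) y = i}" for k i
  show False
  proof (rule no_disjoint_unimodular_images[of W P "\<lambda>k. \<Phi> (tk k)" "cball c R \<times> cball 0 2"])
    show "open W" "W \<noteq> {}" by fact+
    show "bounded W"
      unfolding bounded_iff
    proof (intro exI ballI)
      fix y assume y: "y \<in> W"
      have "fst y = snd (line_of y) + line_time y *\<^sub>R fst (line_of y)"
        using phase_point_on_line[of y 0] by simp
      then have "norm (fst y) \<le> norm (snd (line_of y)) + \<bar>line_time y\<bar> * norm (fst (line_of y))"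
        by (metis norm_scaleR norm_triangle_ineq)
      moreover have "norm (fst (line_of y)) = 1" using WF[OF y] sub by (auto simp: oriented_lines_def dest!: subsetD)
      moreover have "norm (snd (line_of y)) < norm (snd l0) + 1"
        using W(3)[OF y] norm_triangle_ineq2[of "snd (line_of y)" "snd l0"] by (simp add: dist_norm)
      ultimately have "norm (fst y) \<le> norm (snd l0) + 1 + (K + 3)" using W(4,5)[OF y] \<open>K > 1\<close> by auto
      then show "norm y \<le> (norm (snd l0) + 1 + (K + 3)) + 2"
        using W(2)[OF y] norm_Pair_le[of "fst y" "snd y"] by simp
    qed
    show "(\<Union>i. P k i) = W" for k by (auto simp: P_def)
    show "disjoint_family (P k)" for k by (auto simp: P_def disjoint_family_on_def)
    show "P k i \<in> sets borel" for k i
    proof -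
      have "P k i = {y \<in> W. i \<le> N (tk k) y} - {y \<in> W. Suc i \<le> N (tk k) y}"
        by (auto simp: P_def)
      then show ?thesis using N_open[OF tk(1)] by (auto intro!: sets.Diff)
    qed
    show "\<exists>L. unimodular L \<and> (\<Phi> (tk k) has_derivative L) (at x within P k i)" if "x \<in> P k i" for x k i
    proof -
      have x: "x \<in> W" "N (tk k) x = i" using that by (auto simp: P_def)
      obtain \<alpha> g L where g: "\<alpha> < tk k" "unimodular L" "(g has_derivative L) (at x)"
        "\<forall>a b. \<alpha> < a \<longrightarrow> a \<le> b \<longrightarrow> b < tk k \<longrightarrow> (\<forall>\<^sub>F y in nhds x. N a y = N (tk k) x \<and>
           (\<forall>s\<in>{a..b}. \<Gamma> y s = fst (g y) + s *\<^sub>R snd (g y) \<and> \<Gamma> y s \<notin> \<Union>T))"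
        using flow[OF x(1) tk(1)[of k]] by (elim exE conjE)
      define a where "a = (max \<alpha> 0 + tk k) / 2"
      define b where "b = (a + tk k) / 2"
      have ab: "\<alpha> < a" "0 < a" "a < b" "b < tk k" using g(1) tk(1)[of k] by (auto simp: a_def b_def)
      have "\<forall>\<^sub>F y in nhds x. y \<in> P k i \<longrightarrow> free_flight (tk k) (g y) = \<Phi> (tk k) y"
        using g(4)[rule_format, OF ab(1) less_imp_le[OF ab(3)] ab(4)]
      proof eventually_elim
        case (elim y)
        have near_line: "\<Gamma> y s = fst (g y) + s *\<^sub>R snd (g y)" if "a < s" "s < b" for s
        proof -
          have "s \<in> {a..b}" using that by simp
          then show ?thesis using elim by blast
        qed
        show ?case
        proof
          assume "y \<in> P k i"
          then have y: "y \<in> W" "N (tk k) y = i" "N a y = i" using x(2) elim by (auto simp: P_def)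
          \<comment> \<open>Equal counts at \<open>a\<close> and at \<open>tk k\<close> exclude
            collisions in between, so \<open>y\<close> keeps the line \<open>g y\<close> up to time
            \<open>tk k\<close> and arrives there with its velocity.\<close>
          have "collisions T (\<Gamma> y) a = collisions T (\<Gamma> y) (tk k)"
            using y(2,3) finite_collisions[OF path[OF y(1)]] ab
            by (intro card_subset_eq) (auto simp: N_def collisions_def)
          then have nocoll: "\<Gamma> y s \<notin> \<Union>T" if "a < s" "s < tk k" for s
          proof -
            have "s \<notin> collisions T (\<Gamma> y) (tk k)"
              using \<open>collisions T (\<Gamma> y) a = _\<close>[symmetric] that by (simp add: collisions_def)
            then show ?thesis using that ab(2) by (simp add: collisions_def)
          qed
          note pc = path_continue[OF path[OF y(1)] ab(3) less_imp_le[OF ab(4)] nocoll near_line]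
          have "\<Gamma> y (tk k) = fst (g y) + tk k *\<^sub>R snd (g y)"
            by (rule pc(1)) (use ab in auto)
          moreover have "left_velocity (\<Gamma> y) (tk k) = snd (g y)" by (rule pc(2))
          ultimately show "free_flight (tk k) (g y) = \<Phi> (tk k) y" by (simp add: free_flight_def \<Phi>_def)
        qed
      qed
      then have ev: "\<forall>\<^sub>F y in at x within P k i. free_flight (tk k) (g y) = \<Phi> (tk k) y"
        and eq: "free_flight (tk k) (g x) = \<Phi> (tk k) x"
        using eventually_nhds_x_imp_x that by (fastforce simp: eventually_at_filter elim: eventually_mono)+
      have "((\<lambda>y. free_flight (tk k) (g y)) has_derivative (\<lambda>\<delta>. free_flight (tk k) (L \<delta>))) (at x within P k i)"
        using has_derivative_at_withinI[OF g(3)] bounded_linear.has_derivative[OF free_flight_bounded_linear] by blast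
      from has_derivative_transform_eventually[OF this ev eq that]
      have "(\<Phi> (tk k) has_derivative (free_flight (tk k) \<circ> L)) (at x within P k i)" by (simp add: o_def)
      then show ?thesis using unimodular_compose[OF unimodular_free_flight g(2)] by blast
    qed
    show "inj_on (\<Phi> (tk k)) W" for k
    proof (rule inj_onI)
      fix y y' assume y: "y \<in> W" "y' \<in> W" "\<Phi> (tk k) y = \<Phi> (tk k) y'"
      have "\<Gamma> y 0 = \<Gamma> y' 0" "left_velocity (\<Gamma> y) 0 = left_velocity (\<Gamma> y') 0"
        using rewind[OF y(3,1,2), of "tk k"] tk(1)[of k] by auto
      then show "y = y'" using in_out(1)[OF y(1), of 0] in_out(1)[OF y(2), of 0] lv0 y by (simp add: prod_eq_iff)
    qed
    \<comment> \<open>Rewinding both paths by \<open>tk j\<close> brings the first to its start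
      outside the ball, while the second has still travelled for at least \<open>\<Delta>\<close>
      and is inside.\<close>
    have disj: "\<Phi> (tk j) y \<noteq> \<Phi> (tk k) y'" if "j < k" "y \<in> W" "y' \<in> W" for j k y y'
    proof
      assume "\<Phi> (tk j) y = \<Phi> (tk k) y'"
      from rewind(1)[OF this that(2,3), of "tk j"] have "\<Gamma> y 0 = \<Gamma> y' (tk k - tk j)" using tk(1)[of j] by simp
      moreover have "\<Delta> \<le> tk k - tk j"
      proof -
        have "1 * \<Delta> \<le> (real k - real j) * \<Delta>" using that(1) \<open>\<Delta> > 0\<close> by (intro mult_right_mono) auto
        then show ?thesis by (simp add: tk_def algebra_simps)
      qed
      ultimately show False using in_out(3)[OF that(3)] in_out(2)[OF that(2), of 0] by auto
    qed
    show "\<Phi> (tk j) ` W \<inter> \<Phi> (tk k) ` W = {}" if jk: "j \<noteq> k" for j k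
    proof (rule equals0I)
      fix z assume "z \<in> \<Phi> (tk j) ` W \<inter> \<Phi> (tk k) ` W"
      then obtain y y' where y: "y \<in> W" "y' \<in> W" "\<Phi> (tk j) y = \<Phi> (tk k) y'" by auto
      consider "j < k" | "k < j" using jk by (meson linorder_neqE_nat)
      then show False using disj[of j k y y'] disj[of k j y' y] y by cases auto
    qed
    show "bounded (cball c R \<times> cball (0 :: real^'n) 2)" by (intro bounded_Times bounded_cball)
    show "\<Phi> (tk k) ` W \<subseteq> cball c R \<times> cball 0 2" for k
    proof (rule image_subsetI)
      fix y assume y: "y \<in> W"
      show "\<Phi> (tk k) y \<in> cball c R \<times> cball 0 2"
        using in_out(3)[OF y tk(2)] norm_left_velocity[OF path[OF y], of "tk k"] W(2)[OF y]
        by (simp add: \<Phi>_def)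
    qed
  qed
qed

section \<open>Submanifolds of top dimension\<close>

text \<open>In the hemisphere around \<open>u\<close>, unit length and sign recover the
  \<open>u\<close>-component of the direction, and orthogonality to the direction then recovers that
  of the base point. So the two projections are coordinates on lines near \<open>u\<close>.\<close>

lemma oriented_line_eqI:
  assumes l: "l \<in> oriented_lines" "l' \<in> oriented_lines" "fst l \<bullet> u > 0" "fst l' \<bullet> u > 0" "norm u = 1"
    and eq: "fst l - (fst l \<bullet> u) *\<^sub>R u = fst l' - (fst l' \<bullet> u) *\<^sub>R u"
      "snd l - (snd l \<bullet> u) *\<^sub>R u = snd l' - (snd l' \<bullet> u) *\<^sub>R u"
  shows "l = l'"
proof -
  have uu: "u \<bullet> u = 1" using l(5) by (simp add: norm_eq_1)
  have n: "fst l \<bullet> fst l = 1" "fst l' \<bullet> fst l' = 1" "snd l \<bullet> fst l = 0" "snd l' \<bullet> fst l' = 0"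
    using l(1,2) by (auto simp: oriented_lines_def norm_eq_1)
  have sq: "(x - (x \<bullet> u) *\<^sub>R u) \<bullet> (x - (x \<bullet> u) *\<^sub>R u) = x \<bullet> x - (x \<bullet> u)\<^sup>2" for x
    using uu by (simp add: inner_diff_left inner_diff_right inner_commute power2_eq_square)
  have "(fst l \<bullet> u)\<^sup>2 = (fst l' \<bullet> u)\<^sup>2" using sq[of "fst l"] sq[of "fst l'"] n eq(1) by simp
  then have a: "fst l \<bullet> u = fst l' \<bullet> u" using l(3,4) by (simp add: power2_eq_iff)
  then have f: "fst l = fst l'" using eq(1) by simp
  define k where "k = snd l \<bullet> u - snd l' \<bullet> u"
  have d: "snd l - snd l' = k *\<^sub>R u" using eq(2) by (simp add: k_def algebra_simps)
  have "(snd l - snd l') \<bullet> fst l = 0" using n(3,4) f by (simp add: inner_diff_left)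
  then have "k * (fst l \<bullet> u) = 0" unfolding d by (simp add: inner_commute)
  then have "k = 0" using l(3) by simp
  then have "snd l = snd l'" using d by simp
  with f show ?thesis by (simp add: prod_eq_iff)
qed

text \<open>The slice is mapped injectively by \<open>P \<circ> \<psi>\<close> into the coordinate
  space \<open>W\<close> of dimension 2n - 2. As the slice has at least that dimension, invariance
  of domain makes the image open, and \<open>P\<close> pulls it back to an open set of
  lines.\<close>

lemma top_dimensional_submanifold_contains_open:
  fixes F :: "('a::euclidean_space \<times> 'a) set"
  assumes F: "submanifold_of_lines d F" "F \<noteq> {}" and d: "2 * DIM('a) - 2 \<le> d"
  obtains G where "openin (top_of_set oriented_lines) G" "G \<noteq> {}" "G \<subseteq> F"
proof -
  have sub: "F \<subseteq> oriented_lines" using F by (simp add: submanifold_of_lines_def)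
  obtain l0 where l0: "l0 \<in> F" using F(2) by blast
  obtain U V \<phi> \<psi> S where ch: "diffeomorphism U V \<phi> \<psi>" "l0 \<in> U" "subspace S" "dim S = d" "\<phi> ` (U \<inter> F) = V \<inter> S"
    using F(1) l0 by (auto simp: submanifold_of_lines_def embedded_submanifold_def manifold_interior_def)
  have h: "open V" "continuous_on V \<psi>" "\<And>y. y \<in> V \<Longrightarrow> \<phi> (\<psi> y) = y" "\<And>x. x \<in> U \<Longrightarrow> \<psi> (\<phi> x) = x"
    using ch(1) by (auto simp: diffeomorphism_def homeomorphism_def)
  define u where "u = fst l0"
  have u: "norm u = 1" "u \<bullet> u = 1" using l0 sub by (auto simp: u_def oriented_lines_def norm_eq_1)
  define pr where "pr x = x - (x \<bullet> u) *\<^sub>R u" for x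
  define P where "P l = (pr (fst l), pr (snd l))" for l
  define W where "W = {x. u \<bullet> x = 0} \<times> {x. u \<bullet> x = 0}"
  have "u \<noteq> 0" using u by auto
  then have dW: "dim W = 2 * DIM('a) - 2"
    using dim_Times[OF subspace_hyperplane subspace_hyperplane, of u u] dim_hyperplane[of u]
    by (simp add: W_def)
  define A where "A = S \<inter> (V \<inter> \<psi> -` {l. 0 < fst l \<bullet> u})"
  have \<psi>F: "\<psi> y \<in> F" if "y \<in> V \<inter> S" for y
    using that h(4) unfolding ch(5)[symmetric] by auto
  have contP: "continuous_on B P" for B unfolding P_def[abs_def] pr_def by (intro continuous_intros)
  have op: "openin (top_of_set W) ((P \<circ> \<psi>) ` A)"
  proof (rule invariance_of_domain_subspaces[of S])
    have "open {l :: 'a \<times> 'a. 0 < fst l \<bullet> u}" by (intro open_Collect_less continuous_intros)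
    then show "openin (top_of_set S) A"
      unfolding A_def using continuous_open_preimage[OF h(2,1)] by (intro openin_open_Int)
    show "subspace S" by fact
    show "subspace W" unfolding W_def by (intro subspace_Times subspace_hyperplane)
    show "dim W \<le> dim S" using dW d ch(4) by simp
    show "continuous_on A (P \<circ> \<psi>)"
      by (intro continuous_on_compose contP continuous_on_subset[OF h(2)]) (auto simp: A_def)
    show "P \<circ> \<psi> \<in> A \<rightarrow> W"
      using u by (auto simp: P_def W_def pr_def inner_diff_right inner_commute)
    show "inj_on (P \<circ> \<psi>) A"
    proof (rule inj_onI)
      fix y y' assume y: "y \<in> A" "y' \<in> A" "(P \<circ> \<psi>) y = (P \<circ> \<psi>) y'"
      have "\<psi> y \<in> oriented_lines" "\<psi> y' \<in> oriented_lines"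
        using y(1,2) \<psi>F sub unfolding A_def by blast+
      then have "\<psi> y = \<psi> y'"
        by (rule oriented_line_eqI[of _ _ u]) (use y u in \<open>auto simp: A_def P_def pr_def\<close>)
      then show "y = y'" using h(3) y by (metis A_def IntD1 IntD2)
    qed
  qed
  then obtain N where N: "open N" "(P \<circ> \<psi>) ` A = W \<inter> N" unfolding openin_open by blast
  define G where "G = oriented_lines \<inter> ({l. 0 < fst l \<bullet> u} \<inter> P -` N)"
  show thesis
  proof
    have "open {l :: 'a \<times> 'a. 0 < fst l \<bullet> u}" by (intro open_Collect_less continuous_intros)
    then show "openin (top_of_set oriented_lines) G"
      unfolding G_def using continuous_open_preimage[OF contP _ N(1)] by (intro openin_open_Int) blast
    have "\<phi> l0 \<in> V \<inter> S" using ch(2,5) l0 by blast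
    then have "\<phi> l0 \<in> A" using h(4)[OF ch(2)] u by (simp add: A_def u_def)
    then have "P l0 \<in> N" using N(2) h(4)[OF ch(2)] by force
    then have "l0 \<in> G" using l0 sub u by (auto simp: G_def u_def)
    then show "G \<noteq> {}" by blast
    show "G \<subseteq> F"
    proof
      fix l assume l: "l \<in> G"
      have "P l \<in> W" using u by (auto simp: P_def W_def pr_def inner_diff_right inner_commute)
      then have "P l \<in> (P \<circ> \<psi>) ` A" using l N(2) by (auto simp: G_def)
      then obtain y where y: "y \<in> A" "P l = P (\<psi> y)" by auto
      have "\<psi> y \<in> F" using y(1) \<psi>F unfolding A_def by blast
      moreover from this have "\<psi> y \<in> oriented_lines" using sub by blast
      then have "l = \<psi> y"
        by (rule oriented_line_eqI[of _ _ u, rotated]) (use y l u in \<open>auto simp: A_def G_def P_def pr_def\<close>)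
      ultimately show "l \<in> F" by simp
    qed
  qed
qed

lemma trapped_family_subset: "trapped_family T F \<Longrightarrow> G \<subseteq> F \<Longrightarrow> trapped_family T G"
  unfolding trapped_family_def by (meson subset_iff)

text \<open>\<open>F\<close> must be nonempty here, as the empty set is a submanifold of every
  dimension.\<close>

theorem trapped_family_dimension:
  fixes T :: "(real ^ 'n::finite) set set"
  assumes "trap T" "F \<noteq> {}" "submanifold_of_lines d F" "trapped_family T F" "CARD('n) \<ge> 2"
  shows "d \<le> 2 * CARD('n) - 3"
proof (rule ccontr)
  assume "\<not> ?thesis"
  then have "2 * DIM(real^'n) - 2 \<le> d" using assms(5) by simp
  then obtain G where "openin (top_of_set oriented_lines) G" "G \<noteq> {}" "G \<subseteq> F"
    using top_dimensional_submanifold_contains_open[OF assms(3,2)] by blast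
  then show False using open_not_trapped[OF assms(1)] trapped_family_subset[OF assms(4)] by blast
qed

section \<open>The elliptic mirror\<close>

text \<open>A point with a flat chart cannot also have a half-space chart: the change of charts
  would have an open image inside a half space that touches its edge. Avoidance of the rim thus
  follows from the interior charts alone.\<close>

lemma manifold_interior_boundary_disjoint:
  assumes "x \<in> manifold_interior d M"
  shows "x \<notin> manifold_boundary d M"
proof
  assume "x \<in> manifold_boundary d M"
  then obtain U2 V2 \<phi>2 \<psi>2 S2 b where ch2: "diffeomorphism U2 V2 \<phi>2 \<psi>2" "x \<in> U2" "subspace S2" "dim S2 = d"
    "b \<in> S2" "b \<noteq> 0" "b \<bullet> \<phi>2 x = 0" "\<phi>2 ` (U2 \<inter> M) = V2 \<inter> {y \<in> S2. 0 \<le> b \<bullet> y}"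
    unfolding manifold_boundary_def by blast
  obtain U1 V1 \<phi>1 \<psi>1 S1 where ch1: "diffeomorphism U1 V1 \<phi>1 \<psi>1" "x \<in> U1" "subspace S1" "dim S1 = d"
    "\<phi>1 ` (U1 \<inter> M) = V1 \<inter> S1" and xM: "x \<in> M"
    using assms unfolding manifold_interior_def by blast
  have h1: "open V1" "continuous_on V1 \<psi>1" "\<And>y. y \<in> V1 \<Longrightarrow> \<phi>1 (\<psi>1 y) = y" "\<And>y. y \<in> U1 \<Longrightarrow> \<psi>1 (\<phi>1 y) = y"
    using ch1(1) by (auto simp: diffeomorphism_def homeomorphism_def)
  have h2: "open U2" "continuous_on U2 \<phi>2" "\<And>y. y \<in> U2 \<Longrightarrow> \<psi>2 (\<phi>2 y) = y"
    using ch2(1) by (auto simp: diffeomorphism_def homeomorphism_def)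
  define A where "A = S1 \<inter> (V1 \<inter> \<psi>1 -` U2)"
  have \<psi>M: "\<psi>1 y \<in> U1 \<inter> M" if "y \<in> V1 \<inter> S1" for y
    using that h1(4) unfolding ch1(5)[symmetric] by auto
  have im: "\<phi>2 (\<psi>1 y) \<in> {y \<in> S2. 0 \<le> b \<bullet> y}" if "y \<in> A" for y
  proof -
    have "\<psi>1 y \<in> U2 \<inter> M" using that \<psi>M by (auto simp: A_def)
    then show ?thesis using ch2(8) by blast
  qed
  have "openin (top_of_set S2) ((\<phi>2 \<circ> \<psi>1) ` A)"
  proof (rule invariance_of_domain_subspaces[of S1])
    show "openin (top_of_set S1) A"
      unfolding A_def using continuous_open_preimage[OF h1(2,1) h2(1)] by (intro openin_open_Int)
    show "continuous_on A (\<phi>2 \<circ> \<psi>1)"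
      by (intro continuous_on_compose continuous_on_subset[OF h1(2)] continuous_on_subset[OF h2(2)])
        (auto simp: A_def)
    show "\<phi>2 \<circ> \<psi>1 \<in> A \<rightarrow> S2" using im by auto
    show "inj_on (\<phi>2 \<circ> \<psi>1) A"
    proof (rule inj_onI)
      fix y y' assume y: "y \<in> A" "y' \<in> A" "(\<phi>2 \<circ> \<psi>1) y = (\<phi>2 \<circ> \<psi>1) y'"
      then have V: "y \<in> V1" "y' \<in> V1" "\<psi>1 y \<in> U2" "\<psi>1 y' \<in> U2" by (simp_all add: A_def)
      have "\<psi>1 y = \<psi>1 y'" using h2(3)[OF V(3)] h2(3)[OF V(4)] y(3) by (metis comp_apply)
      then show "y = y'" using h1(3)[OF V(1)] h1(3)[OF V(2)] by metis
    qed
  qed (use ch1 ch2 in simp_all)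
  then obtain N where N: "open N" "(\<phi>2 \<circ> \<psi>1) ` A = S2 \<inter> N" unfolding openin_open by blast
  have "\<phi>1 x \<in> V1 \<inter> S1" using ch1(2,5) xM by blast
  then have "\<phi>1 x \<in> A" using h1(4)[OF ch1(2)] ch2(2) by (simp add: A_def)
  then have "\<phi>2 x \<in> (\<phi>2 \<circ> \<psi>1) ` A" using h1(4)[OF ch1(2)] by force
  then have x: "\<phi>2 x \<in> S2" "\<phi>2 x \<in> N" using N(2) by auto
  \<comment> \<open>An open image contains a point slightly on the wrong side of the edge, in
    direction \<open>-b\<close>.\<close>
  have "open ((\<lambda>t. \<phi>2 x - t *\<^sub>R b) -` N)"
    by (rule open_vimage[OF N(1)]) (intro continuous_intros)
  moreover have "0 \<in> (\<lambda>t. \<phi>2 x - t *\<^sub>R b) -` N" using x by simp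
  ultimately obtain e where e: "e > 0" "ball 0 e \<subseteq> (\<lambda>t. \<phi>2 x - t *\<^sub>R b) -` N" using openE by blast
  then have "e / 2 \<in> (\<lambda>t. \<phi>2 x - t *\<^sub>R b) -` N" by (auto simp: subset_iff dist_real_def)
  then have "\<phi>2 x - (e / 2) *\<^sub>R b \<in> (\<phi>2 \<circ> \<psi>1) ` A"
    using N(2) x(1) ch2(3,5) by (simp add: subspace_diff subspace_scale)
  then obtain y where "y \<in> A" "\<phi>2 x - (e / 2) *\<^sub>R b = \<phi>2 (\<psi>1 y)" by auto
  then have "0 \<le> b \<bullet> (\<phi>2 x - (e / 2) *\<^sub>R b)" using im[of y] by simp
  then have "e * (b \<bullet> b) \<le> 0" using ch2(7) by (simp add: inner_diff_right)
  moreover have "b \<bullet> b > 0" using ch2(6) by simp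
  ultimately show False using mult_pos_pos[OF e(1), of "b \<bullet> b"] by linarith
qed

lemma diffeomorphism_restrict:
  assumes "diffeomorphism U V \<phi> \<psi>" "open \<Omega>"
  shows "diffeomorphism (U \<inter> \<Omega>) (V \<inter> \<psi> -` \<Omega>) \<phi> \<psi>"
proof -
  have h: "open U" "open V" "continuous_on U \<phi>" "continuous_on V \<psi>" "smooth_on U \<phi>" "smooth_on V \<psi>"
    "\<phi> ` U = V" "\<psi> ` V = U" "\<And>x. x \<in> U \<Longrightarrow> \<psi> (\<phi> x) = x" "\<And>y. y \<in> V \<Longrightarrow> \<phi> (\<psi> y) = y"
    using assms(1) by (auto simp: diffeomorphism_def homeomorphism_def)
  have "homeomorphism (U \<inter> \<Omega>) (V \<inter> \<psi> -` \<Omega>) \<phi> \<psi>"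
  proof (rule homeomorphismI)
    show "continuous_on (U \<inter> \<Omega>) \<phi>" "continuous_on (V \<inter> \<psi> -` \<Omega>) \<psi>"
      using h(3,4) by (auto intro: continuous_on_subset)
  qed (use h(7-10) in auto)
  moreover have "smooth_on (U \<inter> \<Omega>) \<phi>" "smooth_on (V \<inter> \<psi> -` \<Omega>) \<psi>"
    using h(5,6) Ck_on_subset unfolding smooth_on_def by (meson inf_le1)+
  ultimately show ?thesis
    using h(1,2) assms(2) continuous_open_preimage[OF h(4,2) assms(2)]
    by (simp add: diffeomorphism_def open_Int)
qed

text \<open>The oblate ellipsoid of revolution about the axis \<open>e\<close> with semi-axes \<open>sqrt 2\<close> and \<open>1\<close>:
  its focal set is the unit sphere of the equatorial hyperplane \<open>y \<bullet> e = 0\<close>.\<close>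

definition ellipsoid_form :: "'a::real_inner \<Rightarrow> 'a \<Rightarrow> real" where
  "ellipsoid_form e y = y \<bullet> y + (y \<bullet> e)\<^sup>2"

definition bowl :: "'a::real_inner \<Rightarrow> 'a set" where
  "bowl e = {y. ellipsoid_form e y = 2 \<and> y \<bullet> e \<le> 1/2}"

lemma smooth_on_ellipsoid_form:
  "open S \<Longrightarrow> smooth_on S f \<Longrightarrow> smooth_on S (\<lambda>x. ellipsoid_form e (f x))"
  unfolding ellipsoid_form_def power2_eq_square
  by (simp only: inner_real_def[symmetric])
    (intro smooth_on_add smooth_on_inner smooth_on_const | assumption)+

text \<open>The chart replaces the coordinate along \<open>d\<close> by the value of the defining
  function. By \<open>split\<close> the form contains that coordinate only as \<kappa> times its
  square, so a square root inverts the chart on the half space. The shift \<open>a\<close> serves to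
  put a rim point on the edge of a half-slice.\<close>

lemma ellipsoid_chart:
  fixes e d a :: "'a::euclidean_space"
  assumes d: "d \<bullet> d = 1" and \<kappa>: "\<kappa> > 0" and a: "a \<bullet> d = 0"
    and split: "\<And>y. ellipsoid_form e y = ellipsoid_form e (y - (y \<bullet> d) *\<^sub>R d) + \<kappa> * (y \<bullet> d)\<^sup>2"
  defines "\<phi> \<equiv> \<lambda>y. (y - (y \<bullet> d) *\<^sub>R d) + (ellipsoid_form e y - 2) *\<^sub>R d - a"
  obtains V \<psi> where "diffeomorphism {y. y \<bullet> d > 0} V \<phi> \<psi>"
proof -
  define pr where "pr w = w - (w \<bullet> d) *\<^sub>R d" for w
  \<comment> \<open>The value of \<open>\<kappa> * (y \<bullet> d)\<^sup>2\<close> read off from the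
    image point.\<close>
  define k where "k \<eta> = (\<eta> + a) \<bullet> d + 2 - ellipsoid_form e (pr (\<eta> + a))" for \<eta>
  define V where "V = {\<eta>. k \<eta> > 0}"
  define \<psi> where "\<psi> \<eta> = pr (\<eta> + a) + sqrt (k \<eta> / \<kappa>) *\<^sub>R d" for \<eta>
  have pr: "pr w \<bullet> d = 0" "pr (pr w + t *\<^sub>R d) = pr w" for w t
    using d by (auto simp: pr_def inner_diff_left inner_add_left)
  have contk: "continuous_on S k" for S
    unfolding k_def[abs_def] pr_def[abs_def] ellipsoid_form_def[abs_def] by (intro continuous_intros)
  have opU: "open {y. y \<bullet> d > 0}" by (intro open_Collect_less continuous_intros)
  have opV: "open V" unfolding V_def by (intro open_Collect_less contk continuous_intros)
  have \<phi>: "\<phi> y + a = pr y + (ellipsoid_form e y - 2) *\<^sub>R d" for y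
    by (simp add: \<phi>_def pr_def)
  have \<phi>d: "(\<phi> y + a) \<bullet> d = ellipsoid_form e y - 2" "pr (\<phi> y + a) = pr y" for y
    unfolding \<phi> using d pr by (auto simp: inner_add_left)
  have k\<phi>: "k (\<phi> y) = \<kappa> * (y \<bullet> d)\<^sup>2" for y
    unfolding k_def \<phi>d using split[of y] by (simp add: pr_def)
  have \<psi>\<phi>: "\<psi> (\<phi> y) = y" if "y \<bullet> d > 0" for y
    using that \<kappa> unfolding \<psi>_def k\<phi> \<phi>d by (simp add: pr_def)
  have \<psi>d: "\<psi> \<eta> \<bullet> d = sqrt (k \<eta> / \<kappa>)" for \<eta>
    unfolding \<psi>_def using d pr by (simp add: inner_add_left)
  have \<phi>\<psi>: "\<phi> (\<psi> \<eta>) = \<eta>" if "\<eta> \<in> V" for \<eta>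
  proof -
    have p: "pr (\<psi> \<eta>) = pr (\<eta> + a)" unfolding \<psi>_def by (simp add: pr)
    have "ellipsoid_form e (\<psi> \<eta>) = ellipsoid_form e (pr (\<eta> + a)) + \<kappa> * (k \<eta> / \<kappa>)"
    proof -
      have "(\<psi> \<eta> \<bullet> d)\<^sup>2 = k \<eta> / \<kappa>" using that \<kappa> by (simp add: \<psi>d V_def)
      then show ?thesis
        unfolding p[symmetric] using split[of "\<psi> \<eta>"] by (simp only: pr_def)
    qed
    then have "ellipsoid_form e (\<psi> \<eta>) - 2 = (\<eta> + a) \<bullet> d" using \<kappa> by (simp add: k_def)
    then have "\<phi> (\<psi> \<eta>) + a = pr (\<eta> + a) + ((\<eta> + a) \<bullet> d) *\<^sub>R d" unfolding \<phi> p by simp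
    then show ?thesis by (simp add: pr_def)
  qed
  have s\<phi>: "smooth_on {y. y \<bullet> d > 0} \<phi>"
    unfolding \<phi>_def
    by (intro smooth_on_add[OF opU] smooth_on_diff[OF opU] smooth_on_scaleR[OF opU] smooth_on_inner[OF opU]
      smooth_on_ellipsoid_form[OF opU] smooth_on_const[OF opU] smooth_on_ident[OF opU])
  have spr: "smooth_on V (\<lambda>\<eta>. pr (\<eta> + a))"
    unfolding pr_def
    by (intro smooth_on_add[OF opV] smooth_on_diff[OF opV] smooth_on_scaleR[OF opV] smooth_on_inner[OF opV]
      smooth_on_const[OF opV] smooth_on_ident[OF opV])
  have sk: "smooth_on V k"
    unfolding k_def[abs_def]
    by (intro smooth_on_add[OF opV] smooth_on_diff[OF opV] smooth_on_scaleR[OF opV] smooth_on_inner[OF opV]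
      smooth_on_ellipsoid_form[OF opV] spr smooth_on_const[OF opV] smooth_on_ident[OF opV])
  have s\<psi>: "smooth_on V \<psi>"
    unfolding \<psi>_def[abs_def]
    by (intro smooth_on_add[OF opV] smooth_on_scaleR[OF opV] smooth_on_sqrt[OF opV] smooth_on_divide[OF opV]
      spr sk smooth_on_const[OF opV]) (use \<kappa> in \<open>auto simp: V_def\<close>)
  have "homeomorphism {y. y \<bullet> d > 0} V \<phi> \<psi>"
  proof (rule homeomorphismI)
    show "continuous_on {y. y \<bullet> d > 0} \<phi>" "continuous_on V \<psi>"
      using s\<phi> s\<psi> smooth_on_imp_continuous_on by blast+
    show "\<phi> ` {y. y \<bullet> d > 0} \<subseteq> V" using \<kappa> by (auto simp: V_def k\<phi>)
    show "\<psi> ` V \<subseteq> {y. y \<bullet> d > 0}" using \<kappa> by (auto simp: V_def \<psi>d)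
  qed (use \<psi>\<phi> \<phi>\<psi> in auto)
  then show thesis using that[of V \<psi>] opU opV s\<phi> s\<psi> by (simp add: diffeomorphism_def)
qed

section \<open>The bowl as a mirror with boundary\<close>

context
  fixes e :: "'a::euclidean_space"
  assumes e: "norm e = 1"
begin

lemma axis_inner: "e \<bullet> e = 1"
  using e by (simp add: norm_eq_1)

lemma ellipsoid_form_split_radial:
  assumes "d \<bullet> d = 1" "d \<bullet> e = 0"
  shows "ellipsoid_form e y = ellipsoid_form e (y - (y \<bullet> d) *\<^sub>R d) + 1 * (y \<bullet> d)\<^sup>2"
  using assms
  by (simp add: ellipsoid_form_def inner_diff_left inner_diff_right inner_commute power2_eq_square)

lemma ellipsoid_form_split_pole:
  "ellipsoid_form e y = ellipsoid_form e (y - (y \<bullet> - e) *\<^sub>R - e) + 2 * (y \<bullet> - e)\<^sup>2"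
proof -
  define w where "w = y - (y \<bullet> e) *\<^sub>R e"
  have we: "w \<bullet> e = 0" by (simp add: w_def inner_diff_left axis_inner)
  have "w \<bullet> w = w \<bullet> y" by (subst (2) w_def) (simp add: inner_diff_right we)
  also have "\<dots> = y \<bullet> y - (y \<bullet> e)\<^sup>2"
    by (simp add: w_def inner_diff_left inner_commute[of e] power2_eq_square)
  finally have "ellipsoid_form e w = y \<bullet> y - (y \<bullet> e)\<^sup>2" by (simp add: ellipsoid_form_def we)
  moreover have "y - (y \<bullet> - e) *\<^sub>R - e = w" by (simp add: w_def)
  ultimately show ?thesis by (simp add: ellipsoid_form_def)
qed

lemma radial_direction:
  assumes "y - (y \<bullet> e) *\<^sub>R e \<noteq> 0"
  obtains d where "d \<bullet> d = 1" "d \<bullet> e = 0" "y \<bullet> d > 0"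
proof -
  define x where "x = y - (y \<bullet> e) *\<^sub>R e"
  have x: "x \<bullet> e = 0" "x \<noteq> 0" using axis_inner assms by (auto simp: x_def inner_diff_left)
  have "y \<bullet> x = x \<bullet> x + (y \<bullet> e) * (x \<bullet> e)"
    unfolding x_def by (simp add: inner_diff_left inner_diff_right inner_commute axis_inner)
  then have "y \<bullet> x > 0" using x by simp
  then have "y \<bullet> sgn x > 0" using x by (simp add: sgn_div_norm)
  moreover have "sgn x \<bullet> sgn x = 1" using x by (metis norm_eq_1 norm_sgn)
  moreover have "sgn x \<bullet> e = 0" using x by (simp add: sgn_div_norm)
  ultimately show thesis using that by blast
qed

text \<open>Off the axis a horizontal direction serves for the chart, with \<kappa> = 1; at the
  lower pole the direction is \<open>- e\<close>, with \<kappa> = 2.\<close>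

lemma bowl_interior:
  assumes "y \<in> bowl e" "y \<bullet> e < 1/2"
  shows "y \<in> mirror_interior (bowl e)"
proof -
  have "\<exists>d \<kappa>. d \<bullet> d = 1 \<and> \<kappa> > 0 \<and> y \<bullet> d > 0 \<and>
    (\<forall>y. ellipsoid_form e y = ellipsoid_form e (y - (y \<bullet> d) *\<^sub>R d) + \<kappa> * (y \<bullet> d)\<^sup>2)"
  proof (cases "y - (y \<bullet> e) *\<^sub>R e = 0")
    case True
    then have y: "y = (y \<bullet> e) *\<^sub>R e" by simp
    then have "y \<bullet> y = (y \<bullet> e)\<^sup>2" by (metis inner_scaleR_right power2_eq_square)
    then have "(y \<bullet> e)\<^sup>2 = 1" using assms(1) by (simp add: bowl_def ellipsoid_form_def)
    \<comment> \<open>The upper pole is excluded because its height exceeds 1/2.\<close>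
    then have "y \<bullet> e = - 1" using assms(2) by (auto simp: power2_eq_1_iff)
    then have "- e \<bullet> - e = 1" "y \<bullet> - e > 0" using axis_inner by simp_all
    then show ?thesis
      by (intro exI[of _ "- e"] exI[of _ 2] conjI allI) (rule ellipsoid_form_split_pole zero_less_numeral | assumption)+
  next
    case False
    then obtain d where "d \<bullet> d = 1" "d \<bullet> e = 0" "y \<bullet> d > 0" by (rule radial_direction)
    then show ?thesis
      by (intro exI[of _ d] exI[of _ 1] conjI allI)
        (rule ellipsoid_form_split_radial zero_less_one | assumption)+
  qed
  then obtain d \<kappa> where d: "d \<bullet> d = 1" "\<kappa> > 0" "y \<bullet> d > 0"
    "\<And>y. ellipsoid_form e y = ellipsoid_form e (y - (y \<bullet> d) *\<^sub>R d) + \<kappa> * (y \<bullet> d)\<^sup>2" by blast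
  define \<phi> where "\<phi> = (\<lambda>y. (y - (y \<bullet> d) *\<^sub>R d) + (ellipsoid_form e y - 2) *\<^sub>R d - 0)"
  obtain V \<psi> where ch: "diffeomorphism {y. y \<bullet> d > 0} V \<phi> \<psi>"
    using ellipsoid_chart[OF d(1,2) inner_zero_left d(4)] unfolding \<phi>_def by blast
  let ?\<Omega> = "{y. y \<bullet> e < 1/2}"
  have "open ?\<Omega>" by (intro open_Collect_less continuous_intros)
  note ch' = diffeomorphism_restrict[OF ch this]
  have \<phi>d: "d \<bullet> \<phi> z = ellipsoid_form e z - 2" for z
    using d(1) by (simp add: \<phi>_def inner_diff_right inner_add_right inner_commute)
  let ?U = "{y. y \<bullet> d > 0} \<inter> ?\<Omega>" and ?V = "V \<inter> \<psi> -` ?\<Omega>"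
  have h: "\<phi> ` ?U = ?V" "\<And>x. x \<in> ?U \<Longrightarrow> \<psi> (\<phi> x) = x"
    using ch' by (auto simp: diffeomorphism_def homeomorphism_def)
  have "\<phi> ` (?U \<inter> bowl e) = ?V \<inter> {x. d \<bullet> x = 0}"
  proof (intro equalityI subsetI)
    fix z assume "z \<in> \<phi> ` (?U \<inter> bowl e)"
    then show "z \<in> ?V \<inter> {x. d \<bullet> x = 0}" using h(1) by (auto simp: bowl_def \<phi>d)
  next
    fix z assume z: "z \<in> ?V \<inter> {x. d \<bullet> x = 0}"
    then obtain x where x: "x \<in> ?U" "z = \<phi> x" using h(1) by blast
    then have "x \<in> bowl e" using z by (auto simp: bowl_def \<phi>d)
    then show "z \<in> \<phi> ` (?U \<inter> bowl e)" using x by blast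
  qed
  moreover have "y \<in> ?U" using d(3) assms(2) by simp
  moreover have "d \<noteq> 0" using d(1) by auto
  then have "dim {x. d \<bullet> x = 0} = DIM('a) - 1" by (rule dim_hyperplane)
  ultimately show ?thesis
    unfolding mirror_interior_def manifold_interior_def
    using assms(1) ch' subspace_hyperplane[of d] by blast
qed

lemma bowl_boundary:
  assumes "y \<in> bowl e" "y \<bullet> e = 1/2"
  shows "y \<in> mirror_boundary (bowl e)"
proof -
  have "y - (y \<bullet> e) *\<^sub>R e \<noteq> 0"
  proof
    assume "y - (y \<bullet> e) *\<^sub>R e = 0"
    then have "y = (y \<bullet> e) *\<^sub>R e" by simp
    then have "y \<bullet> y = (y \<bullet> e)\<^sup>2" by (metis inner_scaleR_right power2_eq_square)
    then show False using assms by (simp add: bowl_def ellipsoid_form_def power2_eq_square)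
  qed
  then obtain d where d: "d \<bullet> d = 1" "d \<bullet> e = 0" "y \<bullet> d > 0" by (rule radial_direction)
  \<comment> \<open>The chart along a horizontal \<open>d\<close> keeps the height; after this shift
    the rim has height 0 and the bowl is where \<open>- e\<close> is nonnegative.\<close>
  define a where "a = (1/2::real) *\<^sub>R e"
  define \<phi> where "\<phi> = (\<lambda>y. (y - (y \<bullet> d) *\<^sub>R d) + (ellipsoid_form e y - 2) *\<^sub>R d - a)"
  have ad: "a \<bullet> d = 0" using d(2) by (simp add: a_def inner_commute)
  obtain V \<psi> where ch: "diffeomorphism {y. y \<bullet> d > 0} V \<phi> \<psi>"
    using ellipsoid_chart[OF d(1) zero_less_one ad ellipsoid_form_split_radial[OF d(1,2)]]
    unfolding \<phi>_def by blast
  have \<phi>d: "d \<bullet> \<phi> z = ellipsoid_form e z - 2" for z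
    using d(1) ad by (simp add: \<phi>_def inner_diff_right inner_add_right inner_commute)
  have \<phi>e: "- e \<bullet> \<phi> z = 1/2 - z \<bullet> e" for z
    using d(2) axis_inner by (simp add: \<phi>_def a_def inner_diff_right inner_add_right inner_commute)
  let ?U = "{y. y \<bullet> d > 0}"
  have h: "\<phi> ` ?U = V" "\<And>x. x \<in> ?U \<Longrightarrow> \<psi> (\<phi> x) = x"
    using ch by (auto simp: diffeomorphism_def homeomorphism_def)
  have im: "\<phi> ` (?U \<inter> bowl e) = V \<inter> {x \<in> {x. d \<bullet> x = 0}. 0 \<le> - e \<bullet> x}"
  proof (intro equalityI subsetI)
    fix z assume "z \<in> \<phi> ` (?U \<inter> bowl e)"
    then obtain x where "x \<in> ?U" "x \<in> bowl e" "z = \<phi> x" by blast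
    then show "z \<in> V \<inter> {x \<in> {x. d \<bullet> x = 0}. 0 \<le> - e \<bullet> x}"
      using h(1) \<phi>e[of x] by (auto simp: bowl_def \<phi>d)
  next
    fix z assume z: "z \<in> V \<inter> {x \<in> {x. d \<bullet> x = 0}. 0 \<le> - e \<bullet> x}"
    then obtain x where x: "x \<in> ?U" "z = \<phi> x" using h(1) by blast
    then have "x \<in> bowl e" using z \<phi>e[of x] by (auto simp: bowl_def \<phi>d)
    then show "z \<in> \<phi> ` (?U \<inter> bowl e)" using x by blast
  qed
  have "d \<noteq> 0" using d(1) by auto
  then have "dim {x. d \<bullet> x = 0} = DIM('a) - 1" by (rule dim_hyperplane)
  moreover have "- e \<in> {x. d \<bullet> x = 0}" "- e \<noteq> 0" using d(2) axis_inner by auto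
  moreover have "- e \<bullet> \<phi> y = 0" using \<phi>e[of y] assms(2) by simp
  moreover have "y \<in> ?U" using d(3) by simp
  ultimately have "diffeomorphism ?U V \<phi> \<psi> \<and> y \<in> ?U \<and> subspace {x. d \<bullet> x = 0} \<and>
     dim {x. d \<bullet> x = 0} = DIM('a) - 1 \<and> - e \<in> {x. d \<bullet> x = 0} \<and> - e \<noteq> 0 \<and> - e \<bullet> \<phi> y = 0 \<and>
     \<phi> ` (?U \<inter> bowl e) = V \<inter> {x \<in> {x. d \<bullet> x = 0}. 0 \<le> - e \<bullet> x}"
    using ch subspace_hyperplane[of d] im by (intro conjI)
  then show ?thesis
    unfolding mirror_boundary_def manifold_boundary_def using assms(1) by blast
qed

lemma bowl_compact: "compact (bowl e)"
  unfolding compact_eq_bounded_closed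
proof
  have "norm y \<le> 2" if "y \<in> bowl e" for y
  proof -
    have "y \<bullet> y \<le> 2"
      using that zero_le_power2[of "y \<bullet> e"] unfolding bowl_def ellipsoid_form_def mem_Collect_eq by linarith
    then have "(norm y)\<^sup>2 \<le> 2\<^sup>2" by (simp add: power2_norm_eq_inner)
    then show ?thesis by (rule power2_le_imp_le) simp
  qed
  then show "bounded (bowl e)" unfolding bounded_iff by blast
  show "closed (bowl e)" unfolding bowl_def ellipsoid_form_def
    by (intro closed_Collect_conj closed_Collect_eq closed_Collect_le continuous_intros)
qed

lemma trap_bowl: "trap {bowl e}"
proof -
  have "bowl e \<subseteq> mirror_interior (bowl e) \<union> mirror_boundary (bowl e)"
  proof
    fix y assume "y \<in> bowl e"
    then show "y \<in> mirror_interior (bowl e) \<union> mirror_boundary (bowl e)"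
      using bowl_interior bowl_boundary by (cases "y \<bullet> e = 1/2") (auto simp: bowl_def)
  qed
  then show ?thesis
    using bowl_compact
    by (simp add: trap_def mirror_def embedded_submanifold_with_boundary_def mirror_interior_def mirror_boundary_def)
qed

text \<open>\<open>N\<close> is half the gradient of \<open>ellipsoid_form e\<close>, which is
  constant along curves in the bowl. It is nonzero because its inner product with \<open>y\<close>
  is 2.\<close>

lemma bowl_normal:
  assumes y: "y \<in> bowl e"
  defines "N \<equiv> y + (y \<bullet> e) *\<^sub>R e"
  shows "unit_normal (bowl e) y (sgn N)"
proof -
  have "N \<bullet> y = 2" using y 
    by (simp add: N_def bowl_def ellipsoid_form_def inner_add_left inner_add_right inner_commute power2_eq_square)
  then have "N \<noteq> 0" by auto
  moreover have "N \<bullet> v = 0" if v: "v \<in> tangent_space (bowl e) y" for v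
  proof -
    obtain c \<epsilon> where c: "(0::real) < \<epsilon>" "c ` {-\<epsilon><..<\<epsilon>} \<subseteq> bowl e" "c 0 = y" "(c has_vector_derivative v) (at 0)"
      using v unfolding tangent_space_def by blast
    have d: "(c has_derivative (\<lambda>t. t *\<^sub>R v)) (at 0)" using c(4) by (simp add: has_vector_derivative_def)
    have "((\<lambda>t. ellipsoid_form e (c t)) has_derivative (\<lambda>t. 2 * (N \<bullet> v) * t)) (at 0)"
      unfolding ellipsoid_form_def
      by (rule derivative_eq_intros d refl)+
        (auto simp: c(3) N_def inner_add_left inner_commute algebra_simps)
    moreover have "((\<lambda>t. ellipsoid_form e (c t)) has_derivative (\<lambda>t. 0)) (at 0)"
      by (rule has_derivative_transform_within_open[of "\<lambda>t. 2" _ _ _ "{-\<epsilon><..<\<epsilon>}"])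
        (use c(1,2) in \<open>auto simp: bowl_def image_subset_iff\<close>)
    ultimately have "(\<lambda>t. 2 * (N \<bullet> v) * t) = (\<lambda>t. 0)" by (rule has_derivative_unique)
    from fun_cong[OF this, of 1] show ?thesis by simp
  qed
  ultimately show ?thesis by (simp add: unit_normal_def norm_sgn sgn_div_norm)
qed

end

section \<open>Rays through the focal sphere\<close>

text \<open>A state \<open>(f, v)\<close> is a point of the focal sphere together with a direction.\<close>

definition focal :: "'a::real_inner \<Rightarrow> 'a \<times> 'a \<Rightarrow> bool" where
  "focal e s \<longleftrightarrow> fst s \<bullet> e = 0 \<and> fst s \<bullet> fst s = 1 \<and> snd s \<bullet> snd s = 1"

text \<open>The positive root of the quadratic equation \<open>ellipsoid_form e (f + d v) = 2\<close> in \<open>d\<close>.\<close>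

definition hit_distance :: "'a::real_inner \<Rightarrow> 'a \<times> 'a \<Rightarrow> real" where
  "hit_distance e s =
    (sqrt ((fst s \<bullet> snd s)\<^sup>2 + (1 + (snd s \<bullet> e)\<^sup>2)) - fst s \<bullet> snd s) / (1 + (snd s \<bullet> e)\<^sup>2)"

definition hit_point :: "'a::real_inner \<Rightarrow> 'a \<times> 'a \<Rightarrow> 'a" where
  "hit_point e s = fst s + hit_distance e s *\<^sub>R snd s"

text \<open>The distance to the second focal point, solved from the product relation of the two
  distances.\<close>

definition return_distance :: "'a::real_inner \<Rightarrow> 'a \<times> 'a \<Rightarrow> real" where
  "return_distance e s = (1 + (hit_point e s \<bullet> e)\<^sup>2) / hit_distance e s"

definition ellipsoid_normal :: "'a::real_inner \<Rightarrow> 'a \<Rightarrow> 'a" where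
  "ellipsoid_normal e y = y + (y \<bullet> e) *\<^sub>R e"

definition focal_step :: "'a::real_inner \<Rightarrow> 'a \<times> 'a \<Rightarrow> 'a \<times> 'a" where
  "focal_step e s = (let v' = reflect (ellipsoid_normal e (hit_point e s)) (snd s)
     in (hit_point e s + return_distance e s *\<^sub>R v', v'))"

lemma hit_distance:
  shows "hit_distance e s > 0"
    and "(hit_distance e s)\<^sup>2 * (1 + (snd s \<bullet> e)\<^sup>2) + 2 * hit_distance e s * (fst s \<bullet> snd s) = 1"
proof -
  define \<rho> where "\<rho> = fst s \<bullet> snd s"
  define a where "a = 1 + (snd s \<bullet> e)\<^sup>2"
  define S where "S = sqrt (\<rho>\<^sup>2 + a)"
  have a: "a > 0" by (simp add: a_def add_pos_nonneg)
  have S2: "S\<^sup>2 = \<rho>\<^sup>2 + a" unfolding S_def using a by simp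
  have d: "hit_distance e s = (S - \<rho>) / a" by (simp add: hit_distance_def S_def \<rho>_def a_def)
  have "\<rho> < S" unfolding S_def using a by (intro real_less_rsqrt) simp
  then show "hit_distance e s > 0" unfolding d using a by simp
  have "((S - \<rho>) / a)\<^sup>2 * a + 2 * ((S - \<rho>) / a) * \<rho> = (S\<^sup>2 - \<rho>\<^sup>2) / a"
    using a by (simp add: field_simps power2_eq_square)
  also have "\<dots> = 1" using a S2 by simp
  finally show "(hit_distance e s)\<^sup>2 * (1 + (snd s \<bullet> e)\<^sup>2) + 2 * hit_distance e s * (fst s \<bullet> snd s) = 1"
    unfolding d a_def[symmetric] \<rho>_def[symmetric] .
qed

text \<open>Along the ray the equation is quadratic with product of roots \<open>-1 / a\<close>,
  \<open>a\<close> being its leading coefficient; besides the hit distance there is only a root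
  behind the focal point.\<close>

lemma ellipsoid_form_on_ray:
  assumes "focal e s"
  shows "ellipsoid_form e (fst s + t *\<^sub>R snd s) - 2 =
    (t - hit_distance e s) * ((1 + (snd s \<bullet> e)\<^sup>2) * t + 1 / hit_distance e s)"
proof -
  define d where "d = hit_distance e s"
  define a where "a = 1 + (snd s \<bullet> e)\<^sup>2"
  have d: "d > 0" "d\<^sup>2 * a + 2 * d * (fst s \<bullet> snd s) = 1"
    using hit_distance[of e s] by (auto simp: d_def a_def)
  have "ellipsoid_form e (fst s + t *\<^sub>R snd s) - 2 = a * t\<^sup>2 + 2 * t * (fst s \<bullet> snd s) - 1"
    using assms unfolding ellipsoid_form_def focal_def a_def
    by (simp add: inner_add_left inner_add_right inner_commute algebra_simps power2_eq_square)
  moreover have "2 * (fst s \<bullet> snd s) = 1 / d - d * a" using d by (simp add: field_simps power2_eq_square)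
  ultimately have "ellipsoid_form e (fst s + t *\<^sub>R snd s) - 2 = a * t\<^sup>2 + t * (1 / d - d * a) - 1"
    by (metis mult.assoc mult.commute)
  also have "\<dots> = (t - d) * (a * t + 1 / d)"
    using d(1) by (simp add: field_simps power2_eq_square)
  finally show ?thesis by (simp add: d_def a_def)
qed

text \<open>The chord need not lie in a plane through the axis, so the focal property of a plane
  ellipse is not enough. Instead all inner products are expressed through the distance
  \<open>d\<close> and the height \<open>z\<close>, and the claims become identities in these two
  numbers.\<close>

lemma focal_step:
  fixes e :: "'a::euclidean_space"
  assumes e: "e \<bullet> e = 1" and s: "focal e s"
  defines "d \<equiv> hit_distance e s" and "y \<equiv> hit_point e s" and "s' \<equiv> focal_step e s"
  shows "focal e s'" "snd s' \<bullet> e = - (snd s \<bullet> e) * d\<^sup>2 / (1 + (y \<bullet> e)\<^sup>2)"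
    "fst s' \<bullet> snd s' = ((1 + (y \<bullet> e)\<^sup>2)\<^sup>2 - d\<^sup>2 * (1 - (y \<bullet> e)\<^sup>2)) / (2 * d * (1 + (y \<bullet> e)\<^sup>2))"
    "ellipsoid_form e y = 2" "y \<bullet> e = d * (snd s \<bullet> e)" "snd s \<bullet> ellipsoid_normal e y > 0"
    "snd s' = reflect (ellipsoid_normal e y) (snd s)" "fst s' = y + return_distance e s *\<^sub>R snd s'"
proof -
  define f v where "f = fst s" and "v = snd s"
  define z where "z = y \<bullet> e"
  define Q where "Q = 1 + z\<^sup>2"
  define N where "N = ellipsoid_normal e y"
  define \<rho> where "\<rho> = f \<bullet> v"
  have Q: "Q > 0" by (simp add: Q_def add_pos_nonneg)
  have fv: "f \<bullet> e = 0" "f \<bullet> f = 1" "v \<bullet> v = 1" using s by (auto simp: focal_def f_def v_def)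
  have d: "d > 0" using hit_distance(1)[of e s] by (simp add: d_def)
  have y: "y = f + d *\<^sub>R v" by (simp add: y_def hit_point_def f_def v_def d_def)
  have z: "z = d * (v \<bullet> e)" using fv by (simp add: z_def y inner_add_left)
  \<comment> \<open>The quadratic equation for \<open>d\<close>, read as an equation for the radial
    velocity \<rho>; it eliminates \<rho> from all that follows.\<close>
  have d2: "2 * d * \<rho> = 1 - d\<^sup>2 - z\<^sup>2"
    using hit_distance(2)[of e s] by (simp add: d_def[symmetric] f_def[symmetric] v_def[symmetric] \<rho>_def z power_mult_distrib algebra_simps)
  then have \<rho>: "\<rho> = (1 - d\<^sup>2 - z\<^sup>2) / (2 * d)" using d by (simp add: field_simps)
  have yy: "y \<bullet> y = 2 - z\<^sup>2"
    using d2 fv by (simp add: y inner_add_left inner_add_right inner_commute \<rho>_def power2_eq_square algebra_simps)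
  show "ellipsoid_form e y = 2" using yy by (simp add: ellipsoid_form_def z_def)
  show "y \<bullet> e = d * (snd s \<bullet> e)" using z by (simp add: z_def v_def)
  have N: "N = y + z *\<^sub>R e" by (simp add: N_def ellipsoid_normal_def z_def)
  have Ne: "N \<bullet> e = 2 * z" using e by (simp add: N inner_add_left z_def)
  have yN: "y \<bullet> N = 2" using yy by (simp add: N inner_add_right z_def power2_eq_square)
  have NN: "N \<bullet> N = 2 * Q"
    using yN Ne by (subst N) (simp add: inner_add_left inner_commute[of e] Q_def power2_eq_square)
  have vy: "v \<bullet> y = \<rho> + d" using fv by (simp add: y inner_add_right inner_commute \<rho>_def)
  have ve: "v \<bullet> e = z / d" using z d by simp
  have vN: "v \<bullet> N = (Q + d\<^sup>2) / (2 * d)"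
    using d by (simp add: N inner_add_right vy ve \<rho> Q_def field_simps power2_eq_square)
  then have vN0: "v \<bullet> N > 0" using d Q by (simp add: add_pos_nonneg)
  then show "snd s \<bullet> ellipsoid_normal e y > 0" by (simp add: v_def N_def)
  define v' where "v' = reflect N v"
  define k where "k = (Q + d\<^sup>2) / (2 * d * Q)"
  have "2 * (v \<bullet> N) / (N \<bullet> N) = k" using Q d by (simp add: vN NN k_def field_simps)
  then have v': "v' = v - k *\<^sub>R N" by (simp add: v'_def reflect_def)
  define d' where "d' = Q / d"
  have d': "d' = return_distance e s"
    by (simp add: d'_def return_distance_def Q_def z_def y_def d_def)
  have s': "s' = (y + d' *\<^sub>R v', v')"
    by (simp add: s'_def focal_step_def Let_def v'_def N_def y_def v_def d')
  show "snd s' = reflect (ellipsoid_normal e y) (snd s)" "fst s' = y + return_distance e s *\<^sub>R snd s'"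
    by (auto simp: s' v'_def N_def v_def d')
  have v'e: "v' \<bullet> e = - z * d / Q"
    using d Q by (simp add: v' inner_diff_left Ne ve k_def field_simps power2_eq_square)
  have "v' \<bullet> e = - (v \<bullet> e) * d\<^sup>2 / Q" using d by (simp add: v'e ve power2_eq_square)
  then show "snd s' \<bullet> e = - (snd s \<bullet> e) * d\<^sup>2 / (1 + (y \<bullet> e)\<^sup>2)"
    by (simp add: s' Q_def z_def v_def)
  have v'v': "v' \<bullet> v' = 1" using norm_reflect[of N v] fv(3) by (simp add: v'_def norm_eq_sqrt_inner)
  have "y \<bullet> v = (1 + d\<^sup>2 - z\<^sup>2) / (2 * d)"
    using d vy by (simp add: inner_commute \<rho> field_simps power2_eq_square)
  moreover have "k * 2 = (Q + d\<^sup>2) / (d * Q)" using d Q by (simp add: k_def field_simps)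
  ultimately have yv': "y \<bullet> v' = (1 + d\<^sup>2 - z\<^sup>2) / (2 * d) - (Q + d\<^sup>2) / (d * Q)"
    by (simp add: v' inner_diff_right yN)
  have f'e: "(y + d' *\<^sub>R v') \<bullet> e = 0"
    using d Q by (simp add: inner_add_left v'e d'_def z_def[symmetric])
  have "(y + d' *\<^sub>R v') \<bullet> (y + d' *\<^sub>R v') = 2 - z\<^sup>2 + 2 * d' * (y \<bullet> v') + d'\<^sup>2"
    by (simp add: inner_add_left inner_add_right yy v'v' inner_commute power2_eq_square)
  also have "\<dots> = 1"
  proof -
    have "d\<^sup>2 * (2 - z\<^sup>2 + 2 * d' * (y \<bullet> v') + d'\<^sup>2) =
      (2 - z\<^sup>2) * d\<^sup>2 + Q * (1 + d\<^sup>2 - z\<^sup>2) - 2 * (Q + d\<^sup>2) + Q\<^sup>2"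
      using d Q by (simp add: d'_def yv' field_simps power2_eq_square)
    also have "\<dots> = d\<^sup>2" by (simp add: Q_def algebra_simps power2_eq_square)
    finally show ?thesis using d by simp
  qed
  finally have "(y + d' *\<^sub>R v') \<bullet> (y + d' *\<^sub>R v') = 1" .
  then show "focal e s'" using f'e v'v' by (simp add: focal_def s')
  have "(y + d' *\<^sub>R v') \<bullet> v' = y \<bullet> v' + d'" by (simp add: inner_add_left v'v')
  also have "\<dots> = (Q\<^sup>2 - d\<^sup>2 * (1 - z\<^sup>2)) / (2 * d * Q)"
  proof -
    have "2 * d * Q * (y \<bullet> v' + d') = Q * (1 + d\<^sup>2 - z\<^sup>2) - 2 * (Q + d\<^sup>2) + 2 * Q\<^sup>2"
      using d Q by (simp add: d'_def yv' field_simps power2_eq_square)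
    also have "\<dots> = Q\<^sup>2 - d\<^sup>2 * (1 - z\<^sup>2)" by (simp add: Q_def algebra_simps power2_eq_square)
    finally show ?thesis using d Q by (simp add: field_simps)
  qed
  finally show "fst s' \<bullet> snd s' = ((1 + (y \<bullet> e)\<^sup>2)\<^sup>2 - d\<^sup>2 * (1 - (y \<bullet> e)\<^sup>2)) / (2 * d * (1 + (y \<bullet> e)\<^sup>2))"
    by (simp add: s' Q_def z_def)
qed

section \<open>An invariant condition on focal rays\<close>

text \<open>The condition that reproduces itself. A nonzero slope is demanded because it makes the
  next hit distance, and with the bound 1/2 the next height, strictly small: the rim is never
  touched.\<close>

definition outward :: "'a::real_inner \<Rightarrow> 'a \<times> 'a \<Rightarrow> bool" where
  "outward e s \<longleftrightarrow> focal e s \<and> 0 \<le> fst s \<bullet> snd s \<and> snd s \<bullet> e \<noteq> 0 \<and> \<bar>snd s \<bullet> e\<bar> \<le> 1/2"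

definition entering :: "'a::real_inner \<Rightarrow> 'a \<times> 'a \<Rightarrow> bool" where
  "entering e s \<longleftrightarrow> focal e s \<and> snd s \<bullet> e < 0 \<and> (snd s \<bullet> e)\<^sup>2 > 99/100"

text \<open>With Q = 1 + z^2 the new slope is minus the old one times d^2/Q, so the last assumption
  says exactly that it is at most 1/2. Outwardness reduces to d^2 (1 - z^2) <= 1 <= Q^2, and the
  return distance is Q/d.\<close>

lemma focal_step_outwardI:
  fixes e :: "'a::euclidean_space"
  assumes e: "e \<bullet> e = 1" and s: "focal e s" and "snd s \<bullet> e \<noteq> 0" and d1: "hit_distance e s \<le> 1"
    and "\<bar>snd s \<bullet> e\<bar> * (hit_distance e s)\<^sup>2 \<le> (1 + (hit_point e s \<bullet> e)\<^sup>2) / 2"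
  shows "outward e (focal_step e s)" "1 \<le> return_distance e s"
proof -
  note st = focal_step[OF e s]
  define d where "d = hit_distance e s"
  define Q where "Q = 1 + (hit_point e s \<bullet> e)\<^sup>2"
  have d: "d > 0" "d \<le> 1" "d\<^sup>2 \<le> 1" using hit_distance(1)[of e s] d1 by (auto simp: d_def power_le_one)
  have Q: "Q \<ge> 1" by (simp add: Q_def)
  have "d\<^sup>2 * (1 - (hit_point e s \<bullet> e)\<^sup>2) \<le> d\<^sup>2 * 1"
    by (intro mult_left_mono) auto
  also have "\<dots> \<le> Q\<^sup>2" using d(3) one_le_power[OF Q, of 2] by linarith
  finally have "0 \<le> fst (focal_step e s) \<bullet> snd (focal_step e s)"
    unfolding st(3) d_def[symmetric] Q_def[symmetric] using d Q by (intro divide_nonneg_nonneg) auto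
  moreover have z: "snd (focal_step e s) \<bullet> e = - (snd s \<bullet> e) * d\<^sup>2 / Q"
    using st(2) by (simp add: d_def Q_def)
  then have "snd (focal_step e s) \<bullet> e \<noteq> 0" using assms(3) d Q by auto
  moreover have "\<bar>snd (focal_step e s) \<bullet> e\<bar> \<le> 1/2"
    using assms(5) Q unfolding z d_def[symmetric] Q_def[symmetric]
    by (simp add: abs_mult field_simps)
  ultimately show "outward e (focal_step e s)" using st(1) by (simp add: outward_def)
  show "1 \<le> return_distance e s"
    unfolding return_distance_def d_def[symmetric] Q_def[symmetric] using d Q by (simp add: field_simps)
qed

text \<open>For an outward ray the linear term of the quadratic equation is nonnegative, which
  leaves d^2 (1 + slope^2) <= 1.\<close>

lemma outward_hit:
  assumes "outward e s"
  shows "hit_distance e s \<le> 1" "\<bar>hit_distance e s * (snd s \<bullet> e)\<bar> < 1/2"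
proof -
  define d where "d = hit_distance e s"
  have d: "d > 0" "d\<^sup>2 * (1 + (snd s \<bullet> e)\<^sup>2) + 2 * d * (fst s \<bullet> snd s) = 1"
    using hit_distance[of e s] by (auto simp: d_def)
  have "0 \<le> 2 * d * (fst s \<bullet> snd s)" using d(1) assms by (simp add: outward_def)
  then have "d\<^sup>2 + d\<^sup>2 * (snd s \<bullet> e)\<^sup>2 \<le> 1" using d(2) by (simp add: algebra_simps)
  moreover have "d\<^sup>2 * (snd s \<bullet> e)\<^sup>2 > 0" using d(1) assms by (simp add: outward_def)
  ultimately have "d\<^sup>2 < 1" by linarith
  then have d1: "d < 1" using power2_less_imp_less[of d 1] by simp
  then show "hit_distance e s \<le> 1" by (simp add: d_def)
  have "d * \<bar>snd s \<bullet> e\<bar> < 1 * \<bar>snd s \<bullet> e\<bar>"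
    using d1 assms by (intro mult_strict_right_mono) (auto simp: outward_def)
  moreover have "\<bar>snd s \<bullet> e\<bar> \<le> 1/2" using assms by (simp add: outward_def)
  moreover have "\<bar>hit_distance e s * (snd s \<bullet> e)\<bar> = d * \<bar>snd s \<bullet> e\<bar>"
    using d(1) by (simp add: d_def[symmetric] abs_mult)
  ultimately show "\<bar>hit_distance e s * (snd s \<bullet> e)\<bar> < 1/2" by linarith
qed

lemma outward_step:
  fixes e :: "'a::euclidean_space"
  assumes e: "e \<bullet> e = 1" and s: "outward e s"
  shows "outward e (focal_step e s)" "1 \<le> return_distance e s"
proof -
  have f: "focal e s" "snd s \<bullet> e \<noteq> 0" "\<bar>snd s \<bullet> e\<bar> \<le> 1/2" using s by (auto simp: outward_def)
  have "\<bar>snd s \<bullet> e\<bar> * (hit_distance e s)\<^sup>2 \<le> (1/2) * 1"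
    using f(3) outward_hit(1)[OF s] hit_distance(1)[of e s]
    by (intro mult_mono) (auto simp: power_le_one)
  also have "\<dots> \<le> (1 + (hit_point e s \<bullet> e)\<^sup>2) / 2" by simp
  finally show "outward e (focal_step e s)" "1 \<le> return_distance e s"
    using focal_step_outwardI[OF e f(1,2) outward_hit(1)[OF s]] by auto
qed

lemma focal_radial_velocity:
  fixes e :: "'a::euclidean_space"
  assumes "e \<bullet> e = 1" "focal e s"
  shows "(fst s \<bullet> snd s)\<^sup>2 \<le> 1 - (snd s \<bullet> e)\<^sup>2"
proof -
  define w where "w = snd s - (snd s \<bullet> e) *\<^sub>R e"
  have "fst s \<bullet> w = fst s \<bullet> snd s" using assms by (simp add: w_def focal_def inner_diff_right)
  moreover have "w \<bullet> w = 1 - (snd s \<bullet> e)\<^sup>2"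
    using assms by (simp add: w_def focal_def inner_diff_right inner_diff_left inner_commute power2_eq_square)
  ultimately show ?thesis
    using Cauchy_Schwarz_ineq[of "fst s" w] assms(2) by (simp add: focal_def)
qed

text \<open>For a nearly vertical ray the equation is close to 2 t^2 = 1, with root about 0.707. The
  sign of \<open>r\<close> is left open so that the bounds cover the hit point below as well as,
  with \<open>-t\<close>, the intersection above.\<close>

lemma entering_bounds:
  fixes e :: "'a::euclidean_space"
  assumes e: "e \<bullet> e = 1" and s: "entering e s"
    and t: "t > 0" "t\<^sup>2 * (1 + (snd s \<bullet> e)\<^sup>2) + 2 * t * r = 1" "\<bar>r\<bar> = \<bar>fst s \<bullet> snd s\<bar>"
  shows "65/100 \<le> t" "t \<le> 78/100"
proof -
  have f: "focal e s" "(snd s \<bullet> e)\<^sup>2 > 99/100" using s by (auto simp: entering_def)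
  have "(fst s \<bullet> snd s)\<^sup>2 < (1/10)\<^sup>2"
    using focal_radial_velocity[OF e f(1)] f(2) by (simp add: power2_eq_square)
  then have r: "\<bar>r\<bar> < 1/10" unfolding t(3)
    using power2_less_imp_less[of "\<bar>fst s \<bullet> snd s\<bar>" "1/10"] by simp
  have z1: "(snd s \<bullet> e)\<^sup>2 \<le> 1"
    using focal_radial_velocity[OF e f(1)] zero_le_power2[of "fst s \<bullet> snd s"] by linarith
  have tr: "\<bar>2 * t * r\<bar> \<le> t / 5"
    using t(1) r by (simp add: abs_mult)
  show "65/100 \<le> t"
  proof (rule ccontr)
    assume "\<not> ?thesis"
    then have tl: "t < 65/100" by simp
    have "t\<^sup>2 * (1 + (snd s \<bullet> e)\<^sup>2) \<le> t\<^sup>2 * 2" using z1 by (intro mult_left_mono) auto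
    moreover have "t\<^sup>2 \<le> (65/100)\<^sup>2" using tl t(1) by (intro power_mono) auto
    then have "t\<^sup>2 * 2 \<le> 845/1000" by (simp add: power2_eq_square)
    ultimately show False using t(2) tr tl by linarith
  qed
  show "t \<le> 78/100"
  proof (rule ccontr)
    assume "\<not> ?thesis"
    then have tl: "78/100 < t" by simp
    have "t\<^sup>2 * (199/100) \<le> t\<^sup>2 * (1 + (snd s \<bullet> e)\<^sup>2)" using f(2) by (intro mult_left_mono) auto
    moreover have "(78/100) * t \<le> t\<^sup>2" using tl t(1) by (simp add: power2_eq_square)
    ultimately show False using t(2) tr tl by linarith
  qed
qed

lemma entering_step:
  fixes e :: "'a::euclidean_space"
  assumes e: "e \<bullet> e = 1" and s: "entering e s"
  shows "outward e (focal_step e s)" "1 \<le> return_distance e s" "hit_point e s \<bullet> e < 0"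
    "\<And>t. t \<le> 0 \<Longrightarrow> fst s + t *\<^sub>R snd s \<notin> bowl e"
proof -
  have f: "focal e s" "snd s \<bullet> e < 0" "(snd s \<bullet> e)\<^sup>2 > 99/100" using s by (auto simp: entering_def)
  define d where "d = hit_distance e s"
  have d: "d > 0" "65/100 \<le> d" "d \<le> 78/100"
    using entering_bounds[OF e s hit_distance refl] hit_distance(1)[of e s] by (auto simp: d_def)
  have he: "hit_point e s \<bullet> e = d * (snd s \<bullet> e)" using focal_step(5)[OF e f(1)] by (simp add: d_def)
  show "hit_point e s \<bullet> e < 0" unfolding he using d(1) f(2) by (simp add: mult_pos_neg)
  have z1: "(snd s \<bullet> e)\<^sup>2 \<le> 1"
    using focal_radial_velocity[OF e f(1)] zero_le_power2[of "fst s \<bullet> snd s"] by linarith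
  then have za: "\<bar>snd s \<bullet> e\<bar> \<le> 1" by (simp add: abs_square_le_1)
  have dd: "(65/100)\<^sup>2 \<le> d\<^sup>2" "d\<^sup>2 \<le> (78/100)\<^sup>2" using d by (auto intro!: power_mono)
  \<comment> \<open>Numerically 0.6084 against about 0.709: the first reflection already brings the
    slope below 1/2.\<close>
  have "\<bar>snd s \<bullet> e\<bar> * d\<^sup>2 \<le> 1 * (78/100)\<^sup>2" using za dd by (intro mult_mono) auto
  also have "\<dots> \<le> (1 + (65/100)\<^sup>2 * (99/100)) / 2" by (simp add: power2_eq_square)
  also have "(65/100)\<^sup>2 * (99/100) \<le> d\<^sup>2 * (snd s \<bullet> e)\<^sup>2" using f(3) dd by (intro mult_mono) auto
  finally have "\<bar>snd s \<bullet> e\<bar> * d\<^sup>2 \<le> (1 + (hit_point e s \<bullet> e)\<^sup>2) / 2" by (simp add: he power_mult_distrib)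
  then show "outward e (focal_step e s)" "1 \<le> return_distance e s"
    using focal_step_outwardI[OF e f(1)] f(2) d by (auto simp: d_def)
  \<comment> \<open>Traced back, the ray meets the ellipsoid only at a height of at least 0.65 times
    0.99, which exceeds 1/2: this is inside the removed cap.\<close>
  show "fst s + t *\<^sub>R snd s \<notin> bowl e" if "t \<le> 0" for t
  proof
    assume b: "fst s + t *\<^sub>R snd s \<in> bowl e"
    have q: "t\<^sup>2 * (1 + (snd s \<bullet> e)\<^sup>2) + 2 * t * (fst s \<bullet> snd s) = 1"
      using b f(1) unfolding bowl_def ellipsoid_form_def focal_def
      by (simp add: inner_add_left inner_add_right inner_commute power2_eq_square algebra_simps)
    then have "t \<noteq> 0" by auto
    then have "- t > 0" using that by simp
    then have "65/100 \<le> - t" using entering_bounds(1)[OF e s, of "-t" "- (fst s \<bullet> snd s)"] q by simp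
    moreover have "99/100 \<le> \<bar>snd s \<bullet> e\<bar>"
    proof (rule ccontr)
      assume "\<not> ?thesis"
      then have "\<bar>snd s \<bullet> e\<bar>\<^sup>2 \<le> (99/100)\<^sup>2" by (intro power_mono) auto
      then show False using f(3) by (simp add: power2_eq_square)
    qed
    then have "99/100 \<le> - (snd s \<bullet> e)" using f(2) by simp
    ultimately have "(65/100) * (99/100) \<le> (- t) * (- (snd s \<bullet> e))" by (intro mult_mono) auto
    moreover have "(fst s + t *\<^sub>R snd s) \<bullet> e = t * (snd s \<bullet> e)"
      using f(1) by (simp add: focal_def inner_add_left)
    ultimately show False using b by (simp add: bowl_def)
  qed
qed

definition line_of_state :: "'a::real_inner \<times> 'a \<Rightarrow> 'a \<times> 'a" where
  "line_of_state s = (snd s, fst s - (fst s \<bullet> snd s) *\<^sub>R snd s)"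

text \<open>The trajectory is glued from the chords of the iterated \<open>focal_step\<close>:
  \<open>f k\<close> is the focal point passed at time \<open>T k\<close>, and \<open>P k\<close> is
  the mirror point reached at time \<open>\<tau> k\<close>.\<close>

theorem entering_ray_trapped:
  fixes e :: "'a::euclidean_space"
  assumes ne: "norm e = 1" and s: "entering e s"
  shows "\<exists>\<gamma>. nonsingular_trajectory {bowl e} \<gamma> \<and> comes_from_infinity_along (line_of_state s) \<gamma> \<and>
    enters_and_remains_in (cball 0 2) \<gamma>"
proof -
  have e: "e \<bullet> e = 1" using ne by (simp add: norm_eq_1)
  define st where "st k = (focal_step e ^^ k) s" for k
  define f where "f k = fst (st k)" for k
  define v where "v k = snd (st k)" for k
  define d where "d k = hit_distance e (st k)" for k
  define g where "g k = return_distance e (st k)" for k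
  define P where "P k = hit_point e (st k)" for k
  have st0: "st 0 = s" and stS: "st (Suc k) = focal_step e (st k)" for k by (auto simp: st_def)
  have out: "outward e (st (Suc k)) \<and> 1 \<le> g k" for k
  proof (induction k)
    case 0
    then show ?case using entering_step(1,2)[OF e s] by (simp add: stS st0 g_def)
  next
    case (Suc k)
    then show ?case using outward_step[OF e, of "st (Suc k)"] by (simp add: stS[of "Suc k"] g_def)
  qed
  have foc: "focal e (st k)" for k
    using s out[of "k - 1"] by (cases k) (auto simp: st0 entering_def outward_def)
  have d0: "d k > 0" for k unfolding d_def by (rule hit_distance)
  have g1: "1 \<le> g k" for k using out by blast
  have nv: "norm (v k) = 1" for k using foc[of k] by (simp add: focal_def v_def norm_eq_1)
  have P: "P k = f k + d k *\<^sub>R v k" for k by (simp add: P_def hit_point_def f_def d_def v_def)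
  note step = focal_step[OF e foc]
  have f_next: "f (Suc k) = P k + g k *\<^sub>R v (Suc k)" for k
    using step(8)[of k] by (simp add: f_def stS P_def g_def v_def)
  have v_next: "v (Suc k) = reflect (ellipsoid_normal e (P k)) (v k)" for k
    using step(7)[of k] by (simp add: v_def stS P_def)
  have P_height: "P k \<bullet> e < 1/2" for k
  proof (cases k)
    case 0
    then show ?thesis using entering_step(3)[OF e s] by (simp add: P_def st0)
  next
    case (Suc j)
    then show ?thesis
      using outward_hit(2)[of e "st k"] out[of j] step(5)[of k] by (auto simp: P_def)
  qed
  have qP: "ellipsoid_form e (P k) = 2" for k using step(4)[of k] by (simp add: P_def)
  have P_bowl: "P k \<in> bowl e" for k using qP P_height[of k] by (simp add: bowl_def)
  \<comment> \<open>The initial value is the arc length from the base point of the line, its point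
    nearest the origin, to the first focal point.\<close>
  define T where "T = rec_nat (fst s \<bullet> snd s) (\<lambda>k t. t + d k + g k)"
  have T0: "T 0 = fst s \<bullet> snd s" and TS: "T (Suc k) = T k + d k + g k" for k by (auto simp: T_def)
  define \<tau> where "\<tau> k = T k + d k" for k
  define A where "A k t = f k + (t - T k) *\<^sub>R v k" for k t
  have A_hit: "A k (\<tau> k) = P k" "A (Suc k) (\<tau> k) = P k" for k
    by (auto simp: A_def \<tau>_def P f_next TS algebra_simps)
  have A_shift: "A k t = A k u + (t - u) *\<^sub>R v k" for k t u by (simp add: A_def algebra_simps)
  \<comment> \<open>Return distances of at least 1 separate the collisions; this excludes
    accumulation and lets the chords exhaust all times.\<close>
  have \<tau>S: "\<tau> k + 1 \<le> \<tau> (Suc k)" for k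
    using g1[of k] d0[of "Suc k"] by (simp add: \<tau>_def TS)
  have \<tau>_add: "\<tau> j + real i \<le> \<tau> (j + i)" for i j
  proof (induction i)
    case (Suc i)
    then show ?case using \<tau>S[of "j + i"] by simp
  qed simp
  have \<tau>_mono: "\<tau> j \<le> \<tau> k" if "j \<le> k" for j k
    using \<tau>_add[of j "k - j"] that by simp
  \<comment> \<open>At a collision time the earlier chord is selected; by \<open>A_hit\<close> both
    adjacent chords give the same point.\<close>
  define \<gamma> where "\<gamma> t = A (LEAST k. t \<le> \<tau> k) t" for t
  have \<gamma>0: "\<gamma> t = A 0 t" if "t \<le> \<tau> 0" for t
  proof -
    have "(LEAST k. t \<le> \<tau> k) = 0" using that by (rule Least_eq_0)
    then show ?thesis by (simp add: \<gamma>_def)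
  qed
  have \<gamma>S: "\<gamma> t = A (Suc k) t" if "\<tau> k \<le> t" "t \<le> \<tau> (Suc k)" for t k
  proof (cases "t = \<tau> k")
    case True
    have "(LEAST j. t \<le> \<tau> j) = k"
    proof (rule Least_equality)
      fix j assume "t \<le> \<tau> j"
      show "k \<le> j"
      proof (rule ccontr)
        assume "\<not> k \<le> j"
        then have "\<tau> (Suc j) \<le> \<tau> k" by (intro \<tau>_mono) simp
        then show False using \<tau>S[of j] \<open>t \<le> \<tau> j\<close> True by simp
      qed
    qed (use True in simp)
    then show ?thesis using A_hit[of k] True by (simp add: \<gamma>_def)
  next
    case False
    have "(LEAST j. t \<le> \<tau> j) = Suc k"
    proof (rule Least_equality)
      fix j assume "t \<le> \<tau> j"
      show "Suc k \<le> j"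
      proof (rule ccontr)
        assume "\<not> Suc k \<le> j"
        then have "\<tau> j \<le> \<tau> k" by (intro \<tau>_mono) simp
        then show False using False that(1) \<open>t \<le> \<tau> j\<close> by simp
      qed
    qed (use that in simp)
    then show ?thesis by (simp add: \<gamma>_def)
  qed
  have time_cases: thesis
    if "t < \<tau> 0 \<Longrightarrow> thesis" "\<And>k. t = \<tau> k \<Longrightarrow> thesis" "\<And>k. \<tau> k < t \<Longrightarrow> t < \<tau> (Suc k) \<Longrightarrow> thesis"
    for t thesis
  proof -
    obtain n :: nat where "t - \<tau> 0 \<le> real n" using real_arch_simple by blast
    then have ex: "t \<le> \<tau> n" using \<tau>_add[of 0 n] by simp
    define k where "k = (LEAST k. t \<le> \<tau> k)"
    have k: "t \<le> \<tau> k" unfolding k_def using ex by (rule LeastI)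
    show thesis
    proof (cases "t = \<tau> k")
      case True
      then show ?thesis by (rule that(2))
    next
      case False
      then have lt: "t < \<tau> k" using k by simp
      show ?thesis
      proof (cases k)
        case 0
        then show ?thesis using lt that(1) by simp
      next
        case (Suc j)
        have "\<not> t \<le> \<tau> j" using not_less_Least[of j "\<lambda>k. t \<le> \<tau> k"] Suc by (simp add: k_def)
        then show ?thesis using lt Suc that(3)[of j] by simp
      qed
    qed
  qed
  have form_A: "ellipsoid_form e (A k t) - 2 = (t - \<tau> k) * ((1 + (v k \<bullet> e)\<^sup>2) * (t - T k) + 1 / d k)" for k t
    using ellipsoid_form_on_ray[OF foc[of k], of "t - T k"]
    by (simp add: A_def f_def v_def d_def \<tau>_def algebra_simps)
  \<comment> \<open>The chord starts at \<open>P k\<close> on the ellipsoid, so the second linear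
    factor vanishes at \<open>\<tau> k\<close>. It is positive afterwards, while the first is
    negative until \<open>\<tau> (Suc k)\<close>.\<close>
  have inside_S: "ellipsoid_form e (A (Suc k) t) < 2" if t: "\<tau> k < t" "t < \<tau> (Suc k)" for k t
  proof -
    define a where "a = 1 + (v (Suc k) \<bullet> e)\<^sup>2"
    have a: "a > 0" by (simp add: a_def add_pos_nonneg)
    have "(\<tau> k - \<tau> (Suc k)) * (a * (\<tau> k - T (Suc k)) + 1 / d (Suc k)) = 0"
      using form_A[of "Suc k" "\<tau> k"] qP[of k] by (simp add: A_hit a_def)
    then have "a * (\<tau> k - T (Suc k)) + 1 / d (Suc k) = 0" using \<tau>S[of k] by simp
    moreover have "a * (\<tau> k - T (Suc k)) < a * (t - T (Suc k))" using a t by simp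
    ultimately have "a * (t - T (Suc k)) + 1 / d (Suc k) > 0" by linarith
    then have "(t - \<tau> (Suc k)) * (a * (t - T (Suc k)) + 1 / d (Suc k)) < 0"
      using t by (simp add: mult_neg_pos)
    then show ?thesis using form_A[of "Suc k" t] by (simp add: a_def)
  qed
  \<comment> \<open>Before the focal point the ray passes through the hole; between the focal point
    and the first hit it is inside the ellipsoid.\<close>
  have free0: "A 0 t \<notin> bowl e" if t: "t < \<tau> 0" for t
  proof (cases "t \<le> T 0")
    case True
    then show ?thesis using entering_step(4)[OF e s, of "t - T 0"] by (simp add: A_def f_def v_def st0)
  next
    case False
    have "(1 + (v 0 \<bullet> e)\<^sup>2) * (t - T 0) > 0" using False by (intro mult_pos_pos) (auto simp: add_pos_nonneg)
    then have "(1 + (v 0 \<bullet> e)\<^sup>2) * (t - T 0) + 1 / d 0 > 0" using d0[of 0] by (simp add: add_pos_pos)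
    then have "(t - \<tau> 0) * ((1 + (v 0 \<bullet> e)\<^sup>2) * (t - T 0) + 1 / d 0) < 0"
      using t by (simp add: mult_neg_pos)
    then show ?thesis using form_A[of 0 t] by (simp add: bowl_def)
  qed
  have hits: "\<gamma> t \<in> bowl e \<longleftrightarrow> t \<in> range \<tau>" for t
  proof
    assume "t \<in> range \<tau>"
    then obtain k where "t = \<tau> k" by blast
    then show "\<gamma> t \<in> bowl e" using \<gamma>S[of k t] \<tau>S[of k] A_hit[of k] P_bowl[of k] by simp
  next
    assume h: "\<gamma> t \<in> bowl e"
    show "t \<in> range \<tau>"
    proof (rule time_cases[of t])
      assume "t < \<tau> 0"
      then show ?thesis using h free0[of t] \<gamma>0[of t] by simp
    next
      fix k assume "\<tau> k < t" "t < \<tau> (Suc k)"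
      then show ?thesis using h inside_S[of k t] \<gamma>S[of k t] by (simp add: bowl_def)
    qed auto
  qed
  have free: "moves_freely \<gamma> t" if "\<gamma> t \<notin> bowl e" for t
  proof (rule time_cases[of t])
    assume t: "t < \<tau> 0"
    have "\<forall>\<^sub>F s in nhds t. s < \<tau> 0" using t by (intro eventually_nhds_in_open[of "{..<\<tau> 0}", simplified])
    then have "\<forall>\<^sub>F s in nhds t. \<gamma> s = \<gamma> t + (s - t) *\<^sub>R v 0"
    proof eventually_elim
      case (elim s)
      then show ?case using A_shift[of 0 s t] \<gamma>0[of s] \<gamma>0[of t] t by simp
    qed
    then show ?thesis using nv unfolding moves_freely_def by blast
  next
    fix k assume t: "\<tau> k < t" "t < \<tau> (Suc k)"
    then have "t \<in> {\<tau> k<..<\<tau> (Suc k)}" by simp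
    then have "\<forall>\<^sub>F s in nhds t. s \<in> {\<tau> k<..<\<tau> (Suc k)}" by (intro eventually_nhds_in_open) auto
    then have "\<forall>\<^sub>F s in nhds t. \<gamma> s = \<gamma> t + (s - t) *\<^sub>R v (Suc k)"
    proof eventually_elim
      case (elim s)
      then show ?case using A_shift[of "Suc k" s t] \<gamma>S[of k s] \<gamma>S[of k t] t by simp
    qed
    then show ?thesis using nv unfolding moves_freely_def by blast
  next
    fix k assume "t = \<tau> k"
    then show ?thesis using that hits[of t] by blast
  qed
  have coll: "reflects_transversally (bowl e) \<gamma> (\<tau> k)" for k
    unfolding reflects_transversally_def
  proof (intro exI conjI)
    define N where "N = ellipsoid_normal e (P k)"
    have \<gamma>P: "\<gamma> (\<tau> k) = P k" using \<gamma>S[of k "\<tau> k"] \<tau>S[of k] A_hit[of k] by simp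
    show "norm (v k) = 1" by (rule nv)
    show un: "unit_normal (bowl e) (\<gamma> (\<tau> k)) (sgn N)"
      using bowl_normal[OF ne P_bowl[of k]] \<gamma>P by (simp add: N_def ellipsoid_normal_def)
    have pos: "v k \<bullet> N > 0" using step(6)[of k] by (simp add: v_def N_def P_def)
    then have "N \<noteq> 0" by auto
    then show "v k \<bullet> sgn N \<noteq> 0" using pos by (simp add: sgn_div_norm)
    have "reflect (sgn N) (v k) = reflect N (v k)"
      using \<open>N \<noteq> 0\<close> by (simp add: sgn_div_norm reflect_scaleR)
    moreover have "reflect (sgn N) (v k) = v k - (2 * (v k \<bullet> sgn N)) *\<^sub>R sgn N"
      using un by (intro reflect_unit) (simp add: unit_normal_def)
    ultimately have vS: "v (Suc k) = v k - (2 * (v k \<bullet> sgn N)) *\<^sub>R sgn N"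
      by (simp add: v_next N_def)
    have left: "\<gamma> t = \<gamma> (\<tau> k) + (t - \<tau> k) *\<^sub>R v k" if "\<tau> k - 1 < t" "t < \<tau> k" for t
    proof -
      have "\<gamma> t = A k t"
      proof (cases k)
        case 0
        then show ?thesis using \<gamma>0[of t] that by simp
      next
        case (Suc j)
        then show ?thesis using \<gamma>S[of j t] \<tau>S[of j] that by simp
      qed
      then show ?thesis using A_shift[of k t "\<tau> k"] A_hit \<gamma>P by simp
    qed
    show "\<forall>\<^sub>F t in at_left (\<tau> k). \<gamma> t = \<gamma> (\<tau> k) + (t - \<tau> k) *\<^sub>R v k"
      using eventually_at_left_real[of "\<tau> k - 1" "\<tau> k"] left by (auto elim: eventually_mono)
    have right: "\<gamma> t = \<gamma> (\<tau> k) + (t - \<tau> k) *\<^sub>R v (Suc k)" if "\<tau> k < t" "t < \<tau> (Suc k)" for t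
      using \<gamma>S[of k t] A_shift[of "Suc k" t "\<tau> k"] A_hit \<gamma>P that by simp
    show "\<forall>\<^sub>F t in at_right (\<tau> k). \<gamma> t = \<gamma> (\<tau> k) + (t - \<tau> k) *\<^sub>R (v k - (2 * (v k \<bullet> sgn N)) *\<^sub>R sgn N)"
      unfolding vS[symmetric]
      using eventually_at_right_real[of "\<tau> k" "\<tau> (Suc k)"] \<tau>S[of k] right by (auto elim: eventually_mono)
  qed
  have "nonsingular_trajectory {bowl e} \<gamma>"
    unfolding nonsingular_trajectory_def
  proof (intro conjI allI ballI impI)
    fix t assume "\<gamma> t \<notin> \<Union>{bowl e}"
    then show "moves_freely \<gamma> t" using free by simp
  next
    fix t M assume M: "M \<in> {bowl e}" "\<gamma> t \<in> M"
    then obtain k where k: "t = \<tau> k" using hits by blast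
    then have "\<gamma> t = P k" using \<gamma>S[of k t] \<tau>S[of k] A_hit[of k] by simp
    then have int: "\<gamma> t \<in> mirror_interior M"
      using bowl_interior[OF ne P_bowl P_height] M(1) by simp
    then show "\<gamma> t \<in> mirror_interior M" .
    show "\<gamma> t \<notin> mirror_boundary M"
      using int manifold_interior_boundary_disjoint unfolding mirror_interior_def mirror_boundary_def by blast
    show "M' = M" if "M' \<in> {bowl e}" for M' using that M by simp
    show "reflects_transversally M \<gamma> t" using coll k M by simp
  next
    fix a b :: real
    obtain n :: nat where n: "b - \<tau> 0 \<le> real n" using real_arch_simple by blast
    have "{t \<in> {a..b}. \<gamma> t \<in> \<Union>{bowl e}} \<subseteq> \<tau> ` {..n}"
    proof
      fix t assume "t \<in> {t \<in> {a..b}. \<gamma> t \<in> \<Union>{bowl e}}"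
      then obtain k where k: "t = \<tau> k" "t \<le> b" using hits by auto
      then have "real k \<le> real n" using \<tau>_add[of 0 k] n by simp
      then show "t \<in> \<tau> ` {..n}" using k by simp
    qed
    then show "finite {t \<in> {a..b}. \<gamma> t \<in> \<Union>{bowl e}}" by (rule finite_subset) simp
  qed
  moreover have line0: "A 0 t = snd (line_of_state s) + t *\<^sub>R fst (line_of_state s)" for t
    by (simp add: A_def f_def v_def st0 T0 line_of_state_def algebra_simps)
  then have "comes_from_infinity_along (line_of_state s) \<gamma>"
    unfolding comes_from_infinity_along_def eventually_at_bot_linorder using \<gamma>0 by metis
  moreover have "enters_and_remains_in (cball 0 2) \<gamma>"
  proof -
    define p where "p = snd (line_of_state s)"
    have fs: "fst s \<bullet> fst s = 1" "snd s \<bullet> snd s = 1" using s by (auto simp: entering_def focal_def)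
    have pp: "p \<bullet> p = 1 - (T 0)\<^sup>2" and pv: "p \<bullet> v 0 = 0"
      using fs by (auto simp: p_def line_of_state_def T0 v_def st0 inner_diff_left inner_diff_right inner_commute power2_eq_square)
    have A0: "(norm (A 0 t))\<^sup>2 = p \<bullet> p + t\<^sup>2" for t
    proof -
      have "A 0 t = p + t *\<^sub>R v 0" unfolding line0 by (simp add: p_def line_of_state_def v_def st0)
      then show ?thesis
        unfolding power2_norm_eq_inner using pv nv[of 0]
        by (simp add: inner_add_left inner_add_right inner_commute norm_eq_1 power2_eq_square)
    qed
    have ell: "(norm y)\<^sup>2 \<le> 2" if "ellipsoid_form e y \<le> 2" for y
      using that zero_le_power2[of "y \<bullet> e"] unfolding ellipsoid_form_def power2_norm_eq_inner by linarith
    have \<tau>0: "(\<tau> 0)\<^sup>2 \<le> 2 - p \<bullet> p" using A0[of "\<tau> 0"] ell[of "P 0"] qP[of 0] A_hit by simp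
    have pp1: "p \<bullet> p \<le> 1" "0 \<le> p \<bullet> p"
      using pp zero_le_power2[of "T 0"] inner_ge_zero[of p] by linarith+
    \<comment> \<open>The negative time at which the incoming line crosses the sphere of radius 2,
      since \<open>p\<close> is orthogonal to the direction.\<close>
    define t0 where "t0 = - sqrt (4 - p \<bullet> p)"
    have t0: "t0\<^sup>2 = 4 - p \<bullet> p" "t0 < 0" using pp1 by (auto simp: t0_def)
    have le2: "norm y \<le> 2" if "(norm y)\<^sup>2 \<le> 4" for y :: 'a
      using that power2_le_imp_le[of "norm y" 2] by simp
    have lt_t0: "t0 < \<tau> 0"
    proof (rule ccontr)
      assume "\<not> ?thesis"
      then have "\<bar>t0\<bar> \<le> \<bar>\<tau> 0\<bar>" using t0(2) by linarith
      then have "t0\<^sup>2 \<le> (\<tau> 0)\<^sup>2" by (simp add: abs_le_square_iff)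
      then show False using t0 \<tau>0 by simp
    qed
    have before: "\<gamma> t \<notin> cball 0 2" if "t < t0" for t
    proof
      assume "\<gamma> t \<in> cball 0 2"
      then have "(norm (\<gamma> t))\<^sup>2 \<le> 2\<^sup>2" by (intro power_mono) auto
      moreover have "t0\<^sup>2 < t\<^sup>2" using that t0(2) abs_le_square_iff[of t t0] by linarith
      ultimately show False using A0[of t] \<gamma>0[of t] that lt_t0 t0(1) by simp
    qed
    have after: "\<gamma> t \<in> cball 0 2" if t: "t0 \<le> t" for t
    proof (rule time_cases[of t])
      assume lt: "t < \<tau> 0"
      have "t\<^sup>2 \<le> 4 - p \<bullet> p"
      proof (cases "t \<le> 0")
        case True
        then have "\<bar>t\<bar> \<le> \<bar>t0\<bar>" using t by linarith
        then show ?thesis using t0(1) by (simp add: abs_le_square_iff)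
      next
        case False
        then have "\<bar>t\<bar> \<le> \<bar>\<tau> 0\<bar>" using lt by linarith
        then have "t\<^sup>2 \<le> (\<tau> 0)\<^sup>2" by (simp add: abs_le_square_iff)
        then show ?thesis using \<tau>0 by simp
      qed
      then show ?thesis using A0[of t] \<gamma>0[of t] lt le2[of "\<gamma> t"] by simp
    next
      fix k assume "t = \<tau> k"
      then have "\<gamma> t = P k" using \<gamma>S[of k t] \<tau>S[of k] A_hit[of k] by simp
      then show ?thesis using ell[of "P k"] qP[of k] le2[of "\<gamma> t"] by simp
    next
      fix k assume "\<tau> k < t" "t < \<tau> (Suc k)"
      then show ?thesis using inside_S[of k t] \<gamma>S[of k t] ell[of "\<gamma> t"] le2[of "\<gamma> t"] by simp
    qed
    show ?thesis unfolding enters_and_remains_in_def using before after by blast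
  qed
  ultimately show ?thesis by blast
qed

section \<open>The family of focal rays\<close>

lemma smooth_on_fst: "open S \<Longrightarrow> smooth_on S f \<Longrightarrow> smooth_on S (\<lambda>x. fst (f x))"
  by (rule smooth_on_bounded_linear[OF _ bounded_linear_fst])

lemma smooth_on_snd: "open S \<Longrightarrow> smooth_on S f \<Longrightarrow> smooth_on S (\<lambda>x. snd (f x))"
  by (rule smooth_on_bounded_linear[OF _ bounded_linear_snd])

lemma dim_orthogonal_pair:
  fixes e b :: "'a::euclidean_space"
  assumes "e \<bullet> e = 1" "b \<bullet> b = 1" "b \<bullet> e = 0"
  shows "dim {x. e \<bullet> x = 0 \<and> b \<bullet> x = 0} = DIM('a) - 2"
proof -
  have ne: "e \<noteq> b" "e \<noteq> 0" "b \<noteq> 0" using assms by auto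
  have "pairwise orthogonal {e, b}"
    using assms by (auto simp: pairwise_def orthogonal_def inner_commute)
  then have "independent {e, b}" using ne by (intro pairwise_orthogonal_independent) auto
  then have d: "dim (span {e, b}) = 2" using ne by (simp add: dim_eq_card_independent)
  have "{x. e \<bullet> x = 0 \<and> b \<bullet> x = 0} = {y \<in> UNIV. \<forall>x\<in>span {e, b}. orthogonal x y}"
  proof (intro equalityI subsetI)
    fix y assume y: "y \<in> {x. e \<bullet> x = 0 \<and> b \<bullet> x = 0}"
    have "orthogonal y x" if "x \<in> span {e, b}" for x
      using that by (rule orthogonal_to_span) (use y in \<open>auto simp: orthogonal_def inner_commute\<close>)
    then show "y \<in> {y \<in> UNIV. \<forall>x\<in>span {e, b}. orthogonal x y}" by (simp add: orthogonal_commute)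
  next
    fix y assume "y \<in> {y \<in> UNIV. \<forall>x\<in>span {e, b}. orthogonal x y}"
    then show "y \<in> {x. e \<bullet> x = 0 \<and> b \<bullet> x = 0}"
      using span_base[of e "{e, b}"] span_base[of b "{e, b}"] by (auto simp: orthogonal_def)
  qed
  then show ?thesis
    using dim_subspace_orthogonal_to_vectors[OF subspace_span subspace_UNIV subset_UNIV, of "{e, b}"] d
    by simp
qed

text \<open>Lines are parametrised by their direction and their intersection with the equatorial
  hyperplane; the radial coordinates of both, and \<open>u \<bullet> p\<close>, are replaced by the defining functions of
  the family.\<close>

lemma focal_rays_submanifold:
  fixes e b :: "'a::euclidean_space"
  assumes e: "e \<bullet> e = 1" and b: "b \<bullet> b = 1" "b \<bullet> e = 0"
  obtains F where "F \<noteq> {}" "submanifold_of_lines (2 * DIM('a) - 3) F"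
    "\<And>l. l \<in> F \<Longrightarrow> \<exists>s. entering e s \<and> l = line_of_state s"
proof -
  define perp where "perp y = y - (y \<bullet> e) *\<^sub>R e" for y
  define rad where "rad y = y - (y \<bullet> b) *\<^sub>R b" for y
  have perp_e: "perp y \<bullet> e = 0" for y using e by (simp add: perp_def inner_diff_left)
  have perp_id: "perp y = y" if "y \<bullet> e = 0" for y using that by (simp add: perp_def)
  have perp_add: "perp (x + t *\<^sub>R e) = x" if "x \<bullet> e = 0" for x t
    using that e by (simp add: perp_def inner_add_left)
  have perp_sq: "perp y \<bullet> perp y = y \<bullet> y - (y \<bullet> e)\<^sup>2" for y
    using e by (simp add: perp_def inner_diff_left inner_diff_right inner_commute power2_eq_square)
  have rad_b: "rad y \<bullet> b = 0" for y using b by (simp add: rad_def inner_diff_left)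
  have rad_e: "rad y \<bullet> e = y \<bullet> e" for y using b by (simp add: rad_def inner_diff_left)
  have rad_add: "rad (x + t *\<^sub>R b) = x" if "x \<bullet> b = 0" for x t
    using that b by (simp add: rad_def inner_add_left)
  have rad_sq: "rad y \<bullet> rad y = y \<bullet> y - (y \<bullet> b)\<^sup>2" for y
    using b by (simp add: rad_def inner_diff_left inner_diff_right inner_commute power2_eq_square)
  define foc :: "'a \<times> 'a \<Rightarrow> 'a" where "foc l = snd l - ((snd l \<bullet> e) / (fst l \<bullet> e)) *\<^sub>R fst l" for l
  define U where "U = {l :: 'a \<times> 'a. fst l \<bullet> e < 0} \<inter>
     (\<lambda>l. (perp (fst l) \<bullet> perp (fst l), foc l \<bullet> b)) -` ({..<1/100} \<times> {0<..})"
  define \<phi> where "\<phi> l = (perp (fst l) + (fst l \<bullet> fst l - 1) *\<^sub>R e,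
     rad (foc l) + (foc l \<bullet> foc l - 1) *\<^sub>R b + (fst l \<bullet> snd l) *\<^sub>R e)" for l
  \<comment> \<open>In the new coordinates \<open>z\<close> and \<open>r\<close> are the squares of
    \<open>fst l \<bullet> e\<close> and \<open>foc l \<bullet> b\<close>. The signs fixed in
    \<open>U\<close> select the square roots.\<close>
  define z where "z x = 1 + fst x \<bullet> e - perp (fst x) \<bullet> perp (fst x)" for x :: "'a \<times> 'a"
  define r where "r x = 1 + perp (snd x) \<bullet> b - rad (perp (snd x)) \<bullet> rad (perp (snd x))" for x :: "'a \<times> 'a"
  define V where "V = {x. z x > 0 \<and> perp (fst x) \<bullet> perp (fst x) < 1/100 \<and> r x > 0}"
  define u where "u x = perp (fst x) - sqrt (z x) *\<^sub>R e" for x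
  define f where "f x = rad (perp (snd x)) + sqrt (r x) *\<^sub>R b" for x
  \<comment> \<open>Chosen so that the point \<open>f x + t x *\<^sub>R u x\<close> has the
    prescribed inner product \<open>snd x \<bullet> e\<close> with \<open>u x\<close>.\<close>
  define t where "t x = (snd x \<bullet> e - f x \<bullet> u x) / (1 + fst x \<bullet> e)" for x
  define \<psi> where "\<psi> x = (u x, f x + t x *\<^sub>R u x)" for x
  have cf: "continuous_on {l. fst l \<bullet> e < 0} foc"
    unfolding foc_def[abs_def] by (intro continuous_intros) auto
  have op0: "open {l :: 'a \<times> 'a. fst l \<bullet> e < 0}" by (intro open_Collect_less continuous_intros)
  have opU: "open U"
    unfolding U_def
    by (intro continuous_open_preimage continuous_on_Pair continuous_on_inner cf op0 open_Times)
      (auto simp: perp_def intro!: continuous_intros)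
  have opV: "open V"
    unfolding V_def z_def r_def perp_def rad_def
    by (intro open_Collect_conj open_Collect_less continuous_intros)
  have ue: "u x \<bullet> e = - sqrt (z x)" for x using e perp_e by (simp add: u_def inner_diff_left)
  have perp_u: "perp (u x) = perp (fst x)" for x
    using perp_add[OF perp_e, of "fst x" "- sqrt (z x)"] by (simp add: u_def)
  have uu: "u x \<bullet> u x = 1 + fst x \<bullet> e" if "x \<in> V" for x
    using perp_sq[of "u x"] that unfolding perp_u ue by (simp add: V_def z_def)
  have uu0: "1 + fst x \<bullet> e > 0" if "x \<in> V" for x
    using that inner_ge_zero[of "perp (fst x)"] unfolding V_def z_def mem_Collect_eq by linarith
  have fe: "f x \<bullet> e = 0" for x using b perp_e by (simp add: f_def inner_add_left rad_e)
  have rad_f: "rad (f x) = rad (perp (snd x))" for x using rad_add[OF rad_b] by (simp add: f_def)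
  have fb: "f x \<bullet> b = sqrt (r x)" for x using b rad_b by (simp add: f_def inner_add_left)
  have ff: "f x \<bullet> f x = 1 + perp (snd x) \<bullet> b" if "x \<in> V" for x
    using rad_sq[of "f x"] that unfolding rad_f fb by (simp add: V_def r_def)
  have foc\<psi>: "foc (\<psi> x) = f x" if "x \<in> V" for x
    using that ue[of x] fe[of x] by (simp add: foc_def \<psi>_def V_def inner_add_left)
  have up: "u x \<bullet> (f x + t x *\<^sub>R u x) = snd x \<bullet> e" if "x \<in> V" for x
    using uu[OF that] uu0[OF that] by (simp add: inner_add_right t_def inner_commute)
  have perp_split: "perp y + (y \<bullet> e) *\<^sub>R e = y" for y by (simp add: perp_def)
  have rad_split: "rad y + (y \<bullet> b) *\<^sub>R b = y" for y by (simp add: rad_def)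
  have \<phi>\<psi>: "\<phi> (\<psi> x) = x" if x: "x \<in> V" for x
  proof -
    have "fst (\<phi> (\<psi> x)) = fst x"
      using uu[OF x] perp_u[of x] perp_split[of "fst x"] by (simp add: \<phi>_def \<psi>_def)
    moreover have "snd (\<phi> (\<psi> x)) = rad (f x) + (f x \<bullet> f x - 1) *\<^sub>R b + (snd x \<bullet> e) *\<^sub>R e"
      using foc\<psi>[OF x] up[OF x] by (simp add: \<phi>_def) (simp add: \<psi>_def)
    then have "snd (\<phi> (\<psi> x)) = snd x"
      using ff[OF x] rad_f[of x] rad_split[of "perp (snd x)"] perp_split[of "snd x"] by simp
    ultimately show ?thesis by (simp add: prod_eq_iff)
  qed
  have foc_e: "foc l \<bullet> e = 0" if "l \<in> U" for l
    using that by (simp add: foc_def U_def inner_diff_left)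
  have fst\<phi>: "perp (fst (\<phi> l)) = perp (fst l)" "fst (\<phi> l) \<bullet> e = fst l \<bullet> fst l - 1" for l
    using perp_add[OF perp_e] e perp_e by (auto simp: \<phi>_def inner_add_left)
  have z\<phi>: "z (\<phi> l) = (fst l \<bullet> e)\<^sup>2" for l
    unfolding z_def fst\<phi> using perp_sq[of "fst l"] by simp
  have u\<phi>: "u (\<phi> l) = fst l" if "l \<in> U" for l
    using that perp_split[of "fst l"] unfolding u_def z\<phi> fst\<phi> by (simp add: U_def abs_of_neg)
  have snd\<phi>: "perp (snd (\<phi> l)) = rad (foc l) + (foc l \<bullet> foc l - 1) *\<^sub>R b" "snd (\<phi> l) \<bullet> e = fst l \<bullet> snd l"
    if "l \<in> U" for l
  proof -
    have 0: "(rad (foc l) + (foc l \<bullet> foc l - 1) *\<^sub>R b) \<bullet> e = 0"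
      using foc_e[OF that] b(2) by (simp add: inner_add_left rad_e)
    show "perp (snd (\<phi> l)) = rad (foc l) + (foc l \<bullet> foc l - 1) *\<^sub>R b"
      using perp_add[OF 0] by (simp add: \<phi>_def)
    show "snd (\<phi> l) \<bullet> e = fst l \<bullet> snd l"
      using 0 e by (simp add: \<phi>_def inner_add_left)
  qed
  have r\<phi>: "r (\<phi> l) = (foc l \<bullet> b)\<^sup>2" "rad (perp (snd (\<phi> l))) = rad (foc l)" if "l \<in> U" for l
    using rad_add[OF rad_b[of "foc l"]] rad_b[of "foc l"] b rad_sq[of "foc l"]
    unfolding r_def snd\<phi>(1)[OF that] by (auto simp: inner_add_left)
  have f\<phi>: "f (\<phi> l) = foc l" if "l \<in> U" for l
    using that rad_split[of "foc l"] unfolding f_def r\<phi>[OF that] by (simp add: U_def)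
  have \<psi>\<phi>: "\<psi> (\<phi> l) = l" if l: "l \<in> U" for l
  proof -
    define k where "k = (snd l \<bullet> e) / (fst l \<bullet> e)"
    have fl: "foc l = snd l - k *\<^sub>R fst l" by (simp add: foc_def k_def)
    have "fst l \<noteq> 0" using l by (auto simp: U_def)
    then have "t (\<phi> l) = k"
      unfolding t_def snd\<phi>(2)[OF l] fst\<phi>(2) f\<phi>[OF l] u\<phi>[OF l]
      by (simp add: fl inner_diff_left inner_diff_right inner_commute)
    then show ?thesis using u\<phi>[OF l] f\<phi>[OF l] fl by (simp add: \<psi>_def prod_eq_iff)
  qed
  have \<phi>V: "\<phi> l \<in> V" if "l \<in> U" for l
    using that z\<phi>[of l] r\<phi>(1)[OF that] fst\<phi>(1)[of l] by (simp add: V_def U_def)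
  have \<psi>U: "\<psi> x \<in> U" if "x \<in> V" for x
    using that ue[of x] perp_u[of x] foc\<psi>[OF that] fb[of x] by (simp add: U_def V_def) (simp add: \<psi>_def)
  note sm = smooth_on_add smooth_on_diff smooth_on_scaleR smooth_on_inner smooth_on_const smooth_on_ident
    smooth_on_fst smooth_on_snd smooth_on_Pair
  have U0: "fst l \<bullet> e \<noteq> 0" if "l \<in> U" for l using that by (simp add: U_def)
  have sfoc: "smooth_on U foc"
    unfolding foc_def[abs_def] by (intro sm smooth_on_divide opU U0)
  have s\<phi>: "smooth_on U \<phi>"
    unfolding \<phi>_def[abs_def] perp_def rad_def by (intro sm opU sfoc)
  have sz: "smooth_on V z" unfolding z_def[abs_def] perp_def by (intro sm opV)
  have sr: "smooth_on V r" unfolding r_def[abs_def] perp_def rad_def by (intro sm opV)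
  have pos: "z x > 0" "r x > 0" if "x \<in> V" for x using that by (auto simp: V_def)
  have su: "smooth_on V u"
    unfolding u_def[abs_def] perp_def by (intro sm smooth_on_sqrt opV sz pos)
  have sf: "smooth_on V f"
    unfolding f_def[abs_def] perp_def rad_def by (intro sm smooth_on_sqrt opV sr pos)
  have V0: "1 + fst x \<bullet> e \<noteq> 0" if "x \<in> V" for x using uu0[OF that] by simp
  have stt: "smooth_on V t"
    unfolding t_def[abs_def] by (intro sm smooth_on_divide opV su sf V0)
  have s\<psi>: "smooth_on V \<psi>"
    unfolding \<psi>_def[abs_def] by (intro sm opV su sf stt)
  have diffeo: "diffeomorphism U V \<phi> \<psi>"
    unfolding diffeomorphism_def
  proof (intro conjI opU opV s\<phi> s\<psi> homeomorphismI)
    show "continuous_on U \<phi>" "continuous_on V \<psi>"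
      using s\<phi> s\<psi> smooth_on_imp_continuous_on by blast+
  qed (use \<phi>V \<psi>U \<phi>\<psi> \<psi>\<phi> in auto)
  define S where "S = {x. e \<bullet> x = 0} \<times> {x. e \<bullet> x = 0 \<and> b \<bullet> x = 0}"
  have sub2: "subspace {x. e \<bullet> x = 0 \<and> b \<bullet> x = 0}"
    using subspace_inter[OF subspace_hyperplane subspace_hyperplane, of e b] by (simp add: Int_def)
  have subS: "subspace S" unfolding S_def by (intro subspace_Times subspace_hyperplane sub2)
  have "DIM('a) \<ge> 2"
  proof -
    have "dim {x. e \<bullet> x = 0} = DIM('a) - 1" using e by (intro dim_hyperplane) auto
    moreover have "b \<in> {x. e \<bullet> x = 0}" "b \<noteq> 0" using b by (auto simp: inner_commute)
    then have "dim {x. e \<bullet> x = 0} \<noteq> 0" using dim_eq_0 by (metis singletonD subsetD)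
    ultimately show ?thesis by linarith
  qed
  moreover have "e \<noteq> 0" using e by auto
  ultimately have dimS: "dim S = 2 * DIM('a) - 3"
    unfolding S_def dim_Times[OF subspace_hyperplane sub2]
    by (simp add: dim_orthogonal_pair[OF e b] dim_hyperplane)
  define F where "F = \<psi> ` (V \<inter> S)"
  have state: "\<exists>s. entering e s \<and> l = line_of_state s" if l: "l \<in> F" for l
  proof -
    obtain x where x: "x \<in> V" "x \<in> S" "l = \<psi> x" using l unfolding F_def by blast
    then have S0: "fst x \<bullet> e = 0" "snd x \<bullet> e = 0" "snd x \<bullet> b = 0" by (auto simp: S_def inner_commute)
    then have 1: "f x \<bullet> f x = 1" "u x \<bullet> u x = 1" "t x = - (f x \<bullet> u x)"
      using ff[OF x(1)] uu[OF x(1)] by (simp_all add: perp_id t_def)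
    \<comment> \<open>The bound 1/100 on the horizontal part in \<open>V\<close> is what makes the
      rays steep enough for \<open>entering\<close>.\<close>
    have zx: "z x > 99/100" using x(1) S0 by (simp add: V_def z_def)
    then have "entering e (f x, u x)"
      using 1 fe[of x] ue[of x] by (simp add: entering_def focal_def)
    moreover have "l = line_of_state (f x, u x)" by (simp add: line_of_state_def x(3) \<psi>_def 1(3))
    ultimately show ?thesis by blast
  qed
  show thesis
  proof (rule that[OF _ _ state])
    \<comment> \<open>The origin corresponds to the vertical ray pointing down through the point
      \<open>b\<close> of the focal sphere.\<close>
    have "(0 :: 'a \<times> 'a) \<in> V \<inter> S" by (simp add: V_def z_def r_def perp_def rad_def S_def zero_prod_def)
    then show "F \<noteq> {}" unfolding F_def by blast
    have "F \<subseteq> oriented_lines"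
    proof
      fix l assume "l \<in> F"
      then obtain s where s: "entering e s" "l = line_of_state s" using state by blast
      then show "l \<in> oriented_lines"
        by (auto simp: line_of_state_def oriented_lines_def entering_def focal_def norm_eq_1 inner_diff_left)
    qed
    moreover have "F \<subseteq> U" using \<psi>U by (auto simp: F_def)
    moreover have "\<phi> ` F = V \<inter> S" using \<phi>\<psi> by (force simp: F_def)
    then have "\<phi> ` (U \<inter> F) = V \<inter> S" using \<open>F \<subseteq> U\<close> by (simp add: Int_absorb1)
    ultimately show "submanifold_of_lines (2 * DIM('a) - 3) F"
      unfolding submanifold_of_lines_def embedded_submanifold_def manifold_interior_def
      using diffeo subS dimS by blast
  qed
qed

theorem theorem1p1:
  assumes "CARD('n::finite) \<ge> 2"
  shows
    "(\<forall>(T :: (real ^ 'n) set set) F.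
        trap T \<longrightarrow> openin (top_of_set oriented_lines) F \<longrightarrow> F \<noteq> {} \<longrightarrow>
        \<not> trapped_family T F) \<and>
     (\<exists>(T :: (real ^ 'n) set set) F.
        trap T \<and> F \<noteq> {} \<and> submanifold_of_lines (2 * CARD('n) - 3) F \<and> trapped_family T F) \<and>
     (\<forall>d (T :: (real ^ 'n) set set) F.
        trap T \<longrightarrow> F \<noteq> {} \<longrightarrow> submanifold_of_lines d F \<longrightarrow> trapped_family T F \<longrightarrow>
        d \<le> 2 * CARD('n) - 3)"
proof (intro conjI allI impI)
  fix T :: "(real ^ 'n) set set" and F :: "((real ^ 'n) \<times> (real ^ 'n)) set"
  assume "trap T" "openin (top_of_set oriented_lines) F" "F \<noteq> {}"
  then show "\<not> trapped_family T F" by (rule open_not_trapped)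
next
  fix d and T :: "(real ^ 'n) set set" and F :: "((real ^ 'n) \<times> (real ^ 'n)) set"
  assume "trap T" "F \<noteq> {}" "submanifold_of_lines d F" "trapped_family T F"
  then show "d \<le> 2 * CARD('n) - 3" using assms by (rule trapped_family_dimension)
next
  \<comment> \<open>Dimension at least 2 provides two orthogonal unit vectors: the axis
    \<open>e\<close> of the ellipsoid and a point \<open>b\<close> of its focal sphere.\<close>
  have "\<not> CARD('n) \<le> 1" using assms by simp
  then obtain i j :: 'n where "i \<noteq> j"
    using card_le_Suc0_iff_eq[of "UNIV :: 'n set"] by auto
  define e b :: "real ^ 'n" where "e = axis i 1" and "b = axis j 1"
  have e: "e \<bullet> e = 1" and b: "b \<bullet> b = 1" "b \<bullet> e = 0"
    using \<open>i \<noteq> j\<close> by (auto simp: e_def b_def inner_axis_axis)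
  then have ne: "norm e = 1" by (simp add: norm_eq_1)
  obtain F :: "((real ^ 'n) \<times> (real ^ 'n)) set"
    where F: "F \<noteq> {}" "submanifold_of_lines (2 * DIM(real^'n) - 3) F"
    "\<And>l. l \<in> F \<Longrightarrow> \<exists>s. entering e s \<and> l = line_of_state s"
    using focal_rays_submanifold[OF e b] by blast
  have "norm y < 2" if "y \<in> bowl e" for y
  proof -
    have "(norm y)\<^sup>2 < 4"
      using that zero_le_power2[of "y \<bullet> e"] unfolding bowl_def ellipsoid_form_def power2_norm_eq_inner mem_Collect_eq
      by linarith
    then show ?thesis using power2_less_imp_less[of "norm y" 2] by simp
  qed
  then have "\<Union>{bowl e} \<subseteq> interior (cball 0 2)" by auto
  moreover have "\<exists>\<gamma>. nonsingular_trajectory {bowl e} \<gamma> \<and> comes_from_infinity_along l \<gamma> \<and>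
      enters_and_remains_in (cball 0 2) \<gamma>" if "l \<in> F" for l
    using F(3)[OF that] entering_ray_trapped[OF ne] by blast
  moreover have "F \<subseteq> oriented_lines" using F(2) by (simp add: submanifold_of_lines_def)
  ultimately have "trapped_family {bowl e} F"
    unfolding trapped_family_def using zero_less_numeral by blast
  then show "\<exists>(T :: (real ^ 'n) set set) F.
        trap T \<and> F \<noteq> {} \<and> submanifold_of_lines (2 * CARD('n) - 3) F \<and> trapped_family T F"
    using trap_bowl[OF ne] F(1,2) by (intro exI[of _ "{bowl e}"] exI[of _ F]) simp
qed

end
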